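(* The following holds. (a) If $T_n=\Omega(n\ln n)$, then $\sigma_1(\hat N-N)=O_{\mathbb P}(\sqrt{T_n/n})$. (b) If $T_n=\omega(n)$ and $\Gamma^{\mathrm c}=[n]\setminus\Gamma$ is a (random) set of size $\lfloor n e^{-T_n/n}\rfloor$ containing the states with highest number of visits, i.e. with the property that $$\min_{y\in\Gamma^{\mathrm c}}\hat N_{[n],y}\ \ge\ \max_{y\in\Gamma}\hat N_{[n],y},$$ then $\sigma_1(\hat N_\Gamma-N)=O_{\mathbb P}(\sqrt{T_n/n})$.
   Context: Block Markov chain (BMC). Fix $K\ge1$, cluster ratios $\alpha=(\alpha_1,\dots,\alpha_K)$ with $\sum_k\alpha_k=1$ and $\min_k\alpha_k>0$, and a row-stochastic matrix $p=(p_{kl})_{k,l\in[K]}$ with $\min_{k,l}p_{kl}>0$ and $\mathrm{rank}(p)=K$; $\alpha,p,K$ do not depend on $n$. Write $[n]=\{1,\dots,n\}$. For each $n$ (large enough that all clusters are nonempty) the state space $[n]$ is partitioned into clusters $\mathcal V_1,\dots,\mathcal V_K$ with $|\mathcal V_k|=\lfloor n\alpha_k\rfloor$ for $k=2,\dots,K$ and $|\mathcal V_1|=n-\sum_{k=2}^K|\mathcal V_k|$; $\sigma:[n]\to[K]$ maps each state to the index of its cluster. The BMC $\{X_t\}_{t\ge0}$ is the homogeneous Markov chain on $[n]$ with transition matrix $P_{x,y}=p_{\sigma(x),\sigma(y)}/|\mathcal V_{\sigma(y)}|$; $\Pi$ denotes its unique stationary distribution, and $X_0$ has distribution $\Pi$.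 Given positive integers $T_n$, $\hat N$ is the random $n\times n$ matrix of transition counts $\hat N_{xy}=\sum_{t=0}^{T_n-1}\mathbf 1[X_t=x,X_{t+1}=y]$, and $N=\mathbb E[\hat N]$, i.e. $N_{xy}=T_n\Pi_xP_{x,y}$. Put $\hat N_{[n],y}=\sum_{x\in[n]}\hat N_{x,y}$. For a (possibly random) $\Gamma\subseteq[n]$, the trimmed matrix $\hat N_\Gamma$ has entries $(\hat N_\Gamma)_{x,y}=\hat N_{x,y}$ if $x,y\in\Gamma$ and $0$ otherwise. If $\Gamma^{\mathrm c}$ is empty the condition on it is void. $\sigma_1(A)$ denotes the largest singular value (spectral norm) of a matrix $A$. $X_n=O_{\mathbb P}(Y_n)$ means: for every $\epsilon>0$ there are $C_\epsilon,n_\epsilon>0$ with $\mathbb P[|X_n/Y_n|>C_\epsilon]\le\epsilon$ for all $n>n_\epsilon$. $T_n=\Omega(n\ln n)$ means $T_n\ge c\,n\ln n$ for some $c>0$ and all large $n$; $T_n=\omega(n)$ means $T_n/n\to\infty$. *)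

theory Defs
  imports
    "HOL-Probability.Probability"
    "HOL-Library.Landau_Symbols"
    "Jordan_Normal_Form.DL_Rank"
    "Jordan_Normal_Form.Char_Poly"
begin

(* Index sets are {1..n} as in the mathematics, while library matrices are indexed from 0;
   this is the only place where the shift happens. *)
definition matrix_of :: "nat \<Rightarrow> (nat \<Rightarrow> nat \<Rightarrow> real) \<Rightarrow> real mat" where
  "matrix_of n f = mat n n (\<lambda>(i, j). f (Suc i) (Suc j))"

definition singular_values :: "real mat \<Rightarrow> real set" where
  "singular_values A = {sqrt l | l. eigenvalue (transpose_mat A * A) l}"

(* Only used for matrices with at least one column, where the set is finite and nonempty. *)
definition sigma_max :: "real mat \<Rightarrow> real" where
  "sigma_max A = Max (singular_values A)"

definition bmc_parameters :: "nat \<Rightarrow> (nat \<Rightarrow> real) \<Rightarrow> (nat \<Rightarrow> nat \<Rightarrow> real) \<Rightarrow> bool" where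
  "bmc_parameters K \<alpha> p \<longleftrightarrow>
     K \<ge> 1 \<and>
     (\<Sum>k=1..K. \<alpha> k) = 1 \<and> (\<forall>k\<in>{1..K}. \<alpha> k > 0) \<and>
     (\<forall>k\<in>{1..K}. (\<Sum>l=1..K. p k l) = 1) \<and>
     (\<forall>k\<in>{1..K}. \<forall>l\<in>{1..K}. p k l > 0) \<and>
     vec_space.rank K (matrix_of K p) = K"

(* The natural number subtraction does not truncate when the ratios are positive and sum to 1. *)
definition cluster_size :: "nat \<Rightarrow> (nat \<Rightarrow> real) \<Rightarrow> nat \<Rightarrow> nat \<Rightarrow> nat" where
  "cluster_size K \<alpha> n k =
     (if k = 1 then n - (\<Sum>j=2..K. nat \<lfloor>real n * \<alpha> j\<rfloor>) else nat \<lfloor>real n * \<alpha> k\<rfloor>)"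

definition clusters_nonempty :: "nat \<Rightarrow> (nat \<Rightarrow> real) \<Rightarrow> nat \<Rightarrow> bool" where
  "clusters_nonempty K \<alpha> n \<longleftrightarrow> (\<forall>k\<in>{1..K}. cluster_size K \<alpha> n k > 0)"

definition cluster :: "nat \<Rightarrow> (nat \<Rightarrow> nat) \<Rightarrow> nat \<Rightarrow> nat set" where
  "cluster n \<sigma> k = {x \<in> {1..n}. \<sigma> x = k}"

definition cluster_assignment :: "nat \<Rightarrow> (nat \<Rightarrow> real) \<Rightarrow> nat \<Rightarrow> (nat \<Rightarrow> nat) \<Rightarrow> bool" where
  "cluster_assignment K \<alpha> n \<sigma> \<longleftrightarrow>
     \<sigma> \<in> {1..n} \<rightarrow> {1..K} \<and>
     (\<forall>k\<in>{1..K}. card (cluster n \<sigma> k) = cluster_size K \<alpha> n k)"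

definition bmc_transition ::
    "(nat \<Rightarrow> nat \<Rightarrow> real) \<Rightarrow> nat \<Rightarrow> (nat \<Rightarrow> nat) \<Rightarrow> nat \<Rightarrow> nat \<Rightarrow> real" where
  "bmc_transition p n \<sigma> x y = p (\<sigma> x) (\<sigma> y) / real (card (cluster n \<sigma> (\<sigma> y)))"

definition stationary_distribution ::
    "nat \<Rightarrow> (nat \<Rightarrow> nat \<Rightarrow> real) \<Rightarrow> (nat \<Rightarrow> real) \<Rightarrow> bool" where
  "stationary_distribution n P \<pi> \<longleftrightarrow>
     (\<forall>x\<in>{1..n}. \<pi> x \<ge> 0) \<and> (\<Sum>x=1..n. \<pi> x) = 1 \<and>
     (\<forall>y\<in>{1..n}. (\<Sum>x=1..n. \<pi> x * P x y) = \<pi> y)"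

definition markov_chain ::
    "nat \<Rightarrow> (nat \<Rightarrow> nat \<Rightarrow> real) \<Rightarrow> (nat \<Rightarrow> real) \<Rightarrow> 'a measure \<Rightarrow> (nat \<Rightarrow> 'a \<Rightarrow> nat) \<Rightarrow> bool" where
  "markov_chain n P \<mu> M X \<longleftrightarrow>
     prob_space M \<and>
     (\<forall>t. X t \<in> M \<rightarrow>\<^sub>M count_space {1..n}) \<and>
     (\<forall>x\<in>{1..n}. \<P>(\<omega> in M. X 0 \<omega> = x) = \<mu> x) \<and>
     (\<forall>t z. \<forall>y\<in>{1..n}. \<P>(\<omega> in M. \<forall>s\<le>t. X s \<omega> = z s) > 0 \<longrightarrow>
        \<P>(\<omega> in M. X (Suc t) \<omega> = y \<bar> \<forall>s\<le>t. X s \<omega> = z s) = P (z t) y)"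

(* The chain has a unique stationary distribution, so \<pi> is determined on {1..n}. *)
definition block_markov_chain ::
    "nat \<Rightarrow> (nat \<Rightarrow> real) \<Rightarrow> (nat \<Rightarrow> nat \<Rightarrow> real) \<Rightarrow> nat \<Rightarrow> (nat \<Rightarrow> nat) \<Rightarrow>
      'a measure \<Rightarrow> (nat \<Rightarrow> 'a \<Rightarrow> nat) \<Rightarrow> bool" where
  "block_markov_chain K \<alpha> p n \<sigma> M X \<longleftrightarrow>
     cluster_assignment K \<alpha> n \<sigma> \<and>
     (\<exists>\<pi>. stationary_distribution n (bmc_transition p n \<sigma>) \<pi> \<and>
          markov_chain n (bmc_transition p n \<sigma>) \<pi> M X)"

definition transition_count :: "(nat \<Rightarrow> 'a \<Rightarrow> nat) \<Rightarrow> nat \<Rightarrow> 'a \<Rightarrow> nat \<Rightarrow> nat \<Rightarrow> real" where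
  "transition_count X T \<omega> x y = (\<Sum>t<T. of_bool (X t \<omega> = x \<and> X (Suc t) \<omega> = y))"

definition mean_count :: "'a measure \<Rightarrow> (nat \<Rightarrow> 'a \<Rightarrow> nat) \<Rightarrow> nat \<Rightarrow> nat \<Rightarrow> nat \<Rightarrow> real" where
  "mean_count M X T x y = (\<integral>\<omega>. transition_count X T \<omega> x y \<partial>M)"

definition visits :: "nat \<Rightarrow> (nat \<Rightarrow> 'a \<Rightarrow> nat) \<Rightarrow> nat \<Rightarrow> 'a \<Rightarrow> nat \<Rightarrow> real" where
  "visits n X T \<omega> y = (\<Sum>x=1..n. transition_count X T \<omega> x y)"

definition trimmed_count ::
    "nat set \<Rightarrow> (nat \<Rightarrow> 'a \<Rightarrow> nat) \<Rightarrow> nat \<Rightarrow> 'a \<Rightarrow> nat \<Rightarrow> nat \<Rightarrow> real" where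
  "trimmed_count G X T \<omega> x y = (if x \<in> G \<and> y \<in> G then transition_count X T \<omega> x y else 0)"

(* G is the random set of states that are kept. *)
definition trimming ::
    "nat \<Rightarrow> nat \<Rightarrow> 'a measure \<Rightarrow> (nat \<Rightarrow> 'a \<Rightarrow> nat) \<Rightarrow> ('a \<Rightarrow> nat set) \<Rightarrow> bool" where
  "trimming n T M X G \<longleftrightarrow>
     G \<in> M \<rightarrow>\<^sub>M count_space (Pow {1..n}) \<and>
     (\<forall>\<omega>\<in>space M.
        int (card ({1..n} - G \<omega>)) = \<lfloor>real n * exp (- (real T / real n))\<rfloor> \<and>
        ({1..n} - G \<omega> \<noteq> {} \<longrightarrow>
          Min (visits n X T \<omega> ` ({1..n} - G \<omega>)) \<ge> Max (visits n X T \<omega> ` G \<omega>)))"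

(* Z n must be measurable on M n for large n; functions of finitely many discrete random
   variables, such as the norms of the count matrices, always are. *)
definition bigO_in_prob ::
    "(nat \<Rightarrow> 'a measure) \<Rightarrow> (nat \<Rightarrow> 'a \<Rightarrow> real) \<Rightarrow> (nat \<Rightarrow> real) \<Rightarrow> bool" where
  "bigO_in_prob M Z Y \<longleftrightarrow>
     (\<forall>\<epsilon>>0. \<exists>C>0. \<exists>n0>0. \<forall>n>n0. \<P>(\<omega> in M n. \<bar>Z n \<omega> / Y n\<bar> > C) \<le> \<epsilon>)"

end

theory Submission
  imports Defs "Jordan_Normal_Form.Spectral_Radius"
begin

text \<open>
  Let d = T / n. A block Markov chain with many states is a stationary chain whose transition
  probabilities all lie between \<delta> / n and c / n (lemma bmc_flat), and the norm bound holds for every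
  such chain. The method is that of Kahn and Szemeredi, in the form given to it by Feige and Ofek for
  sparse random graphs, with the dependence between the transitions removed as follows.

  The spectral norm is at most twice the maximum of the bilinear form over pairs (u, v) in a net of
  exp (O(n)) vectors. A pair of states (x, y) is light for (u, v) if |u x v y| is at most sqrt d / n,
  and heavy otherwise.

  For the light pairs (lemma light_tail) the centred form is a sum along the path. The Poisson equation
  for the chain, which is solvable by Doeblin's contraction, turns it into a sum of increments that
  depend on three consecutive states and are centred given the first of them. Increments starting at
  times of one parity have exponential moments that multiply, and the resulting probability
  exp (- \<kappa> n) survives the union bound over the net.

  For the heavy pairs (lemma heavy_bound) no cancellation is needed. The mean contributes O(sqrt d)
  trivially. The counts contribute O(sqrt d) for every u and v if two things hold: the row and column
  sums on the supports of u and v are O(d), and the numbers of transitions between any two sets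
  of states satisfy a Chernoff-type bound in which the logarithm of the number of sets of the given
  sizes is paid for (lemma discrepancy_failure). The latter holds with probability 1 - O(1 / n).

  It remains to bound the numbers of visits of the kept states by O(d). The expected number of states
  with more than (2 \<kappa> + 1) d visits is O(n exp (- (\<kappa> - 2 c) d)) (lemma many_busy_states). If d is at
  least a multiple of ln n, this tends to 0 for large \<kappa>, and there are no such states. If
  d merely tends to infinity, it is much smaller than n exp (- d) for \<kappa> = 2 c + 2, so with high
  probability all such states are among the removed ones.
\<close>

section \<open>Spectral norm and bilinear forms\<close>

lemma matrix_of_carrier [simp]: "matrix_of n f \<in> carrier_mat n n"
  by (simp add: matrix_of_def)

lemma matrix_of_diff:
  "matrix_of n f - matrix_of n g = matrix_of n (\<lambda>x y. f x y - g x y)"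
  by (rule eq_matI) (auto simp: matrix_of_def)

lemma matrix_of_cong:
  assumes "\<And>x y. x \<in> {1..n} \<Longrightarrow> y \<in> {1..n} \<Longrightarrow> f x y = g x y"
  shows "matrix_of n f = matrix_of n g"
  unfolding matrix_of_def using assms by (intro eq_matI) auto

lemma gram_quadratic_form:
  fixes A :: "'b :: comm_ring_1 mat"
  assumes A: "A \<in> carrier_mat n n" and w: "w \<in> carrier_vec n" and w': "w' \<in> carrier_vec n"
  shows "w' \<bullet> ((transpose_mat A * A) *\<^sub>v w) = (A *\<^sub>v w') \<bullet> (A *\<^sub>v w)"
proof -
  have "w' \<bullet> ((transpose_mat A * A) *\<^sub>v w) = w' \<bullet> (transpose_mat A *\<^sub>v (A *\<^sub>v w))"
    using assms by (subst assoc_mult_mat_vec[of _ n n _ n]) auto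
  also have "\<dots> = (A *\<^sub>v w') \<bullet> (A *\<^sub>v w)"
    using assms transpose_vec_mult_scalar[of A n n "w'" "A *\<^sub>v w"]
    by (metis comm_scalar_prod mult_mat_vec_carrier transpose_carrier_mat)
  finally show ?thesis .
qed

text \<open>A complex eigenvalue exists by the fundamental theorem of algebra; it is real because
  it is the ratio of the squared norms of A w and of w, where w is an eigenvector.
  Without this lemma the maximum defining the spectral norm could be taken over the empty set.\<close>

lemma gram_eigenvalue_exists:
  fixes A :: "real mat"
  assumes A: "A \<in> carrier_mat n n" and n: "n > 0"
  shows "\<exists>l. eigenvalue (transpose_mat A * A) l"
proof -
  define B where "B = transpose_mat A * A"
  define Ac where "Ac = map_mat complex_of_real A"
  define Bc where "Bc = map_mat complex_of_real B"
  have B: "B \<in> carrier_mat n n" and Ac: "Ac \<in> carrier_mat n n" and Bc: "Bc \<in> carrier_mat n n"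
    using A by (auto simp: B_def Ac_def Bc_def)
  have BcA: "Bc = transpose_mat Ac * Ac"
    unfolding Bc_def B_def Ac_def using A
    by (subst of_real_hom.mat_hom_mult[of _ n n _ n]) (auto intro!: arg_cong2[where f = "(*)"] eq_matI)
  obtain k where k: "eigenvalue Bc k"
    using spectrum_non_empty[OF Bc n] by (auto simp: spectrum_def)
  obtain w where w: "w \<in> carrier_vec n" "w \<noteq> 0\<^sub>v n" "Bc *\<^sub>v w = k \<cdot>\<^sub>v w"
    using k Bc by (auto simp: eigenvalue_def eigenvector_def)
  have conjAc: "Ac *\<^sub>v conjugate w = conjugate (Ac *\<^sub>v w)"
  proof (rule eq_vecI)
    fix i assume i: "i < dim_vec (conjugate (Ac *\<^sub>v w))"
    have "(Ac *\<^sub>v conjugate w) $ i = (\<Sum>j<n. of_real (A $$ (i,j)) * cnj (w $ j))"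
      using i Ac A w by (simp add: Ac_def scalar_prod_def atLeast0LessThan)
    also have "\<dots> = cnj (\<Sum>j<n. of_real (A $$ (i,j)) * (w $ j))" by simp
    also have "\<dots> = conjugate (Ac *\<^sub>v w) $ i"
      using i Ac A w by (simp add: Ac_def scalar_prod_def atLeast0LessThan)
    finally show "(Ac *\<^sub>v conjugate w) $ i = conjugate (Ac *\<^sub>v w) $ i" .
  qed (use Ac w in auto)
  have cw: "conjugate w \<in> carrier_vec n" using w by auto
  have "k * (conjugate w \<bullet> w) = conjugate w \<bullet> (Bc *\<^sub>v w)"
    using w cw by simp
  also have "\<dots> = conjugate (Ac *\<^sub>v w) \<bullet> (Ac *\<^sub>v w)"
    unfolding BcA using gram_quadratic_form[OF Ac w(1) cw] by (simp add: conjAc)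
  finally have eq: "k * (conjugate w \<bullet> w) = conjugate (Ac *\<^sub>v w) \<bullet> (Ac *\<^sub>v w)" .
  have real: "conjugate v \<bullet> v = of_real (\<Sum>i<dim_vec v. (cmod (v $ i))\<^sup>2)" for v :: "complex vec"
    by (simp add: scalar_prod_def atLeast0LessThan complex_norm_square[symmetric] mult.commute)
  have "\<exists>i<n. w $ i \<noteq> 0"
    using w by (metis eq_vecI carrier_vecD index_zero_vec)
  then have W0: "(\<Sum>i<dim_vec w. (cmod (w $ i))\<^sup>2) \<noteq> 0"
    using w by (subst sum_nonneg_eq_0_iff) auto
  obtain a b where ab: "k * complex_of_real b = complex_of_real a" "b \<noteq> 0"
    using eq W0 unfolding real by blast
  have "k = of_real (a / b)"
    using ab by (simp add: field_simps)
  then obtain l :: real where l: "k = of_real l" by blast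
  have "poly (char_poly Bc) k = 0"
    using k eigenvalue_root_char_poly[OF Bc] by simp
  moreover have "char_poly Bc = map_poly of_real (char_poly B)"
    unfolding Bc_def using of_real_hom.char_poly_hom[OF B] by simp
  ultimately have "poly (char_poly B) l = 0"
    unfolding l by (simp add: of_real_hom.poly_map_poly)
  then show ?thesis
    using eigenvalue_root_char_poly[OF B] B_def by blast
qed

text \<open>The squared Euclidean norm of a vector with coordinates in {1..n}.\<close>

abbreviation sqnorm :: "nat \<Rightarrow> (nat \<Rightarrow> real) \<Rightarrow> real" where
  "sqnorm n u \<equiv> (\<Sum>x=1..n. (u x)\<^sup>2)"

lemma abs_coord_le_1:
  assumes "sqnorm n u \<le> 1" "x \<in> {1..n}"
  shows "\<bar>u x\<bar> \<le> 1"
proof -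
  have "(u x)\<^sup>2 \<le> sqnorm n u" using assms by (intro member_le_sum) auto
  then show ?thesis using assms by (simp add: abs_square_le_1[symmetric])
qed

text \<open>The bilinear form of a matrix indexed by {1..n}. Vectors are functions, of which only
  the values on {1..n} matter.\<close>

definition bilinear_sum :: "nat \<Rightarrow> (nat \<Rightarrow> nat \<Rightarrow> real) \<Rightarrow> (nat \<Rightarrow> real) \<Rightarrow> (nat \<Rightarrow> real) \<Rightarrow> real" where
  "bilinear_sum n A u v = (\<Sum>x=1..n. \<Sum>y=1..n. u x * v y * A x y)"

lemma sigma_max_bound:
  assumes n: "n > 0" and b: "b \<ge> 0"
    and bil: "\<And>u v. \<bar>bilinear_sum n f u v\<bar> \<le> b * sqrt (sqnorm n u) * sqrt (sqnorm n v)"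
  shows "0 \<le> sigma_max (matrix_of n f)" "sigma_max (matrix_of n f) \<le> b"
proof -
  define A where "A = matrix_of n f"
  have A: "A \<in> carrier_mat n n" by (simp add: A_def)
  have G: "transpose_mat A * A \<in> carrier_mat n n" using A by auto
  have fin: "finite (singular_values A)"
  proof -
    have "singular_values A = sqrt ` spectrum (transpose_mat A * A)"
      by (auto simp: singular_values_def spectrum_def)
    then show ?thesis using card_finite_spectrum(1)[OF G] by simp
  qed
  have ne: "singular_values A \<noteq> {}"
    using gram_eigenvalue_exists[OF A n] by (auto simp: singular_values_def)
  have bd: "0 \<le> s \<and> s \<le> b" if s: "s \<in> singular_values A" for s
  proof -
    obtain l where l: "s = sqrt l" "eigenvalue (transpose_mat A * A) l"
      using s by (auto simp: singular_values_def)
    obtain w where w: "w \<in> carrier_vec n" "w \<noteq> 0\<^sub>v n" "(transpose_mat A * A) *\<^sub>v w = l \<cdot>\<^sub>v w"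
      using l G A by (auto simp: eigenvalue_def eigenvector_def)
    define y where "y = A *\<^sub>v w"
    have y: "y \<in> carrier_vec n" using A w by (auto simp: y_def)
    have idx: "(\<Sum>x=1..n. h x) = (\<Sum>i<n. h (Suc i))" for h :: "nat \<Rightarrow> real"
      by (simp add: sum.atLeast1_atMost_eq)
    have "l * (w \<bullet> w) = y \<bullet> y"
      using gram_quadratic_form[OF A w(1) w(1)] w by (simp add: y_def)
    moreover have nrm: "v \<bullet> v = (\<Sum>i<n. (v $ i)\<^sup>2)" if "v \<in> carrier_vec n" for v :: "real vec"
      using that by (simp add: scalar_prod_def power2_eq_square atLeast0LessThan)
    ultimately have eq: "l * (\<Sum>i<n. (w $ i)\<^sup>2) = (\<Sum>i<n. (y $ i)\<^sup>2)" using w y by simp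
    have "\<exists>i<n. w $ i \<noteq> 0"
      using w by (metis eq_vecI carrier_vecD index_zero_vec)
    then have "(\<Sum>i<n. (w $ i)\<^sup>2) \<noteq> 0"
      by (subst sum_nonneg_eq_0_iff) auto
    then have pos: "(\<Sum>i<n. (w $ i)\<^sup>2) > 0"
      by (simp add: order_less_le sum_nonneg)
    have yi: "y $ i = (\<Sum>j<n. f (Suc i) (Suc j) * w $ j)" if "i < n" for i
      using that w A by (simp add: y_def A_def matrix_of_def scalar_prod_def atLeast0LessThan)
    have "(\<Sum>i<n. (y $ i)\<^sup>2) = (\<Sum>i<n. y $ i * (\<Sum>j<n. f (Suc i) (Suc j) * w $ j))"
      by (intro sum.cong) (auto simp: yi power2_eq_square)
    also have "\<dots> = bilinear_sum n f (\<lambda>x. y $ (x - 1)) (\<lambda>x. w $ (x - 1))"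
      by (simp add: bilinear_sum_def idx sum_distrib_left mult_ac del: One_nat_def)
    also have "\<dots> \<le> b * sqrt (\<Sum>i<n. (y $ i)\<^sup>2) * sqrt (\<Sum>i<n. (w $ i)\<^sup>2)"
      using bil[of "\<lambda>x. y $ (x - 1)" "\<lambda>x. w $ (x - 1)"] by (simp add: idx del: One_nat_def)
    finally have le: "(\<Sum>i<n. (y $ i)\<^sup>2) \<le> b * sqrt (\<Sum>i<n. (y $ i)\<^sup>2) * sqrt (\<Sum>i<n. (w $ i)\<^sup>2)" .
    define Y W where "Y = sqrt (\<Sum>i<n. (y $ i)\<^sup>2)" and "W = sqrt (\<Sum>i<n. (w $ i)\<^sup>2)"
    have YW: "Y \<ge> 0" "W > 0" "Y\<^sup>2 = (\<Sum>i<n. (y $ i)\<^sup>2)" "W\<^sup>2 = (\<Sum>i<n. (w $ i)\<^sup>2)"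
      using pos by (auto simp: Y_def W_def sum_nonneg)
    have "Y * Y \<le> (b * W) * Y" 
      using le unfolding Y_def[symmetric] W_def[symmetric] YW(3)[symmetric]
      using YW(1) by (simp add: power2_eq_square mult_ac)
    then have YbW: "Y \<le> b * W"
      using YW(1,2) b by (cases "Y = 0") auto
    have lW: "l * W\<^sup>2 = Y\<^sup>2" using eq YW by simp
    then have l0: "l \<ge> 0" using YW by (metis zero_le_mult_iff zero_le_power2 zero_less_power not_le)
    have "l * W\<^sup>2 \<le> b\<^sup>2 * W\<^sup>2"
      unfolding lW power_mult_distrib[symmetric] by (intro power_mono YbW YW)
    then have "l \<le> b\<^sup>2" using YW(2) by (metis mult_le_cancel_right_pos zero_less_power)
    then have "sqrt l \<le> b" using b real_le_lsqrt by (simp add: real_le_lsqrt)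
    then show ?thesis using l l0 by auto
  qed
  have "sigma_max A \<in> singular_values A"
    unfolding sigma_max_def using fin ne by (rule Max_in)
  with bd show "0 \<le> sigma_max (matrix_of n f)" "sigma_max (matrix_of n f) \<le> b"
    by (auto simp: A_def)
qed

section \<open>A lattice net of the unit ball\<close>

lemma bilinear_sum_add_left:
  "bilinear_sum n A (\<lambda>x. u x + u' x) v = bilinear_sum n A u v + bilinear_sum n A u' v"
  by (simp add: bilinear_sum_def algebra_simps sum.distrib)

lemma bilinear_sum_add_right:
  "bilinear_sum n A u (\<lambda>x. v x + v' x) = bilinear_sum n A u v + bilinear_sum n A u v'"
  by (simp add: bilinear_sum_def algebra_simps sum.distrib)

lemma bilinear_sum_scale:
  "bilinear_sum n A (\<lambda>x. a * u x) (\<lambda>y. b * v y) = a * b * bilinear_sum n A u v"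
  by (simp add: bilinear_sum_def sum_distrib_left mult_ac)

text \<open>The integer points z in the ball of radius 4 sqrt n. Divided by 4 sqrt n they form a
  net of the unit ball; the integers are kept because they make counting and truncating easy.\<close>

definition lattice_net :: "nat \<Rightarrow> (nat \<Rightarrow> int) set" where
  "lattice_net n = {z \<in> {1..n} \<rightarrow>\<^sub>E UNIV. (\<Sum>x=1..n. (z x)\<^sup>2) \<le> 16 * int n}"

text \<open>The point of the net that the integer vector z encodes.\<close>

definition net_vector :: "nat \<Rightarrow> (nat \<Rightarrow> int) \<Rightarrow> nat \<Rightarrow> real" where
  "net_vector n z x = real_of_int (z x) / (4 * sqrt (real n))"

lemma sum_exp_abs_le: "(\<Sum>k\<in>{- int m..int m}. exp (- \<bar>real_of_int k\<bar>)) \<le> 3 - 2 * exp (- real m)"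
proof (induction m)
  case 0
  then show ?case by simp
next
  case (Suc m)
  have "{- int (Suc m)..int (Suc m)} = insert (int (Suc m)) (insert (- int (Suc m)) {- int m..int m})"
    by auto
  then have "(\<Sum>k\<in>{- int (Suc m)..int (Suc m)}. exp (- \<bar>real_of_int k\<bar>))
      = 2 * exp (- real (Suc m)) + (\<Sum>k\<in>{- int m..int m}. exp (- \<bar>real_of_int k\<bar>))"
    by simp
  also have "\<dots> \<le> 2 * exp (- real (Suc m)) + (3 - 2 * exp (- real m))" using Suc by simp
  also have "\<dots> \<le> 3 - 2 * exp (- real (Suc m))"
  proof -
    have "exp (- real m) = exp 1 * exp (- real (Suc m))" by (simp add: exp_add[symmetric])
    moreover have "(2::real) \<le> exp 1" using exp_ge_add_one_self[of 1] by simp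
    ultimately have "exp (- real m) \<ge> 2 * exp (- real (Suc m))" by simp
    then show ?thesis by simp
  qed
  finally show ?case .
qed

lemma abs_le_square_int: "\<bar>k\<bar> \<le> (k :: int)\<^sup>2"
proof (cases "k = 0")
  case False
  then have "\<bar>k\<bar> * 1 \<le> \<bar>k\<bar> * \<bar>k\<bar>" by (intro mult_left_mono) auto
  then show ?thesis by (simp add: power2_eq_square)
qed simp

text \<open>As |k| <= k^2 for integers, the coordinates of a vector z of the net satisfy
  \<Sum> |z x| <= 16 n, so 1 is at most exp (16 n) times the product of the exp (- |z x|); summed over all
  integer vectors this product factorizes.\<close>

lemma finite_card_lattice_net:
  "finite (lattice_net n)" "real (card (lattice_net n)) \<le> exp (18 * real n)"
proof -
  define m where "m = 16 * n"
  define B where "B = {1..n} \<rightarrow>\<^sub>E {- int m..int m}"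
  have sub: "lattice_net n \<subseteq> B"
  proof
    fix z assume z: "z \<in> lattice_net n"
    have "\<bar>z x\<bar> \<le> int m" if x: "x \<in> {1..n}" for x
    proof -
      have "\<bar>z x\<bar> \<le> (z x)\<^sup>2"
        by (rule abs_le_square_int)
      also have "\<dots> \<le> (\<Sum>x=1..n. (z x)\<^sup>2)" using x by (intro member_le_sum) auto
      also have "\<dots> \<le> int m" using z by (simp add: lattice_net_def m_def)
      finally show ?thesis .
    qed
    then have "z x \<in> {- int m..int m}" if "x \<in> {1..n}" for x using that by (force simp: abs_le_iff)
    then show "z \<in> B" using z by (auto simp: lattice_net_def B_def PiE_iff)
  qed
  have finB: "finite B" unfolding B_def by (intro finite_PiE) auto
  show fin: "finite (lattice_net n)" using sub finB finite_subset by blast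
  have "real (card (lattice_net n)) = (\<Sum>z\<in>lattice_net n. 1)" by simp
  also have "\<dots> \<le> (\<Sum>z\<in>lattice_net n. exp (16 * real n) * (\<Prod>x=1..n. exp (- \<bar>real_of_int (z x)\<bar>)))"
  proof (rule sum_mono)
    fix z assume z: "z \<in> lattice_net n"
    have "(\<Sum>x=1..n. \<bar>real_of_int (z x)\<bar>) \<le> (\<Sum>x=1..n. real_of_int ((z x)\<^sup>2))"
    proof (rule sum_mono)
      fix x
      have "\<bar>z x\<bar> \<le> (z x)\<^sup>2"
        by (rule abs_le_square_int)
      then show "\<bar>real_of_int (z x)\<bar> \<le> real_of_int ((z x)\<^sup>2)"
        by (metis of_int_abs of_int_le_iff)
    qed
    also have "\<dots> = real_of_int (\<Sum>x=1..n. (z x)\<^sup>2)" by simp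
    also have "\<dots> \<le> real_of_int (16 * int n)" using z unfolding lattice_net_def by (simp only: of_int_le_iff mem_Collect_eq)
    finally have "(\<Sum>x=1..n. \<bar>real_of_int (z x)\<bar>) \<le> 16 * real n" by simp
    then have "1 \<le> exp (16 * real n + (\<Sum>x=1..n. - \<bar>real_of_int (z x)\<bar>))" by (simp add: sum_negf)
    also have "\<dots> = exp (16 * real n) * (\<Prod>x=1..n. exp (- \<bar>real_of_int (z x)\<bar>))"
      by (simp only: exp_add exp_sum[OF finite_atLeastAtMost])
    finally show "1 \<le> exp (16 * real n) * (\<Prod>x=1..n. exp (- \<bar>real_of_int (z x)\<bar>))" .
  qed
  also have "\<dots> \<le> (\<Sum>z\<in>B. exp (16 * real n) * (\<Prod>x=1..n. exp (- \<bar>real_of_int (z x)\<bar>)))"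
    by (intro sum_mono2 finB sub mult_nonneg_nonneg prod_nonneg) auto
  also have "\<dots> = exp (16 * real n) * (\<Prod>x=1..n. (\<Sum>k\<in>{- int m..int m}. exp (- \<bar>real_of_int k\<bar>)))"
    unfolding B_def by (subst prod_sum_PiE) (auto simp: sum_distrib_left)
  also have "\<dots> \<le> exp (16 * real n) * (\<Prod>x=1..n. exp 2)"
  proof (intro mult_left_mono prod_mono conjI)
    have "(3::real) \<le> exp 1 * exp 1"
      using mult_mono[of 2 "exp (1::real)" 2 "exp 1"] exp_ge_add_one_self[of "1::real"] by simp
    then have "(3::real) \<le> exp 2" by (simp add: exp_add[symmetric])
    then show "(\<Sum>k\<in>{- int m..int m}. exp (- \<bar>real_of_int k\<bar>)) \<le> exp 2"
      using sum_exp_abs_le[of m] exp_gt_zero[of "- real m"] by linarith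
  qed (auto intro: sum_nonneg)
  also have "\<dots> = exp (18 * real n)"
    by (simp add: exp_of_nat_mult[symmetric] exp_add[symmetric])
  finally show "real (card (lattice_net n)) \<le> exp (18 * real n)" .
qed

lemma net_vector_norm:
  assumes "z \<in> lattice_net n"
  shows "sqnorm n (net_vector n z) \<le> 1"
proof (cases "n = 0")
  case False
  have "sqnorm n (net_vector n z) = real_of_int (\<Sum>x=1..n. (z x)\<^sup>2) / (16 * real n)"
    using False by (simp add: net_vector_def power_divide power_mult_distrib sum_divide_distrib)
  moreover have "real_of_int (\<Sum>x=1..n. (z x)\<^sup>2) \<le> real_of_int (16 * int n)"
    using assms unfolding lattice_net_def by (simp only: of_int_le_iff mem_Collect_eq)
  ultimately show ?thesis using False by (simp add: divide_le_eq_1)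
qed simp

text \<open>Setting coordinates to zero does not leave the net. Hence trimming, which restricts
  both vectors to the set of kept states, costs nothing in the union bound over the net, although
  that set is random.\<close>

lemma net_vector_restrict:
  assumes z: "z \<in> lattice_net n"
  obtains z' where "z' \<in> lattice_net n"
    "\<And>x. x \<in> {1..n} \<Longrightarrow> net_vector n z' x = (if x \<in> G then net_vector n z x else 0)"
proof
  define z' where "z' = restrict (\<lambda>x. if x \<in> G then z x else 0) {1..n}"
  have "(\<Sum>x=1..n. (z' x)\<^sup>2) \<le> (\<Sum>x=1..n. (z x)\<^sup>2)"
    by (intro sum_mono) (auto simp: z'_def)
  then show "z' \<in> lattice_net n" using z by (auto simp: lattice_net_def z'_def)
  show "net_vector n z' x = (if x \<in> G then net_vector n z x else 0)" if "x \<in> {1..n}" for x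
    using that by (auto simp: net_vector_def z'_def)
qed

text \<open>Truncating towards zero does not increase the norm, and moves each coordinate
  by at most 1 / (4 sqrt n).\<close>

lemma net_rounding:
  assumes u: "sqnorm n u \<le> 1" and n: "n > 0"
  obtains z where "z \<in> lattice_net n" "(\<Sum>x=1..n. (u x - net_vector n z x)\<^sup>2) \<le> 1 / 16"
proof
  define q where "q = 4 * sqrt (real n)"
  have q: "q > 0" "q\<^sup>2 = 16 * real n" using n by (auto simp: q_def power_mult_distrib)
  define z where "z = restrict (\<lambda>x. if u x \<ge> 0 then \<lfloor>q * u x\<rfloor> else \<lceil>q * u x\<rceil>) {1..n}"
  have z1: "\<bar>real_of_int (z x)\<bar> \<le> \<bar>q * u x\<bar>" "\<bar>q * u x - real_of_int (z x)\<bar> \<le> 1" if "x \<in> {1..n}" for x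
  proof -
    have "q * u x \<ge> 0" if "u x \<ge> 0" using q that by simp
    moreover have "q * u x \<le> 0" if "u x < 0" using q that by (simp add: mult_nonneg_nonpos)
    ultimately show "\<bar>real_of_int (z x)\<bar> \<le> \<bar>q * u x\<bar>" "\<bar>q * u x - real_of_int (z x)\<bar> \<le> 1"
      using that unfolding z_def by (simp; linarith)+
  qed
  have "real_of_int (\<Sum>x=1..n. (z x)\<^sup>2) \<le> (\<Sum>x=1..n. (q * u x)\<^sup>2)"
    using z1(1) by (simp, intro sum_mono) (simp only: abs_le_square_iff[symmetric] atLeastAtMost_iff)
  also have "\<dots> = q\<^sup>2 * sqnorm n u" by (simp add: power_mult_distrib sum_distrib_left)
  also have "\<dots> \<le> q\<^sup>2" using u by (simp add: mult_left_le)
  finally have "real_of_int (\<Sum>x=1..n. (z x)\<^sup>2) \<le> real_of_int (16 * int n)" by (simp add: q)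
  then have "(\<Sum>x=1..n. (z x)\<^sup>2) \<le> 16 * int n" by (simp only: of_int_le_iff)
  then show "z \<in> lattice_net n" by (auto simp: lattice_net_def z_def)
  have "(u x - net_vector n z x)\<^sup>2 \<le> 1 / q\<^sup>2" if "x \<in> {1..n}" for x
  proof -
    have "u x - net_vector n z x = (q * u x - real_of_int (z x)) / q"
      using q(1) unfolding net_vector_def q_def[symmetric] by (simp add: diff_divide_distrib)
    moreover have "(q * u x - real_of_int (z x))\<^sup>2 \<le> 1" using z1(2)[OF that] by (simp add: abs_square_le_1)
    ultimately show ?thesis by (simp add: power_divide divide_right_mono)
  qed
  then have "(\<Sum>x=1..n. (u x - net_vector n z x)\<^sup>2) \<le> (\<Sum>x=1..n. 1 / q\<^sup>2)" by (intro sum_mono)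
  also have "\<dots> = 1 / 16" using n by (simp add: q)
  finally show "(\<Sum>x=1..n. (u x - net_vector n z x)\<^sup>2) \<le> 1 / 16" .
qed

text \<open>If S is the supremum of the form on the unit ball, rounding both vectors gives
  S <= m + S / 4 + S / 4.\<close>

lemma bilinear_bound_from_net:
  assumes n: "n > 0"
    and net: "\<And>z w. z \<in> lattice_net n \<Longrightarrow> w \<in> lattice_net n \<Longrightarrow>
      \<bar>bilinear_sum n A (net_vector n z) (net_vector n w)\<bar> \<le> m"
  shows "\<bar>bilinear_sum n A u v\<bar> \<le> (2 * m) * sqrt (sqnorm n u) * sqrt (sqnorm n v)"
proof -
  define U where "U = {u :: nat \<Rightarrow> real. sqnorm n u \<le> 1}"
  define Q where "Q = (\<lambda>(u, v). \<bar>bilinear_sum n A u v\<bar>) ` (U \<times> U)"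
  have U1: "\<bar>u x\<bar> \<le> 1" if "u \<in> U" "x \<in> {1..n}" for u x
    using that abs_coord_le_1 by (simp add: U_def)
  have bdd: "bdd_above Q"
  proof (rule bdd_aboveI)
    fix s assume "s \<in> Q"
    then obtain u v where uv: "u \<in> U" "v \<in> U" "s = \<bar>bilinear_sum n A u v\<bar>" by (auto simp: Q_def)
    have "s \<le> (\<Sum>x=1..n. \<Sum>y=1..n. \<bar>u x * v y * A x y\<bar>)"
      unfolding uv bilinear_sum_def by (intro order_trans[OF sum_abs] sum_mono) simp
    also have "\<dots> \<le> (\<Sum>x=1..n. \<Sum>y=1..n. \<bar>A x y\<bar>)"
      using U1 uv by (intro sum_mono) (auto simp: abs_mult intro!: mult_left_le_one_le mult_le_one)
    finally show "s \<le> (\<Sum>x=1..n. \<Sum>y=1..n. \<bar>A x y\<bar>)" .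
  qed
  have ne: "Q \<noteq> {}" by (auto simp: Q_def U_def intro!: exI[of _ "\<lambda>_. 0"])
  define S where "S = Sup Q"
  have S: "\<bar>bilinear_sum n A u v\<bar> \<le> S" if "u \<in> U" "v \<in> U" for u v
    unfolding S_def using that bdd by (intro cSup_upper) (auto simp: Q_def)
  have "S \<le> m + S / 2"
    unfolding S_def
  proof (rule cSup_least[OF ne])
    fix s assume "s \<in> Q"
    then obtain u v where uv: "u \<in> U" "v \<in> U" "s = \<bar>bilinear_sum n A u v\<bar>" by (auto simp: Q_def)
    obtain z where z: "z \<in> lattice_net n" "(\<Sum>x=1..n. (u x - net_vector n z x)\<^sup>2) \<le> 1 / 16"
      using net_rounding[of u n] uv n by (auto simp: U_def)
    obtain w where w: "w \<in> lattice_net n" "(\<Sum>x=1..n. (v x - net_vector n w x)\<^sup>2) \<le> 1 / 16"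
      using net_rounding[of v n] uv n by (auto simp: U_def)
    define r r' where "r = (\<lambda>x. 4 * (u x - net_vector n z x))" and "r' = (\<lambda>x. 4 * (v x - net_vector n w x))"
    have "(\<Sum>x=1..n. (r x)\<^sup>2) = 16 * (\<Sum>x=1..n. (u x - net_vector n z x)\<^sup>2)"
         "(\<Sum>x=1..n. (r' x)\<^sup>2) = 16 * (\<Sum>x=1..n. (v x - net_vector n w x)\<^sup>2)"
      unfolding r_def r'_def power_mult_distrib sum_distrib_left by simp_all
    then have rU: "r \<in> U" "r' \<in> U" using z(2) w(2) unfolding U_def by auto
    have zU: "net_vector n z \<in> U" using net_vector_norm z by (auto simp: U_def)
    have "bilinear_sum n A u v = bilinear_sum n A (\<lambda>x. net_vector n z x + (1/4) * r x) (\<lambda>x. 1 * v x)"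
      by (simp add: r_def diff_divide_distrib)
    also have "\<dots> = bilinear_sum n A (net_vector n z) (\<lambda>x. net_vector n w x + (1/4) * r' x) + (1/4) * bilinear_sum n A r v"
      unfolding bilinear_sum_add_left bilinear_sum_scale by (simp add: r'_def diff_divide_distrib)
    also have "\<dots> = bilinear_sum n A (net_vector n z) (net_vector n w)
        + (1/4) * bilinear_sum n A (net_vector n z) r' + (1/4) * bilinear_sum n A r v"
      unfolding bilinear_sum_add_right using bilinear_sum_scale[of n A 1 "net_vector n z" "1/4" r'] by simp
    finally have "s \<le> \<bar>bilinear_sum n A (net_vector n z) (net_vector n w)\<bar>
        + (1/4) * \<bar>bilinear_sum n A (net_vector n z) r'\<bar> + (1/4) * \<bar>bilinear_sum n A r v\<bar>"
      unfolding uv by linarith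
    also have "\<dots> \<le> m + (1/4) * S + (1/4) * S"
      using net[OF z(1) w(1)] S[OF zU rU(2)] S[OF rU(1) uv(2)] by linarith
    finally show "s \<le> m + Sup Q / 2" by (simp add: S_def)
  qed
  then have S2: "S \<le> 2 * m" by simp
  define a b where "a = sqrt (sqnorm n u)" and "b = sqrt (sqnorm n v)"
  have ab: "a \<ge> 0" "b \<ge> 0" "a\<^sup>2 = sqnorm n u" "b\<^sup>2 = sqnorm n v"
    by (auto simp: a_def b_def sum_nonneg)
  show ?thesis
  proof (cases "a = 0 \<or> b = 0")
    case True
    then have "sqnorm n u = 0 \<or> sqnorm n v = 0" using ab by auto
    then have "(\<forall>x\<in>{1..n}. u x = 0) \<or> (\<forall>x\<in>{1..n}. v x = 0)"
      by (subst (asm) (1 2) sum_nonneg_eq_0_iff) auto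
    then have "bilinear_sum n A u v = 0" by (auto simp: bilinear_sum_def)
    then show ?thesis using True by (auto simp: a_def b_def)
  next
    case False
    define u' v' where "u' = (\<lambda>x. u x / a)" and "v' = (\<lambda>x. v x / b)"
    have "u' \<in> U" "v' \<in> U" using False ab
      by (auto simp: u'_def v'_def U_def power_divide sum_divide_distrib[symmetric])
    then have "\<bar>bilinear_sum n A u' v'\<bar> \<le> 2 * m" using S S2 by force
    moreover have "bilinear_sum n A u v = a * b * bilinear_sum n A u' v'"
      using False bilinear_sum_scale[of n A a u' b v'] by (simp add: u'_def v'_def)
    ultimately have "\<bar>bilinear_sum n A u v\<bar> \<le> a * b * (2 * m)"
      using ab by (simp add: abs_mult mult_left_mono)
    then show ?thesis by (simp add: a_def b_def mult_ac)
  qed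
qed

section \<open>Entropy estimates\<close>

text \<open>An upper bound for the logarithm of the number of a-element subsets of {1..n}.
  By the convention for division by zero its value at a = 0 is 0.\<close>

definition subset_entropy :: "nat \<Rightarrow> nat \<Rightarrow> real" where
  "subset_entropy n a = real a * (1 + ln (real n / real a))"

text \<open>The exponential tilt used for the sets of pairs on which |u| |v| is about
  exp m / n: its exponential is then about |u| |v| n / sqrt d, the factor
  by which such a pair is heavy.\<close>

definition tilt :: "real \<Rightarrow> nat \<Rightarrow> real" where
  "tilt d m = max 1 (real m - ln d / 2)"

lemma tilt_ge_1: "tilt d m \<ge> 1" by (simp add: tilt_def)

lemma tilt_nonneg [simp]: "tilt d m \<ge> 0" by (simp add: tilt_def)

lemma subset_entropy_nonneg:
  assumes "a \<le> n" shows "subset_entropy n a \<ge> 0"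
  using assms by (cases "a = 0") (auto simp: subset_entropy_def intro!: mult_nonneg_nonneg add_nonneg_nonneg ln_ge_zero)

lemma sum_exp_neg_le:
  assumes "a \<ge> 1/2"
  shows "(\<Sum>k\<le>(m::nat). exp (- (a * real k))) \<le> 3"
proof -
  define x where "x = exp (- a)"
  have "exp (1/2::real) \<ge> 3/2" using exp_ge_add_one_self[of "1/2::real"] by simp
  then have "exp a \<ge> 3/2" using assms by (meson exp_le_cancel_iff order_trans)
  then have x: "0 < x" "x \<le> 2/3" by (auto simp: x_def exp_minus field_simps)
  have "(\<Sum>k\<le>m. exp (- (a * real k))) = (\<Sum>k<Suc m. x ^ k)"
    unfolding x_def lessThan_Suc_atMost by (intro sum.cong) (auto simp: exp_of_nat_mult[symmetric] mult_ac)
  also have "\<dots> = (1 - x ^ Suc m) / (1 - x)" using x by (subst sum_gp_strict) auto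
  also have "\<dots> \<le> 1 / (1 - x)" using x by (intro divide_right_mono) auto
  also have "\<dots> \<le> 3" using x by (simp add: field_simps)
  finally show ?thesis .
qed

text \<open>With r = n / (b exp (2 t + L)), L = 2 t + 1, the entropy is at most b (2 L + ln r), and
  ln r is at most r. The factor 1 / (2 t + 1), which the tilt provides, makes the sum over the levels t
  bounded.\<close>

lemma entropy_term_le:
  assumes n: "n > 0"
  shows "exp (2 * real t) * subset_entropy n b / (2 * real t + 1)
         \<le> 2 * (exp (2 * real t) * real b) + real n * exp (- (1 * real t))"
proof (cases "b = 0")
  case True
  then show ?thesis by (simp add: subset_entropy_def)
next
  case False
  define L where "L = 2 * real t + 1"
  define r where "r = real n / (real b * exp (2 * real t + L))"
  have L: "L \<ge> 1" "L > 0" by (auto simp: L_def)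
  have r: "r > 0" using False n by (simp add: r_def)
  have "real n / real b = r * exp (2 * real t + L)" using False by (simp add: r_def)
  then have "ln (real n / real b) = ln r + (2 * real t + L)" using r by (simp add: ln_mult_pos)
  also have "\<dots> \<le> r - 1 + (2 * real t + L)" using r ln_le_minus_one by simp
  finally have "1 + ln (real n / real b) \<le> 2 * L + r" by (simp add: L_def)
  then have "subset_entropy n b \<le> real b * (2 * L + r)"
    unfolding subset_entropy_def by (intro mult_left_mono) auto
  also have "\<dots> = 2 * L * real b + real n * exp (- (2 * real t + L))"
    unfolding r_def exp_minus using False by (simp add: field_simps)
  finally have "exp (2 * real t) * subset_entropy n b \<le> exp (2 * real t) * (2 * L * real b + real n * exp (- (2 * real t + L)))"
    by (intro mult_left_mono) auto
  also have "\<dots> = L * (2 * (exp (2 * real t) * real b)) + real n * exp (- L)"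
    by (simp add: algebra_simps exp_add[symmetric])
  also have "real n * exp (- L) \<le> L * (real n * exp (- (1 * real t)))"
  proof -
    have "exp (- L) \<le> exp (- (1 * real t))" by (simp add: L_def)
    then have "1 * (real n * exp (- L)) \<le> L * (real n * exp (- (1 * real t)))"
      using L by (intro mult_mono) auto
    then show ?thesis by simp
  qed
  finally have "exp (2 * real t) * subset_entropy n b
      \<le> L * (2 * (exp (2 * real t) * real b) + real n * exp (- (1 * real t)))"
    by (simp add: algebra_simps)
  then show ?thesis using L unfolding L_def[symmetric] by (simp add: pos_divide_le_eq mult.commute)
qed

lemma sum_entropy_le:
  assumes n: "n > 0" and b: "(\<Sum>t\<le>m. exp (2 * real t) * real (b t)) \<le> real n"
  shows "(\<Sum>t\<le>m. exp (2 * real t) * subset_entropy n (b t) / (2 * real t + 1)) \<le> 5 * real n"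
proof -
  have "(\<Sum>t\<le>m. exp (2 * real t) * subset_entropy n (b t) / (2 * real t + 1))
      \<le> (\<Sum>t\<le>m. 2 * (exp (2 * real t) * real (b t)) + real n * exp (- (1 * real t)))"
    by (intro sum_mono entropy_term_le n)
  also have "\<dots> = 2 * (\<Sum>t\<le>m. exp (2 * real t) * real (b t)) + real n * (\<Sum>t\<le>m. exp (- (1 * real t)))"
    by (simp only: sum.distrib sum_distrib_left)
  also have "\<dots> \<le> 2 * real n + real n * 3"
    using b sum_exp_neg_le[of 1 m] by (intro add_mono mult_left_mono) auto
  finally show ?thesis by simp
qed

text \<open>The sum is dominated by its last terms. There the tilt is of order 2 t + 1, and this
  denominator is what the entropy of the level t requires.\<close>

lemma sum_exp_over_tilt_le:
  assumes d: "d \<ge> 1"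
  shows "(\<Sum>s | s \<le> m \<and> real s \<le> real t + 1 + ln d / 2. exp (real s) / tilt d (s + t))
         \<le> 6 * exp (real t + 1 + ln d / 2) / (2 * real t + 1)"
proof -
  define R where "R = real t + 1 + ln d / 2"
  define L where "L = 2 * real t + 1"
  have R: "R \<ge> 0" using d by (simp add: R_def)
  have L: "L \<ge> 1" by (simp add: L_def)
  define q where "q = nat \<lfloor>R\<rfloor>"
  have q: "real q \<le> R" using R by (simp add: q_def)
  have S: "{s. s \<le> m \<and> real s \<le> R} \<subseteq> {..q}" unfolding q_def by (auto simp: le_nat_floor)
  have term_le: "exp (real s) / tilt d (s + t) \<le> (2 * exp R / L) * exp (- ((1/2) * real (q - s)))" if s: "s \<le> q" for s
  proof -
    define r where "r = R - real s"
    have r: "r \<ge> 0" "real (q - s) \<le> r" using s q by (auto simp: r_def of_nat_diff)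
    define th where "th = tilt d (s + t)"
    have th: "th \<ge> 1" "th = max 1 (L - r)"
      by (auto simp: th_def tilt_def L_def r_def R_def)
    have "L \<le> th * (1 + r)"
    proof (cases "L - r \<ge> 1")
      case True
      then have "0 \<le> r * (L - 1 - r)" using r by (intro mult_nonneg_nonneg) auto
      then have "L \<le> (L - r) * (1 + r)" by (simp add: algebra_simps)
      then show ?thesis using True th by (simp add: max_def)
    next
      case False
      then show ?thesis using th r by (simp add: max_def)
    qed
    also have "1 + r \<le> 2 * exp (r / 2)" using exp_ge_add_one_self[of "r/2"] r(1) by linarith
    then have "th * (1 + r) \<le> th * (2 * exp (r / 2))" using th by (intro mult_left_mono) auto
    finally have "L \<le> th * (2 * exp (r / 2))" .
    then have "1 / th \<le> 2 * exp (r / 2) / L" using th L by (simp add: field_simps)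
    then have "exp (real s) * (1 / th) \<le> exp (real s) * (2 * exp (r / 2) / L)" by (intro mult_left_mono) auto
    also have "\<dots> = (2 * exp R / L) * exp (- (r / 2))"
      by (simp add: r_def exp_add[symmetric] field_simps)
    also have "\<dots> \<le> (2 * exp R / L) * exp (- ((1/2) * real (q - s)))"
      using r L by (intro mult_left_mono) auto
    finally show ?thesis by (simp add: th_def)
  qed
  have "(\<Sum>s | s \<le> m \<and> real s \<le> R. exp (real s) / tilt d (s + t)) \<le> (\<Sum>s\<le>q. exp (real s) / tilt d (s + t))"
    using S by (intro sum_mono2) auto
  also have "\<dots> \<le> (\<Sum>s\<le>q. (2 * exp R / L) * exp (- ((1/2) * real (q - s))))"
    using term_le by (intro sum_mono) auto
  also have "\<dots> = (2 * exp R / L) * (\<Sum>s\<le>q. exp (- ((1/2) * real (q - s))))" by (simp add: sum_distrib_left)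
  also have "(\<Sum>s\<le>q. exp (- ((1/2) * real (q - s)))) = (\<Sum>k\<le>q. exp (- ((1/2) * real k)))"
    by (rule sum.reindex_bij_witness[of _ "\<lambda>k. q - k" "\<lambda>k. q - k"]) auto
  also have "(2 * exp R / L) * (\<Sum>k\<le>q. exp (- ((1/2) * real k))) \<le> (2 * exp R / L) * 3"
    using L by (intro mult_left_mono sum_exp_neg_le) auto
  finally show ?thesis by (simp add: R_def L_def)
qed

section \<open>The heavy pairs\<close>

text \<open>The states x at which sqrt n |u x| lies between exp s and exp (s + 1), s a natural
  number. States with sqrt n |u x| < 1 belong to no level.\<close>

definition level_set :: "nat \<Rightarrow> (nat \<Rightarrow> real) \<Rightarrow> nat \<Rightarrow> nat set" where
  "level_set n u s = {x \<in> {1..n}. sqrt (real n) * \<bar>u x\<bar> \<ge> 1 \<and> nat \<lfloor>ln (sqrt (real n) * \<bar>u x\<bar>)\<rfloor> = s}"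

lemma level_set_bounds:
  assumes "x \<in> level_set n u s"
  shows "x \<in> {1..n}" "exp (real s) \<le> sqrt (real n) * \<bar>u x\<bar>" "sqrt (real n) * \<bar>u x\<bar> < exp (real s + 1)"
proof -
  define w where "w = sqrt (real n) * \<bar>u x\<bar>"
  have w: "w \<ge> 1" "nat \<lfloor>ln w\<rfloor> = s" "x \<in> {1..n}" using assms by (auto simp: level_set_def w_def)
  have "ln w \<ge> 0" using w by simp
  then have "real s \<le> ln w" "ln w < real s + 1" using w(2) by linarith+
  then have "exp (real s) \<le> exp (ln w)" "exp (ln w) < exp (real s + 1)" by simp_all
  then show "x \<in> {1..n}" "exp (real s) \<le> sqrt (real n) * \<bar>u x\<bar>" "sqrt (real n) * \<bar>u x\<bar> < exp (real s + 1)"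
    using w by (simp_all add: w_def[symmetric])
qed

lemma level_set_mass:
  assumes u: "sqnorm n u \<le> 1"
  shows "(\<Sum>s\<le>m. exp (2 * real s) * real (card (level_set n u s))) \<le> real n"
proof -
  have fin: "finite (level_set n u s)" for s by (simp add: level_set_def)
  have "(\<Sum>s\<le>m. exp (2 * real s) * real (card (level_set n u s)))
      = (\<Sum>s\<le>m. \<Sum>x\<in>level_set n u s. exp (2 * real s))" by (simp add: mult.commute)
  also have "\<dots> \<le> (\<Sum>s\<le>m. \<Sum>x\<in>level_set n u s. real n * (u x)\<^sup>2)"
  proof (intro sum_mono)
    fix s x assume x: "x \<in> level_set n u s"
    have "(exp (real s))\<^sup>2 \<le> (sqrt (real n) * \<bar>u x\<bar>)\<^sup>2"
      by (intro power_mono level_set_bounds(2)[OF x]) simp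
    then show "exp (2 * real s) \<le> real n * (u x)\<^sup>2"
      by (simp add: power_mult_distrib exp_double[symmetric])
  qed
  also have "\<dots> = (\<Sum>x\<in>(\<Union>s\<le>m. level_set n u s). real n * (u x)\<^sup>2)"
    using fin by (intro sum.UNION_disjoint[symmetric]) (auto simp: level_set_def)
  also have "\<dots> \<le> (\<Sum>x=1..n. real n * (u x)\<^sup>2)"
    by (intro sum_mono2) (auto simp: level_set_def)
  also have "\<dots> = real n * sqnorm n u" by (simp add: sum_distrib_left)
  also have "\<dots> \<le> real n" using u by (simp add: mult_left_le)
  finally show ?thesis .
qed

lemma level_le:
  assumes u: "sqnorm n u \<le> 1" and x: "x \<in> level_set n u s"
  shows "2 * real s \<le> real n"
proof -
  have xn: "x \<in> {1..n}" using level_set_bounds[OF x] by simp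
  have u1: "\<bar>u x\<bar> \<le> 1" by (rule abs_coord_le_1[OF u xn])
  have "exp (real s) \<le> sqrt (real n) * 1"
    using level_set_bounds(2)[OF x] u1 by (meson mult_left_mono order_trans real_sqrt_ge_zero of_nat_0_le_iff)
  then have "(exp (real s))\<^sup>2 \<le> (sqrt (real n))\<^sup>2" by (intro power_mono) auto
  then have "exp (2 * real s) \<le> real n" by (simp add: exp_double[symmetric])
  moreover have "1 + 2 * real s \<le> exp (2 * real s)" by (rule exp_ge_add_one_self)
  ultimately show ?thesis by linarith
qed

lemma entropy_part:
  assumes n: "n > 0" and d: "d \<ge> 1"
    and b: "(\<Sum>t\<le>n. exp (2 * real t) * real (b t)) \<le> real n" and bn: "\<And>t. b t \<le> n"
  shows "(\<Sum>t\<le>n. \<Sum>s | s \<le> n \<and> real s \<le> real t + 1 + ln d / 2.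
            exp (real s + real t + 2) / tilt d (s + t) * subset_entropy n (b t))
         \<le> 30 * exp 3 * sqrt d * real n"
proof -
  have sq: "exp (ln d / 2) = sqrt d"
    using d by (simp add: powr_half_sqrt[symmetric] powr_def)
  have "(\<Sum>t\<le>n. \<Sum>s | s \<le> n \<and> real s \<le> real t + 1 + ln d / 2.
            exp (real s + real t + 2) / tilt d (s + t) * subset_entropy n (b t))
      = (\<Sum>t\<le>n. (exp (real t + 2) * subset_entropy n (b t)) *
           (\<Sum>s | s \<le> n \<and> real s \<le> real t + 1 + ln d / 2. exp (real s) / tilt d (s + t)))"
    unfolding sum_distrib_left by (intro sum.cong refl) (simp add: exp_add)
  also have "\<dots> \<le> (\<Sum>t\<le>n. (exp (real t + 2) * subset_entropy n (b t)) *
           (6 * exp (real t + 1 + ln d / 2) / (2 * real t + 1)))"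
    using bn by (intro sum_mono mult_left_mono sum_exp_over_tilt_le d mult_nonneg_nonneg subset_entropy_nonneg) auto
  also have "\<dots> = (\<Sum>t\<le>n. (6 * exp 3 * sqrt d) * (exp (2 * real t) * subset_entropy n (b t) / (2 * real t + 1)))"
  proof (intro sum.cong refl)
    fix t
    have "exp (real t + 2) * exp (real t + 1 + ln d / 2) = exp (3 + 2 * real t + ln d / 2)"
      by (simp add: exp_add[symmetric])
    also have "\<dots> = exp 3 * exp (2 * real t) * sqrt d" by (simp only: exp_add sq)
    finally have eq: "exp (real t + 2) * exp (real t + 1 + ln d / 2) = exp 3 * exp (2 * real t) * sqrt d" .
    have "(exp (real t + 2) * subset_entropy n (b t)) * (6 * exp (real t + 1 + ln d / 2) / (2 * real t + 1))
        = 6 * (exp (real t + 2) * exp (real t + 1 + ln d / 2)) * subset_entropy n (b t) / (2 * real t + 1)"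
      by simp
    also have "\<dots> = (6 * exp 3 * sqrt d) * (exp (2 * real t) * subset_entropy n (b t) / (2 * real t + 1))"
      unfolding eq by simp
    finally show "(exp (real t + 2) * subset_entropy n (b t)) * (6 * exp (real t + 1 + ln d / 2) / (2 * real t + 1))
        = (6 * exp 3 * sqrt d) * (exp (2 * real t) * subset_entropy n (b t) / (2 * real t + 1))" .
  qed
  also have "\<dots> = (6 * exp 3 * sqrt d) * (\<Sum>t\<le>n. exp (2 * real t) * subset_entropy n (b t) / (2 * real t + 1))"
    by (simp only: sum_distrib_left)
  also have "\<dots> \<le> (6 * exp 3 * sqrt d) * (5 * real n)"
    using d by (intro mult_left_mono sum_entropy_le n b) auto
  finally show ?thesis by (simp add: mult_ac)
qed

lemma sum_restrict_pairs:
  fixes N :: "nat \<Rightarrow> nat \<Rightarrow> real"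
  assumes "A \<subseteq> {1..n}" "B \<subseteq> {1..n}"
  shows "(\<Sum>x=1..n. \<Sum>y=1..n. of_bool (x \<in> A \<and> y \<in> B) * N x y) = (\<Sum>x\<in>A. \<Sum>y\<in>B. N x y)"
proof -
  have "(\<Sum>x\<in>A. \<Sum>y\<in>B. N x y) = (\<Sum>x\<in>A. \<Sum>y=1..n. of_bool (x \<in> A \<and> y \<in> B) * N x y)"
    using assms by (intro sum.cong refl sum.mono_neutral_cong_left) auto
  also have "\<dots> = (\<Sum>x=1..n. \<Sum>y=1..n. of_bool (x \<in> A \<and> y \<in> B) * N x y)"
    using assms by (intro sum.mono_neutral_left) auto
  finally show ?thesis by simp
qed

lemma sum_rotate:
  "(\<Sum>y\<in>Y. \<Sum>s\<in>S. \<Sum>t\<in>T. F y s t) = (\<Sum>s\<in>S. \<Sum>t\<in>T. \<Sum>y\<in>Y. F y s t)"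
proof -
  have "(\<Sum>y\<in>Y. \<Sum>s\<in>S. \<Sum>t\<in>T. F y s t) = (\<Sum>s\<in>S. \<Sum>y\<in>Y. \<Sum>t\<in>T. F y s t)"
    by (rule sum.swap)
  also have "\<dots> = (\<Sum>s\<in>S. \<Sum>t\<in>T. \<Sum>y\<in>Y. F y s t)"
    by (rule sum.cong[OF refl], rule sum.swap)
  finally show ?thesis .
qed

text \<open>The deterministic core of the argument. Write U = sqrt n |u| and V = sqrt n |v|; a pair is
  heavy if U V > sqrt d. If V <= U / sqrt d then U V <= U^2 / sqrt d and the bound on the row sums
  suffices, and symmetrically for the column sums. For the remaining pairs U and V exceed 1, so these
  pairs are grouped by levels (s, t) with s + t > ln (sqrt d) - 2 and with s and t differing by at
  most 1 + ln (sqrt d). On each group the discrepancy hypothesis with tilt d (s + t) splits the count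
  into a mean part, which sums to order sqrt d because the level sets are disjoint, and an
  entropy part, which is summed geometrically over one level and then with the entropy estimates
  over the other.\<close>

lemma heavy_bound:
  fixes N :: "nat \<Rightarrow> nat \<Rightarrow> real"
  assumes n: "n > 0" and d: "d \<ge> 1" and C: "C1 \<ge> 0" "C2 \<ge> 0" "c1 \<ge> 0"
    and N: "\<And>x y. N x y \<ge> 0"
    and u: "sqnorm n u \<le> 1" and v: "sqnorm n v \<le> 1"
    and row: "\<And>x. x \<in> {1..n} \<Longrightarrow> u x \<noteq> 0 \<Longrightarrow> (\<Sum>y=1..n. N x y) \<le> c1 * d"
    and col: "\<And>y. y \<in> {1..n} \<Longrightarrow> v y \<noteq> 0 \<Longrightarrow> (\<Sum>x=1..n. N x y) \<le> c1 * d"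
    and disc: "\<And>A B m. A \<subseteq> {1..n} \<Longrightarrow> B \<subseteq> {1..n} \<Longrightarrow> A \<noteq> {} \<Longrightarrow> B \<noteq> {} \<Longrightarrow> m \<le> n \<Longrightarrow>
        tilt d m * (\<Sum>x\<in>A. \<Sum>y\<in>B. N x y) \<le> C1 * (subset_entropy n (card A) + subset_entropy n (card B))
          + C2 * exp (tilt d m) * d * real (card A) * real (card B) / real n"
  shows "(\<Sum>x=1..n. \<Sum>y=1..n. of_bool (\<bar>u x * v y\<bar> > sqrt d / real n) * (\<bar>u x * v y\<bar> * N x y))
         \<le> (2 * c1 + 60 * exp 3 * C1 + exp 5 * C2) * sqrt d"
proof -
  define q where "q = sqrt d"
  have q: "q \<ge> 1" "q > 0" "q * q = d" "d / q = q" using d by (auto simp: q_def real_div_sqrt)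
  define D where "D = ln d / 2"
  have lnq: "ln q = D" using d by (simp add: q_def D_def ln_sqrt)
  have D0: "D \<ge> 0" using d by (simp add: D_def)
  have eD: "exp D = q" using lnq q by (metis exp_ln)
  define U where "U x = sqrt (real n) * \<bar>u x\<bar>" for x
  define V where "V x = sqrt (real n) * \<bar>v x\<bar>" for x
  have UV0: "U x \<ge> 0" "V x \<ge> 0" for x by (auto simp: U_def V_def)
  have U2: "(U x)\<^sup>2 = real n * (u x)\<^sup>2" "(V x)\<^sup>2 = real n * (v x)\<^sup>2" for x
    by (auto simp: U_def V_def power_mult_distrib)
  have UV: "U x * V y = real n * \<bar>u x * v y\<bar>" for x y
    by (simp add: U_def V_def abs_mult)
  define A where "A = level_set n u"
  define B where "B = level_set n v"
  have AB: "A s \<subseteq> {1..n}" "B s \<subseteq> {1..n}" for s by (auto simp: A_def B_def level_set_def)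
  define adm where "adm s t \<longleftrightarrow> s + t \<le> n \<and> real s + real t + 2 > D \<and> real s \<le> real t + 1 + D \<and> real t \<le> real s + 1 + D" for s t :: nat
  define W where "W s t = of_bool (adm s t) * exp (real s + real t + 2)" for s t :: nat
  define R where "R x y = (\<Sum>s\<le>n. \<Sum>t\<le>n. W s t * (of_bool (x \<in> A s \<and> y \<in> B t) * N x y))" for x y
  have R0: "R x y \<ge> 0" for x y unfolding R_def W_def using N by (intro sum_nonneg mult_nonneg_nonneg) auto
  have pointwise: "real n * (of_bool (\<bar>u x * v y\<bar> > sqrt d / real n) * (\<bar>u x * v y\<bar> * N x y))
      \<le> (U x)\<^sup>2 / q * N x y + (V y)\<^sup>2 / q * N x y + R x y" if xy: "x \<in> {1..n}" "y \<in> {1..n}" for x y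
  proof (cases "\<bar>u x * v y\<bar> > sqrt d / real n")
    case False
    then show ?thesis using R0[of x y] N[of x y] q by (auto intro!: add_nonneg_nonneg mult_nonneg_nonneg)
  next
    case True
    then have heavy: "U x * V y > q" using n by (simp add: UV q_def field_simps)
    have lhs: "real n * (of_bool (\<bar>u x * v y\<bar> > sqrt d / real n) * (\<bar>u x * v y\<bar> * N x y)) = U x * V y * N x y"
      using True by (simp add: UV)
    consider "V y \<le> U x / q" | "U x \<le> V y / q" | "V y > U x / q" "U x > V y / q" by linarith
    then show ?thesis
    proof cases
      case 1
      then have "U x * V y \<le> U x * (U x / q)" using UV0 by (intro mult_left_mono)
      then have "U x * V y * N x y \<le> (U x)\<^sup>2 / q * N x y" using N by (intro mult_right_mono) (auto simp: power2_eq_square)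
      moreover have "(V y)\<^sup>2 / q * N x y \<ge> 0" using N q by auto
      ultimately show ?thesis using R0[of x y] unfolding lhs by linarith
    next
      case 2
      then have "V y * U x \<le> V y * (V y / q)" using UV0 by (intro mult_left_mono)
      then have "U x * V y * N x y \<le> (V y)\<^sup>2 / q * N x y" using N by (intro mult_right_mono) (auto simp: power2_eq_square mult_ac)
      moreover have "(U x)\<^sup>2 / q * N x y \<ge> 0" using N q by auto
      ultimately show ?thesis using R0[of x y] unfolding lhs by linarith
    next
      case 3
      have a: "V y * q > U x" "U x * q > V y" using 3 q by (simp_all add: field_simps)
      have U0: "U x > 0" and V0: "V y > 0" using heavy q UV0[of x] UV0[of y]
        by (auto simp: less_le)
      have "(V y * V y) * q > q * 1" using heavy a(1) V0 by (simp add: mult.commute mult.left_commute)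
           (smt (verit) mult.commute mult.left_commute mult_less_cancel_left_pos)
      then have "V y * V y > 1" using q by (simp add: mult.commute)
      then have V1: "V y \<ge> 1" using V0 by (smt (verit) mult_le_one)
      have "(U x * U x) * q > q * 1" using heavy a(2) U0
           by (smt (verit) mult.commute mult.left_commute mult_less_cancel_left_pos)
      then have "U x * U x > 1" using q by (simp add: mult.commute)
      then have U1: "U x \<ge> 1" using U0 by (smt (verit) mult_le_one)
      define s where "s = nat \<lfloor>ln (U x)\<rfloor>"
      define t where "t = nat \<lfloor>ln (V y)\<rfloor>"
      have xA: "x \<in> A s" and yB: "y \<in> B t"
        using U1 V1 xy by (auto simp: A_def B_def level_set_def s_def t_def U_def V_def)
      have sb: "real s \<le> ln (U x)" "ln (U x) < real s + 1" "real t \<le> ln (V y)" "ln (V y) < real t + 1"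
        using ln_ge_zero[OF U1] ln_ge_zero[OF V1] unfolding s_def t_def by linarith+
      have "2 * real s \<le> real n" "2 * real t \<le> real n"
        using level_le[OF u] level_le[OF v] xA yB by (auto simp: A_def B_def)
      then have st: "s + t \<le> n" by linarith
      have "ln q < ln (U x * V y)" using heavy q by simp
      then have "D < ln (U x) + ln (V y)" using U0 V0 by (simp add: lnq ln_mult_pos)
      moreover have "ln (U x) < ln (V y * q)" using a U0 by simp
      then have "ln (U x) < ln (V y) + D" using V0 q by (simp add: lnq ln_mult_pos)
      moreover have "ln (V y) < ln (U x * q)" using a V0 by simp
      then have "ln (V y) < ln (U x) + D" using U0 q by (simp add: lnq ln_mult_pos)
      ultimately have adm: "adm s t" using sb st unfolding adm_def by linarith
      have "U x * V y \<le> exp (real s + 1) * exp (real t + 1)"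
        using level_set_bounds(3)[of x n u s] level_set_bounds(3)[of y n v t] xA yB UV0
        by (intro mult_mono) (auto simp: A_def B_def U_def V_def)
      also have "\<dots> = W s t" using adm by (simp add: W_def exp_add[symmetric])
      finally have "U x * V y * N x y \<le> W s t * (of_bool (x \<in> A s \<and> y \<in> B t) * N x y)"
        using xA yB N by (simp add: mult_right_mono)
      also have "\<dots> \<le> (\<Sum>t\<le>n. W s t * (of_bool (x \<in> A s \<and> y \<in> B t) * N x y))"
        using st N by (intro member_le_sum) (auto simp: W_def)
      also have "\<dots> \<le> R x y" unfolding R_def
        using st N by (intro member_le_sum[of s "{..n}" "\<lambda>s. \<Sum>t\<le>n. W s t * (of_bool (x \<in> A s \<and> y \<in> B t) * N x y)"])
          (auto simp: W_def intro!: sum_nonneg)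
      finally have "U x * V y * N x y \<le> R x y" .
      moreover have "(U x)\<^sup>2 / q * N x y \<ge> 0" "(V y)\<^sup>2 / q * N x y \<ge> 0" using N q by auto
      ultimately show ?thesis unfolding lhs by linarith
    qed
  qed
  have degree: "(\<Sum>x=1..n. (sqrt (real n) * \<bar>w x\<bar>)\<^sup>2 / q * S x) \<le> c1 * q * real n"
    if w: "sqnorm n w \<le> 1" and S: "\<And>x. x \<in> {1..n} \<Longrightarrow> w x \<noteq> 0 \<Longrightarrow> S x \<le> c1 * d" for w S
  proof -
    have "(\<Sum>x=1..n. (sqrt (real n) * \<bar>w x\<bar>)\<^sup>2 / q * S x) \<le> (\<Sum>x=1..n. c1 * (d / q) * real n * (w x)\<^sup>2)"
    proof (intro sum_mono)
      fix x assume "x \<in> {1..n}"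
      then have "w x \<noteq> 0 \<Longrightarrow> (sqrt (real n) * \<bar>w x\<bar>)\<^sup>2 / q * S x \<le> (sqrt (real n) * \<bar>w x\<bar>)\<^sup>2 / q * (c1 * d)"
        using q by (intro mult_left_mono S) auto
      then show "(sqrt (real n) * \<bar>w x\<bar>)\<^sup>2 / q * S x \<le> c1 * (d / q) * real n * (w x)\<^sup>2"
        by (cases "w x = 0") (simp_all add: power_mult_distrib mult_ac)
    qed
    also have "\<dots> = c1 * (d / q) * real n * sqnorm n w" by (simp only: sum_distrib_left)
    also have "\<dots> \<le> c1 * (d / q) * real n * 1"
      using w C q d by (intro mult_left_mono) auto
    finally show ?thesis using q by simp
  qed
  have part1: "(\<Sum>x=1..n. \<Sum>y=1..n. (U x)\<^sup>2 / q * N x y) \<le> c1 * q * real n"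
    unfolding sum_distrib_left[symmetric] U_def by (rule degree[OF u row])
  have part2: "(\<Sum>x=1..n. \<Sum>y=1..n. (V y)\<^sup>2 / q * N x y) \<le> c1 * q * real n"
    by (subst sum.swap, unfold sum_distrib_left[symmetric] V_def, rule degree[OF v col])
  define a where "a s = card (A s)" for s
  define b where "b s = card (B s)" for s
  have ab_mass: "(\<Sum>s\<le>n. exp (2 * real s) * real (a s)) \<le> real n" "(\<Sum>s\<le>n. exp (2 * real s) * real (b s)) \<le> real n"
    using level_set_mass[OF u] level_set_mass[OF v] by (auto simp: a_def b_def A_def B_def)
  have ab_n: "a s \<le> n" "b s \<le> n" for s
    using card_mono[OF _ AB(1)[of s]] card_mono[OF _ AB(2)[of s]] by (auto simp: a_def b_def)
  define E where "E s t = exp (real s + real t + 2) / tilt d (s + t)" for s t :: nat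
  have E0: "E s t \<ge> 0" for s t using tilt_ge_1[of d "s + t"] by (auto simp: E_def)
  have W_le: "W s t * (\<Sum>x\<in>A s. \<Sum>y\<in>B t. N x y)
      \<le> C1 * (of_bool (real t \<le> real s + 1 + D) * (E s t * subset_entropy n (a s)))
       + C1 * (of_bool (real s \<le> real t + 1 + D) * (E s t * subset_entropy n (b t)))
       + C2 * exp 5 * q / real n * ((exp (2 * real s) * real (a s)) * (exp (2 * real t) * real (b t)))" for s t
  proof (cases "adm s t \<and> A s \<noteq> {} \<and> B t \<noteq> {}")
    case False
    then have "W s t * (\<Sum>x\<in>A s. \<Sum>y\<in>B t. N x y) = 0" by (auto simp: W_def)
    then show ?thesis using C q E0 ab_n
      by (auto intro!: add_nonneg_nonneg mult_nonneg_nonneg divide_nonneg_nonneg subset_entropy_nonneg)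
  next
    case True
    define th where "th = tilt d (s + t)"
    have th: "th \<ge> 1" "th \<le> real s + real t - D + 3"
      using True by (auto simp: th_def tilt_def D_def adm_def)
    have "th * (\<Sum>x\<in>A s. \<Sum>y\<in>B t. N x y) \<le> C1 * (subset_entropy n (a s) + subset_entropy n (b t))
          + C2 * exp th * d * real (a s) * real (b t) / real n"
      unfolding th_def a_def b_def using True AB by (intro disc) (auto simp: adm_def)
    then have "(\<Sum>x\<in>A s. \<Sum>y\<in>B t. N x y) \<le> (C1 * (subset_entropy n (a s) + subset_entropy n (b t))
          + C2 * exp th * d * real (a s) * real (b t) / real n) / th"
      using th by (simp add: pos_le_divide_eq mult.commute)
    moreover have W: "W s t = exp (real s + real t + 2)" using True by (simp add: W_def)
    ultimately have "W s t * (\<Sum>x\<in>A s. \<Sum>y\<in>B t. N x y) \<le> exp (real s + real t + 2) * ((C1 * (subset_entropy n (a s) + subset_entropy n (b t))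
          + C2 * exp th * d * real (a s) * real (b t) / real n) / th)"
      unfolding W by (intro mult_left_mono) auto
    also have "\<dots> = C1 * (E s t * subset_entropy n (a s)) + C1 * (E s t * subset_entropy n (b t))
         + (C2 * d * real (a s) * real (b t) / real n) * (exp (real s + real t + 2) * exp th / th)"
      by (simp add: E_def th_def[symmetric] add_divide_distrib algebra_simps)
    also have "\<dots> \<le> C1 * (E s t * subset_entropy n (a s)) + C1 * (E s t * subset_entropy n (b t))
         + (C2 * d * real (a s) * real (b t) / real n) * (exp 5 * exp (2 * real s) * exp (2 * real t) / q)"
    proof (intro add_left_mono mult_left_mono)
      have "exp (real s + real t + 2) * exp th / th \<le> exp (real s + real t + 2) * exp th / 1"
        using th by (intro divide_left_mono) auto
      also have "\<dots> \<le> exp (real s + real t + 2) * exp (real s + real t - D + 3)"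
        using th by simp
      also have "\<dots> = exp (5 + 2 * real s + 2 * real t - D)" by (simp add: exp_add[symmetric])
      also have "\<dots> = exp 5 * exp (2 * real s) * exp (2 * real t) / q"
        by (simp only: exp_diff exp_add eD)
      finally show "exp (real s + real t + 2) * exp th / th \<le> exp 5 * exp (2 * real s) * exp (2 * real t) / q" .
      show "0 \<le> C2 * d * real (a s) * real (b t) / real n" using C d by auto
    qed
    also have "(C2 * d * real (a s) * real (b t) / real n) * (exp 5 * exp (2 * real s) * exp (2 * real t) / q)
       = C2 * exp 5 * (d / q) / real n * ((exp (2 * real s) * real (a s)) * (exp (2 * real t) * real (b t)))"
      by (simp add: mult_ac)
    finally show ?thesis using True by (simp add: adm_def q(4))
  qed
  have part3: "(\<Sum>x=1..n. \<Sum>y=1..n. R x y) \<le> (60 * exp 3 * C1 + exp 5 * C2) * q * real n"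
  proof -
    have "(\<Sum>x=1..n. \<Sum>y=1..n. R x y)
        = (\<Sum>x=1..n. \<Sum>s\<le>n. \<Sum>t\<le>n. \<Sum>y=1..n. W s t * (of_bool (x \<in> A s \<and> y \<in> B t) * N x y))"
      unfolding R_def by (rule sum.cong[OF refl], rule sum_rotate)
    also have "\<dots> = (\<Sum>s\<le>n. \<Sum>t\<le>n. \<Sum>x=1..n. \<Sum>y=1..n. W s t * (of_bool (x \<in> A s \<and> y \<in> B t) * N x y))"
      by (rule sum_rotate)
    also have "\<dots> = (\<Sum>s\<le>n. \<Sum>t\<le>n. W s t * (\<Sum>x\<in>A s. \<Sum>y\<in>B t. N x y))"
      by (intro sum.cong refl) (simp only: sum_distrib_left[symmetric] sum_restrict_pairs[OF AB])
    also have "\<dots> \<le> (\<Sum>s\<le>n. \<Sum>t\<le>n.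
        C1 * (of_bool (real t \<le> real s + 1 + D) * (E s t * subset_entropy n (a s)))
       + C1 * (of_bool (real s \<le> real t + 1 + D) * (E s t * subset_entropy n (b t)))
       + C2 * exp 5 * q / real n * ((exp (2 * real s) * real (a s)) * (exp (2 * real t) * real (b t))))"
      by (intro sum_mono W_le)
    also have "\<dots> = C1 * (\<Sum>s\<le>n. \<Sum>t\<le>n. of_bool (real t \<le> real s + 1 + D) * (E s t * subset_entropy n (a s)))
       + C1 * (\<Sum>s\<le>n. \<Sum>t\<le>n. of_bool (real s \<le> real t + 1 + D) * (E s t * subset_entropy n (b t)))
       + C2 * exp 5 * q / real n * ((\<Sum>s\<le>n. exp (2 * real s) * real (a s)) * (\<Sum>t\<le>n. exp (2 * real t) * real (b t)))"
      by (simp only: sum.distrib sum_distrib_left[symmetric] sum_product)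
    also have "\<dots> \<le> C1 * (30 * exp 3 * sqrt d * real n) + C1 * (30 * exp 3 * sqrt d * real n)
       + C2 * exp 5 * q / real n * (real n * real n)"
    proof (intro add_mono mult_left_mono C)
      have filt: "(\<Sum>t\<le>n. of_bool (real t \<le> r) * f t) = (\<Sum>t | t \<le> n \<and> real t \<le> r. f t)" for r and f :: "nat \<Rightarrow> real"
        by (rule sum.mono_neutral_cong_right) auto
      have "(\<Sum>s\<le>n. \<Sum>t\<le>n. of_bool (real t \<le> real s + 1 + D) * (E s t * subset_entropy n (a s)))
          = (\<Sum>s\<le>n. \<Sum>t | t \<le> n \<and> real t \<le> real s + 1 + D. exp (real t + real s + 2) / tilt d (t + s) * subset_entropy n (a s))"
        unfolding filt E_def by (simp add: add.commute)
      also have "\<dots> \<le> 30 * exp 3 * sqrt d * real n"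
        unfolding D_def by (rule entropy_part[OF n d ab_mass(1) ab_n(1)])
      finally show "(\<Sum>s\<le>n. \<Sum>t\<le>n. of_bool (real t \<le> real s + 1 + D) * (E s t * subset_entropy n (a s)))
          \<le> 30 * exp 3 * sqrt d * real n" .
      have "(\<Sum>s\<le>n. \<Sum>t\<le>n. of_bool (real s \<le> real t + 1 + D) * (E s t * subset_entropy n (b t)))
          = (\<Sum>t\<le>n. \<Sum>s | s \<le> n \<and> real s \<le> real t + 1 + D. exp (real s + real t + 2) / tilt d (s + t) * subset_entropy n (b t))"
        unfolding filt[symmetric] E_def by (rule sum.swap)
      also have "\<dots> \<le> 30 * exp 3 * sqrt d * real n"
        unfolding D_def by (rule entropy_part[OF n d ab_mass(2) ab_n(2)])
      finally show "(\<Sum>s\<le>n. \<Sum>t\<le>n. of_bool (real s \<le> real t + 1 + D) * (E s t * subset_entropy n (b t)))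
          \<le> 30 * exp 3 * sqrt d * real n" .
    qed (use C q ab_mass in \<open>auto intro!: mult_mono sum_nonneg\<close>)
    also have "\<dots> = (60 * exp 3 * C1 + exp 5 * C2) * q * real n"
      using n by (simp add: q_def algebra_simps)
    finally show ?thesis .
  qed
  define H where "H = (\<Sum>x=1..n. \<Sum>y=1..n. of_bool (\<bar>u x * v y\<bar> > sqrt d / real n) * (\<bar>u x * v y\<bar> * N x y))"
  have "real n * H \<le> (\<Sum>x=1..n. \<Sum>y=1..n. (U x)\<^sup>2 / q * N x y + (V y)\<^sup>2 / q * N x y + R x y)"
    unfolding H_def sum_distrib_left by (intro sum_mono pointwise)
  also have "\<dots> \<le> c1 * q * real n + c1 * q * real n + (60 * exp 3 * C1 + exp 5 * C2) * q * real n"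
    unfolding sum.distrib by (intro add_mono part1 part2 part3)
  also have "\<dots> = real n * ((2 * c1 + 60 * exp 3 * C1 + exp 5 * C2) * q)" by (simp add: algebra_simps)
  finally have "H \<le> (2 * c1 + 60 * exp 3 * C1 + exp 5 * C2) * q" using n by simp
  then show ?thesis by (simp add: H_def q_def)
qed

section \<open>Markov chains with flat transition probabilities\<close>

lemma sum_mult_of_bool:
  fixes f :: "nat \<Rightarrow> real"
  assumes "finite A" "x \<in> A"
  shows "(\<Sum>y\<in>A. f y * of_bool (x = y)) = f x"
proof -
  have "(\<Sum>y\<in>A. f y * of_bool (x = y)) = (\<Sum>y\<in>A. if x = y then f y else 0)"
    by (intro sum.cong) auto
  then show ?thesis using assms by simp
qed

text \<open>A stationary chain on {1..n} all of whose transition probabilities are of order 1 / n, such as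
  a block Markov chain.\<close>

locale flat_markov_chain =
  fixes n :: nat and P :: "nat \<Rightarrow> nat \<Rightarrow> real" and \<pi> :: "nat \<Rightarrow> real"
    and M :: "'a measure" and X :: "nat \<Rightarrow> 'a \<Rightarrow> nat" and \<delta> c :: real
  assumes n_pos: "n > 0" and \<delta>_pos: "\<delta> > 0"
    and P_lower: "\<And>x y. x \<in> {1..n} \<Longrightarrow> y \<in> {1..n} \<Longrightarrow> \<delta> / real n \<le> P x y"
    and P_upper: "\<And>x y. x \<in> {1..n} \<Longrightarrow> y \<in> {1..n} \<Longrightarrow> P x y \<le> c / real n"
    and P_sum: "\<And>x. x \<in> {1..n} \<Longrightarrow> (\<Sum>y=1..n. P x y) = 1"
    and stationary: "stationary_distribution n P \<pi>"
    and chain: "markov_chain n P \<pi> M X"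

sublocale flat_markov_chain \<subseteq> prob_space M
  using chain by (simp add: markov_chain_def)

context flat_markov_chain
begin

lemma P_nonneg: "x \<in> {1..n} \<Longrightarrow> y \<in> {1..n} \<Longrightarrow> 0 \<le> P x y"
  using P_lower[of x y] \<delta>_pos n_pos by (smt (verit) divide_nonneg_nonneg of_nat_0_le_iff)

lemma X_measurable [measurable]: "X t \<in> M \<rightarrow>\<^sub>M count_space {1..n}"
  using chain by (simp add: markov_chain_def)

lemma X_in: "\<omega> \<in> space M \<Longrightarrow> X t \<omega> \<in> {1..n}"
  using measurable_space[OF X_measurable] by simp

lemma c_ge_1: "c \<ge> 1"
proof -
  have one: "1 \<in> {1..n}" using n_pos by simp
  have "1 = (\<Sum>y=1..n. P 1 y)" using P_sum[OF one] by simp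
  also have "\<dots> \<le> (\<Sum>y=1..n. c / real n)" by (intro sum_mono P_upper one)
  also have "\<dots> = c" using n_pos by simp
  finally show ?thesis .
qed

lemma \<delta>_le_1: "\<delta> \<le> 1"
proof -
  have one: "1 \<in> {1..n}" using n_pos by simp
  have "\<delta> = (\<Sum>y=1..n. \<delta> / real n)" using n_pos by simp
  also have "\<dots> \<le> (\<Sum>y=1..n. P 1 y)" by (intro sum_mono P_lower one)
  finally show ?thesis using P_sum[OF one] by simp
qed

lemma \<pi>_facts:
  "x \<in> {1..n} \<Longrightarrow> 0 \<le> \<pi> x" "(\<Sum>x=1..n. \<pi> x) = 1"
  "y \<in> {1..n} \<Longrightarrow> (\<Sum>x=1..n. \<pi> x * P x y) = \<pi> y"
  using stationary by (auto simp: stationary_distribution_def)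

lemma \<pi>_upper:
  assumes y: "y \<in> {1..n}" shows "\<pi> y \<le> c / real n"
proof -
  have "\<pi> y = (\<Sum>x=1..n. \<pi> x * P x y)" using \<pi>_facts(3)[OF y] by simp
  also have "\<dots> \<le> (\<Sum>x=1..n. \<pi> x * (c / real n))"
    by (intro sum_mono mult_left_mono P_upper \<pi>_facts y) auto
  also have "\<dots> = c / real n" using \<pi>_facts(2) by (simp add: sum_distrib_right[symmetric] sum_divide_distrib[symmetric])
  finally show ?thesis .
qed

text \<open>The mean of w over the next two states of a chain that is at x.\<close>

abbreviation two_step_avg :: "(nat \<Rightarrow> nat \<Rightarrow> real) \<Rightarrow> nat \<Rightarrow> real" where
  "two_step_avg w x \<equiv> (\<Sum>y=1..n. P x y * (\<Sum>z=1..n. P y z * w y z))"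

text \<open>A function is adapted at time t if it is determined by the path up to time t. As the state
  space is finite, such a real function takes finitely many values, and is therefore measurable
  and integrable.\<close>

definition adapted :: "nat \<Rightarrow> ('a \<Rightarrow> 'b) \<Rightarrow> bool" where
  "adapted t F \<longleftrightarrow> (\<forall>\<omega>\<in>space M. \<forall>\<omega>'\<in>space M. (\<forall>s\<le>t. X s \<omega> = X s \<omega>') \<longrightarrow> F \<omega> = F \<omega>')"

lemma adapted_comp: "adapted t F \<Longrightarrow> adapted t (\<lambda>\<omega>. f (F \<omega>))"
  unfolding adapted_def by metis

lemma adapted_comp2: "adapted t F \<Longrightarrow> adapted t G \<Longrightarrow> adapted t (\<lambda>\<omega>. f (F \<omega>) (G \<omega>))"
  unfolding adapted_def by metis

lemma adapted_X: "s \<le> t \<Longrightarrow> adapted t (X s)"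
  unfolding adapted_def by blast

lemma adapted_mono: "adapted s F \<Longrightarrow> s \<le> t \<Longrightarrow> adapted t F"
  unfolding adapted_def by (meson order_trans)

text \<open>The event that the chain follows z up to time t.\<close>

definition path_event :: "nat \<Rightarrow> (nat \<Rightarrow> nat) \<Rightarrow> 'a set" where
  "path_event t z = {\<omega> \<in> space M. \<forall>s\<le>t. X s \<omega> = z s}"

lemma X_event_sets [measurable]: "{\<omega> \<in> space M. X t \<omega> = y} \<in> sets M"
proof -
  have "{\<omega> \<in> space M. X t \<omega> = y} = X t -` ({y} \<inter> {1..n}) \<inter> space M" using X_in by auto
  also have "\<dots> \<in> sets M" by (intro measurable_sets[OF X_measurable]) auto
  finally show ?thesis .
qed

lemma path_event_sets [measurable]: "path_event t z \<in> sets M"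
proof -
  have "{\<omega> \<in> space M. X s \<omega> = z s} \<in> sets M" for s by (rule X_event_sets)
  then have "(\<Inter>s\<in>{..t}. {\<omega> \<in> space M. X s \<omega> = z s}) \<in> sets M" by (intro sets.finite_INT) auto
  also have "(\<Inter>s\<in>{..t}. {\<omega> \<in> space M. X s \<omega> = z s}) = path_event t z" by (auto simp: path_event_def)
  finally show ?thesis .
qed

text \<open>All paths up to time t; extensionality makes this a finite set.\<close>

definition paths :: "nat \<Rightarrow> (nat \<Rightarrow> nat) set" where
  "paths t = {..t} \<rightarrow>\<^sub>E {1..n}"

lemma finite_paths: "finite (paths t)" by (simp add: paths_def finite_PiE)

lemma adapted_expand:
  fixes F :: "'a \<Rightarrow> real"
  assumes F: "adapted t F"
  obtains a where "\<And>\<omega>. \<omega> \<in> space M \<Longrightarrow> F \<omega> = (\<Sum>z\<in>paths t. a z * indicator (path_event t z) \<omega>)"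
proof
  define a where "a z = F (SOME \<omega>. \<omega> \<in> path_event t z)" for z
  fix \<omega> assume \<omega>: "\<omega> \<in> space M"
  define z0 where "z0 = restrict (\<lambda>s. X s \<omega>) {..t}"
  have z0: "z0 \<in> paths t" using X_in \<omega> by (auto simp: paths_def z0_def)
  have in0: "\<omega> \<in> path_event t z0" using \<omega> by (auto simp: path_event_def z0_def)
  have uniq: "indicator (path_event t z) \<omega> = (of_bool (z = z0) :: real)" if "z \<in> paths t" for z
  proof (cases "z = z0")
    case False
    have "\<omega> \<notin> path_event t z"
    proof
      assume pe: "\<omega> \<in> path_event t z"
      have "z s = z0 s" for s
      proof (cases "s \<le> t")
        case True
        then show ?thesis using pe by (simp add: path_event_def z0_def)
      next
        case False
        then show ?thesis using that z0 by (simp add: paths_def PiE_iff extensional_def)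
      qed
      then show False using False by blast
    qed
    then show ?thesis using False by simp
  qed (use in0 in simp)
  have "(SOME \<omega>. \<omega> \<in> path_event t z0) \<in> path_event t z0" using in0 by (rule someI)
  moreover have "F \<omega>' = F \<omega>" if "\<omega>' \<in> path_event t z0" for \<omega>'
    using F in0 that unfolding adapted_def path_event_def by (smt (verit) mem_Collect_eq)
  ultimately have "a z0 = F \<omega>" unfolding a_def by blast
  moreover have "(\<Sum>z\<in>paths t. a z * indicator (path_event t z) \<omega>) = (\<Sum>z\<in>paths t. if z = z0 then a z else 0)"
    by (intro sum.cong) (auto simp: uniq)
  ultimately show "F \<omega> = (\<Sum>z\<in>paths t. a z * indicator (path_event t z) \<omega>)"
    using z0 finite_paths by simp
qed

lemma adapted_borel:
  fixes F :: "'a \<Rightarrow> real"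
  assumes "adapted t F" shows "F \<in> borel_measurable M"
proof -
  obtain a where a: "\<And>\<omega>. \<omega> \<in> space M \<Longrightarrow> F \<omega> = (\<Sum>z\<in>paths t. a z * indicator (path_event t z) \<omega>)"
    using adapted_expand[OF assms] by blast
  have "(\<lambda>\<omega>. (\<Sum>z\<in>paths t. a z * indicator (path_event t z) \<omega>)) \<in> borel_measurable M" by measurable
  then show ?thesis using a by (subst measurable_cong) auto
qed

lemma adapted_integrable:
  fixes F :: "'a \<Rightarrow> real"
  assumes "adapted t F" shows "integrable M F"
proof -
  obtain a where a: "\<And>\<omega>. \<omega> \<in> space M \<Longrightarrow> F \<omega> = (\<Sum>z\<in>paths t. a z * indicator (path_event t z) \<omega>)"
    using adapted_expand[OF assms] by blast
  have "integrable M (\<lambda>\<omega>. (\<Sum>z\<in>paths t. a z * indicator (path_event t z) \<omega>))"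
    by (intro Bochner_Integration.integrable_sum integrable_mult_right integrable_real_indicator path_event_sets)
       (auto simp: emeasure_eq_measure)
  then show ?thesis using a by (subst Bochner_Integration.integrable_cong) auto
qed

lemma adapted_event_sets:
  assumes "adapted t Q" shows "{\<omega> \<in> space M. Q \<omega>} \<in> sets M"
proof -
  have "adapted t (\<lambda>\<omega>. of_bool (Q \<omega>) :: real)" using assms by (rule adapted_comp)
  then have [measurable]: "(\<lambda>\<omega>. of_bool (Q \<omega>) :: real) \<in> borel_measurable M" by (rule adapted_borel)
  have "{\<omega> \<in> space M. (of_bool (Q \<omega>) :: real) = 1} \<in> sets M" by measurable
  then show ?thesis by simp
qed

lemma path_transition:
  assumes y: "y \<in> {1..n}"
  shows "measure M (path_event t z \<inter> {\<omega> \<in> space M. X (Suc t) \<omega> = y}) = measure M (path_event t z) * P (z t) y"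
proof -
  have eq: "{\<omega> \<in> space M. X (Suc t) \<omega> = y \<and> (\<forall>s\<le>t. X s \<omega> = z s)} = path_event t z \<inter> {\<omega> \<in> space M. X (Suc t) \<omega> = y}"
    by (auto simp: path_event_def)
  show ?thesis
  proof (cases "measure M (path_event t z) > 0")
    case True
    then have "\<P>(\<omega> in M. X (Suc t) \<omega> = y \<bar> \<forall>s\<le>t. X s \<omega> = z s) = P (z t) y"
      using chain y unfolding markov_chain_def path_event_def by blast
    then show ?thesis using True unfolding cond_prob_def eq path_event_def[symmetric]
      by (simp add: field_simps)
  next
    case False
    then have z: "measure M (path_event t z) = 0" by (simp add: zero_less_measure_iff)
    have "measure M (path_event t z \<inter> {\<omega> \<in> space M. X (Suc t) \<omega> = y}) \<le> measure M (path_event t z)"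
      by (intro finite_measure_mono) auto
    then show ?thesis using z by (simp add: measure_le_0_iff)
  qed
qed

lemma markov_step_indicator:
  fixes G :: "'a \<Rightarrow> real"
  assumes G: "adapted t G" and y: "y \<in> {1..n}"
  shows "(\<integral>\<omega>. G \<omega> * of_bool (X (Suc t) \<omega> = y) \<partial>M) = (\<integral>\<omega>. P (X t \<omega>) y * G \<omega> \<partial>M)"
proof -
  obtain a where a: "\<And>\<omega>. \<omega> \<in> space M \<Longrightarrow> G \<omega> = (\<Sum>z\<in>paths t. a z * indicator (path_event t z) \<omega>)"
    using adapted_expand[OF G] by blast
  let ?E = "{\<omega> \<in> space M. X (Suc t) \<omega> = y}"
  have "(\<integral>\<omega>. G \<omega> * of_bool (X (Suc t) \<omega> = y) \<partial>M)
      = (\<integral>\<omega>. (\<Sum>z\<in>paths t. a z * indicator (path_event t z \<inter> ?E) \<omega>) \<partial>M)"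
    by (intro Bochner_Integration.integral_cong) (auto simp: a sum_distrib_right indicator_def intro!: sum.cong)
  also have "\<dots> = (\<Sum>z\<in>paths t. a z * measure M (path_event t z \<inter> ?E))"
    by (subst Bochner_Integration.integral_sum) (auto simp: emeasure_eq_measure)
  also have "\<dots> = (\<Sum>z\<in>paths t. a z * (P (z t) y * measure M (path_event t z)))"
    by (simp add: path_transition[OF y] mult.commute)
  also have "\<dots> = (\<integral>\<omega>. (\<Sum>z\<in>paths t. a z * (P (z t) y * indicator (path_event t z) \<omega>)) \<partial>M)"
    by (subst Bochner_Integration.integral_sum) (auto simp: emeasure_eq_measure)
  also have "\<dots> = (\<integral>\<omega>. P (X t \<omega>) y * G \<omega> \<partial>M)"
    by (intro Bochner_Integration.integral_cong)
       (auto simp: a sum_distrib_left indicator_def path_event_def intro!: sum.cong exI[of _ t])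
  finally show ?thesis .
qed

text \<open>The Markov property in the form in which it is used: conditionally on the past, the next state
  is distributed according to P.\<close>

lemma markov_step:
  fixes \<phi> :: "'a \<Rightarrow> nat \<Rightarrow> real"
  assumes \<phi>: "\<And>y. y \<in> {1..n} \<Longrightarrow> adapted t (\<lambda>\<omega>. \<phi> \<omega> y)"
  shows "(\<integral>\<omega>. \<phi> \<omega> (X (Suc t) \<omega>) \<partial>M) = (\<integral>\<omega>. (\<Sum>y=1..n. P (X t \<omega>) y * \<phi> \<omega> y) \<partial>M)"
proof -
  have "(\<integral>\<omega>. \<phi> \<omega> (X (Suc t) \<omega>) \<partial>M) = (\<integral>\<omega>. (\<Sum>y=1..n. \<phi> \<omega> y * of_bool (X (Suc t) \<omega> = y)) \<partial>M)"
  proof (intro Bochner_Integration.integral_cong refl)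
    fix \<omega> assume "\<omega> \<in> space M"
    then have "X (Suc t) \<omega> \<in> {1..n}" by (rule X_in)
    then show "\<phi> \<omega> (X (Suc t) \<omega>) = (\<Sum>y=1..n. \<phi> \<omega> y * of_bool (X (Suc t) \<omega> = y))"
      by (simp add: sum_mult_of_bool)
  qed
  also have "\<dots> = (\<Sum>y=1..n. (\<integral>\<omega>. \<phi> \<omega> y * of_bool (X (Suc t) \<omega> = y) \<partial>M))"
  proof (intro Bochner_Integration.integral_sum)
    fix y assume "y \<in> {1..n}"
    then have "adapted (Suc t) (\<lambda>\<omega>. \<phi> \<omega> y * of_bool (X (Suc t) \<omega> = y))"
      using adapted_comp2[OF adapted_mono[OF \<phi>[of y], of "Suc t"] adapted_X[of "Suc t"], where f = "\<lambda>a b. a * of_bool (b = y)"] by simp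
    then show "integrable M (\<lambda>\<omega>. \<phi> \<omega> y * of_bool (X (Suc t) \<omega> = y))" by (rule adapted_integrable)
  qed
  also have "\<dots> = (\<Sum>y=1..n. (\<integral>\<omega>. P (X t \<omega>) y * \<phi> \<omega> y \<partial>M))"
    by (intro sum.cong refl markov_step_indicator \<phi>)
  also have "\<dots> = (\<integral>\<omega>. (\<Sum>y=1..n. P (X t \<omega>) y * \<phi> \<omega> y) \<partial>M)"
  proof (intro Bochner_Integration.integral_sum[symmetric])
    fix y assume "y \<in> {1..n}"
    then have "adapted t (\<lambda>\<omega>. P (X t \<omega>) y * \<phi> \<omega> y)"
      using adapted_comp2[OF \<phi>[of y] adapted_X[of t t], where f = "\<lambda>a b. P b y * a"] by simp
    then show "integrable M (\<lambda>\<omega>. P (X t \<omega>) y * \<phi> \<omega> y)" by (rule adapted_integrable)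
  qed
  finally show ?thesis .
qed

lemma markov_two_steps:
  fixes \<phi> :: "'a \<Rightarrow> nat \<Rightarrow> nat \<Rightarrow> real"
  assumes \<phi>: "\<And>y z. y \<in> {1..n} \<Longrightarrow> z \<in> {1..n} \<Longrightarrow> adapted t (\<lambda>\<omega>. \<phi> \<omega> y z)"
  shows "(\<integral>\<omega>. \<phi> \<omega> (X (Suc t) \<omega>) (X (Suc (Suc t)) \<omega>) \<partial>M)
       = (\<integral>\<omega>. two_step_avg (\<phi> \<omega>) (X t \<omega>) \<partial>M)"
proof -
  have "(\<integral>\<omega>. \<phi> \<omega> (X (Suc t) \<omega>) (X (Suc (Suc t)) \<omega>) \<partial>M)
      = (\<integral>\<omega>. (\<Sum>z=1..n. P (X (Suc t) \<omega>) z * \<phi> \<omega> (X (Suc t) \<omega>) z) \<partial>M)"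
  proof (rule markov_step)
    fix z assume z: "z \<in> {1..n}"
    show "adapted (Suc t) (\<lambda>\<omega>. \<phi> \<omega> (X (Suc t) \<omega>) z)"
      unfolding adapted_def
    proof (intro ballI impI)
      fix \<omega> \<omega>' assume w: "\<omega> \<in> space M" "\<omega>' \<in> space M" "\<forall>s\<le>Suc t. X s \<omega> = X s \<omega>'"
      have "\<phi> \<omega> (X (Suc t) \<omega>) z = \<phi> \<omega>' (X (Suc t) \<omega>) z"
        using \<phi>[OF X_in[OF w(1)] z] w unfolding adapted_def by (meson le_SucI)
      then show "\<phi> \<omega> (X (Suc t) \<omega>) z = \<phi> \<omega>' (X (Suc t) \<omega>') z" using w by simp
    qed
  qed
  also have "\<dots> = (\<integral>\<omega>. two_step_avg (\<phi> \<omega>) (X t \<omega>) \<partial>M)"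
  proof (rule markov_step)
    fix y assume y: "y \<in> {1..n}"
    show "adapted t (\<lambda>\<omega>. (\<Sum>z=1..n. P y z * \<phi> \<omega> y z))"
      unfolding adapted_def
    proof (intro ballI impI sum.cong refl arg_cong2[where f = "(*)"])
      fix \<omega> \<omega>' z assume "\<omega> \<in> space M" "\<omega>' \<in> space M" "\<forall>s\<le>t. X s \<omega> = X s \<omega>'" "z \<in> {1..n}"
      then show "\<phi> \<omega> y z = \<phi> \<omega>' y z" using \<phi>[OF y, of z] unfolding adapted_def by blast
    qed
  qed
  finally show ?thesis .
qed

text \<open>Given the state at the start of a block, every value of the next two states has probability at
  most (c / n)^2, so that the conditional moments of a function of them are controlled whatever that
  state is. Taking blocks that start at times of one parity makes consecutive blocks overlap in a
  single state only, and the bounds for the conditional means multiply.\<close>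

lemma block_product_le:
  fixes h :: "nat \<Rightarrow> nat \<Rightarrow> nat \<Rightarrow> real"
  assumes h: "\<And>x y z. h x y z \<ge> 0" and b: "b \<ge> 0"
    and step: "\<And>x. x \<in> {1..n} \<Longrightarrow> two_step_avg (h x) x \<le> b"
  shows "(\<integral>\<omega>. (\<Prod>k<m. h (X (2*k+r) \<omega>) (X (Suc (2*k+r)) \<omega>) (X (Suc (Suc (2*k+r))) \<omega>)) \<partial>M) \<le> b ^ m"
proof (induction m)
  case 0
  then show ?case by (simp add: prob_space)
next
  case (Suc m)
  define F where "F \<omega> = (\<Prod>k<m. h (X (2*k+r) \<omega>) (X (Suc (2*k+r)) \<omega>) (X (Suc (Suc (2*k+r))) \<omega>))" for \<omega>
  define t where "t = 2*m+r"
  have F0: "F \<omega> \<ge> 0" for \<omega> unfolding F_def using h by (intro prod_nonneg) auto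
  have adF: "adapted t F"
    unfolding adapted_def F_def t_def by (auto intro!: prod.cong)
  have ad: "adapted t (\<lambda>\<omega>. F \<omega> * h (X t \<omega>) y z)" for y z
    using adapted_comp2[OF adF adapted_X[of t t], where f = "\<lambda>a x. a * h x y z"] by simp
  have "(\<integral>\<omega>. F \<omega> * h (X t \<omega>) (X (Suc t) \<omega>) (X (Suc (Suc t)) \<omega>) \<partial>M)
      = (\<integral>\<omega>. two_step_avg (\<lambda>y z. F \<omega> * h (X t \<omega>) y z) (X t \<omega>) \<partial>M)"
    using markov_two_steps[of t "\<lambda>\<omega> y z. F \<omega> * h (X t \<omega>) y z"] ad by simp
  also have "\<dots> = (\<integral>\<omega>. F \<omega> * two_step_avg (h (X t \<omega>)) (X t \<omega>) \<partial>M)"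
    by (simp add: sum_distrib_left mult_ac)
  also have "\<dots> \<le> (\<integral>\<omega>. F \<omega> * b \<partial>M)"
  proof (rule integral_mono)
    have "adapted t (\<lambda>\<omega>. F \<omega> * two_step_avg (h (X t \<omega>)) (X t \<omega>))"
      using adapted_comp2[OF adF adapted_X[of t t], where f = "\<lambda>a x. a * two_step_avg (h x) x"] by simp
    then show "integrable M (\<lambda>\<omega>. F \<omega> * two_step_avg (h (X t \<omega>)) (X t \<omega>))"
      by (rule adapted_integrable)
    show "integrable M (\<lambda>\<omega>. F \<omega> * b)" using adapted_integrable[OF adF] by simp
  qed (intro mult_left_mono step X_in F0)
  also have "\<dots> = b * (\<integral>\<omega>. F \<omega> \<partial>M)" by simp
  also have "\<dots> \<le> b * b ^ m" using Suc b unfolding F_def by (intro mult_left_mono)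
  finally show ?case by (simp add: F_def t_def)
qed

text \<open>The sum of g over m blocks of three consecutive states, the first one starting at time r.\<close>

definition block_sum :: "(nat \<Rightarrow> nat \<Rightarrow> nat \<Rightarrow> real) \<Rightarrow> nat \<Rightarrow> nat \<Rightarrow> 'a \<Rightarrow> real" where
  "block_sum g r m \<omega> = (\<Sum>k<m. g (X (2*k+r) \<omega>) (X (Suc (2*k+r)) \<omega>) (X (Suc (Suc (2*k+r))) \<omega>))"

lemma adapted_block_sum: "adapted (2*m+r) (block_sum g r m)"
  unfolding adapted_def block_sum_def by (auto intro!: sum.cong)

lemma block_sum_tail:
  assumes b: "b \<ge> 0" and m: "m \<le> T"
    and step: "\<And>x. x \<in> {1..n} \<Longrightarrow> two_step_avg (\<lambda>y z. exp (g x y z)) x \<le> exp b"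
  shows "measure M {\<omega> \<in> space M. block_sum g r m \<omega> \<ge> s} \<le> exp (real T * b - s)"
proof -
  have ad: "adapted (2*m+r) (\<lambda>\<omega>. exp (block_sum g r m \<omega>))"
    using adapted_block_sum by (rule adapted_comp)
  have "measure M {\<omega> \<in> space M. block_sum g r m \<omega> \<ge> s} = measure M {\<omega> \<in> space M. exp (block_sum g r m \<omega>) \<ge> exp s}"
    by simp
  also have "\<dots> \<le> (\<integral>\<omega>. exp (block_sum g r m \<omega>) \<partial>M) / exp s"
    by (rule integral_Markov_inequality_measure[where A = "{}"]) (auto intro: adapted_integrable[OF ad])
  also have "(\<integral>\<omega>. exp (block_sum g r m \<omega>) \<partial>M) \<le> exp b ^ m"
    unfolding block_sum_def exp_sum[OF finite_lessThan]
    by (rule block_product_le) (use step in auto)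
  also have "exp b ^ m = exp (real m * b)" by (simp add: exp_of_nat_mult)
  also have "\<dots> \<le> exp (real T * b)" using b m by (simp add: mult_right_mono)
  finally show ?thesis by (simp add: exp_diff divide_right_mono)
qed

lemma sum_split_parity:
  fixes f :: "nat \<Rightarrow> real"
  shows "(\<Sum>t<N. f t) = (\<Sum>k<(N+1) div 2. f (2*k)) + (\<Sum>k<N div 2. f (2*k+1))"
proof (induction N)
  case (Suc N)
  show ?case
  proof (cases "even N")
    case True
    then obtain j where "N = 2 * j" by blast
    then show ?thesis using Suc by simp
  next
    case False
    then obtain j where "N = 2 * j + 1" using oddE by blast
    then show ?thesis using Suc by simp
  qed
qed simp

lemma triple_sum_split:
  "(\<Sum>t<N. g (X t \<omega>) (X (Suc t) \<omega>) (X (Suc (Suc t)) \<omega>)) = block_sum g 0 ((N+1) div 2) \<omega> + block_sum g 1 (N div 2) \<omega>"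
  unfolding block_sum_def by (subst sum_split_parity) simp

lemma distribution_X:
  assumes x: "x \<in> {1..n}"
  shows "measure M {\<omega> \<in> space M. X t \<omega> = x} = \<pi> x"
  using x
proof (induction t arbitrary: x)
  case 0
  then show ?case using chain by (simp add: markov_chain_def)
next
  case (Suc t)
  have ind: "(\<integral>\<omega>. of_bool (X s \<omega> = y) \<partial>M) = measure M {\<omega> \<in> space M. X s \<omega> = y}" for s y
  proof -
    have "(\<integral>\<omega>. of_bool (X s \<omega> = y) \<partial>M) = (\<integral>\<omega>. indicator {\<omega> \<in> space M. X s \<omega> = y} \<omega> \<partial>M :: real)"
      by (intro Bochner_Integration.integral_cong) (auto simp: indicator_def)
    then show ?thesis by simp
  qed
  have "measure M {\<omega> \<in> space M. X (Suc t) \<omega> = x} = (\<integral>\<omega>. 1 * of_bool (X (Suc t) \<omega> = x) \<partial>M)"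
    by (simp add: ind)
  also have "\<dots> = (\<integral>\<omega>. P (X t \<omega>) x * 1 \<partial>M)"
    using Suc.prems by (intro markov_step_indicator) (auto simp: adapted_def)
  also have "\<dots> = (\<integral>\<omega>. (\<Sum>y=1..n. P y x * of_bool (X t \<omega> = y)) \<partial>M)"
  proof (intro Bochner_Integration.integral_cong refl)
    fix \<omega> assume "\<omega> \<in> space M"
    then have "X t \<omega> \<in> {1..n}" by (rule X_in)
    then show "P (X t \<omega>) x * 1 = (\<Sum>y=1..n. P y x * of_bool (X t \<omega> = y))"
      by (simp add: sum_mult_of_bool)
  qed
  also have "\<dots> = (\<Sum>y=1..n. P y x * (\<integral>\<omega>. of_bool (X t \<omega> = y) \<partial>M))"
  proof (subst Bochner_Integration.integral_sum)
    fix y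
    have "adapted t (\<lambda>\<omega>. P y x * of_bool (X t \<omega> = y))" unfolding adapted_def by simp
    then show "integrable M (\<lambda>\<omega>. P y x * of_bool (X t \<omega> = y))" by (rule adapted_integrable)
  qed simp
  also have "\<dots> = (\<Sum>y=1..n. \<pi> y * P y x)" by (simp add: ind Suc.IH mult.commute)
  also have "\<dots> = \<pi> x" by (rule \<pi>_facts(3)[OF Suc.prems])
  finally show ?case .
qed

lemma mean_count_eq:
  assumes x: "x \<in> {1..n}" and y: "y \<in> {1..n}"
  shows "mean_count M X T x y = real T * (\<pi> x * P x y)"
proof -
  have "(\<integral>\<omega>. of_bool (X t \<omega> = x \<and> X (Suc t) \<omega> = y) \<partial>M) = \<pi> x * P x y" for t
  proof -
    have "(\<integral>\<omega>. of_bool (X t \<omega> = x \<and> X (Suc t) \<omega> = y) \<partial>M)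
        = (\<integral>\<omega>. of_bool (X t \<omega> = x) * of_bool (X (Suc t) \<omega> = y) \<partial>M :: real)"
      by (intro Bochner_Integration.integral_cong) auto
    also have "\<dots> = (\<integral>\<omega>. P (X t \<omega>) y * of_bool (X t \<omega> = x) \<partial>M)"
      by (intro markov_step_indicator y) (auto simp: adapted_def)
    also have "\<dots> = (\<integral>\<omega>. P x y * indicator {\<omega> \<in> space M. X t \<omega> = x} \<omega> \<partial>M)"
      by (intro Bochner_Integration.integral_cong) (auto simp: indicator_def)
    also have "\<dots> = \<pi> x * P x y" by (simp add: distribution_X[OF x])
    finally show ?thesis .
  qed
  moreover have "integrable M (\<lambda>\<omega>. of_bool (X t \<omega> = x \<and> X (Suc t) \<omega> = y) :: real)" for t
    by (rule adapted_integrable[of "Suc t"]) (auto simp: adapted_def)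
  ultimately have "(\<integral>\<omega>. (\<Sum>t<T. of_bool (X t \<omega> = x \<and> X (Suc t) \<omega> = y)) \<partial>M) = (\<Sum>t<T. \<pi> x * P x y)"
    by (subst Bochner_Integration.integral_sum) simp_all
  then show ?thesis unfolding mean_count_def transition_count_def by simp
qed

end

section \<open>The Poisson equation and transition counts\<close>

lemma exp_le_quadratic:
  fixes w :: real
  assumes "\<bar>w\<bar> \<le> 1"
  shows "exp w \<le> 1 + w + w\<^sup>2"
proof (cases "w \<ge> 0")
  case True
  then show ?thesis using exp_bound assms by simp
next
  case False
  have "1 - w \<le> exp (- w)" using exp_ge_add_one_self[of "- w"] by simp
  then have "exp w * (1 - w) \<le> exp w * exp (- w)" by (intro mult_left_mono) auto
  also have "\<dots> = 1" by (simp add: exp_add[symmetric])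
  also have "\<dots> \<le> (1 + w + w\<^sup>2) * (1 - w)"
  proof -
    have "(1 + w + w\<^sup>2) * (1 - w) = 1 - w * w\<^sup>2" by (simp add: algebra_simps power2_eq_square)
    moreover have "w * w\<^sup>2 \<le> 0" using False by (intro mult_nonpos_nonneg) auto
    ultimately show ?thesis by simp
  qed
  finally show ?thesis using False by (simp add: mult_le_cancel_right)
qed

lemma sum_abs_le_sqrt:
  fixes u :: "nat \<Rightarrow> real"
  assumes "(\<Sum>x\<in>S. (u x)\<^sup>2) \<le> 1" 
  shows "(\<Sum>x\<in>S. \<bar>u x\<bar>) \<le> sqrt (real (card S))"
proof -
  have "(\<Sum>x\<in>S. \<bar>u x\<bar> * \<bar>1\<bar>) \<le> L2_set u S * L2_set (\<lambda>_. 1) S" by (rule L2_set_mult_ineq)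
  also have "\<dots> \<le> 1 * sqrt (real (card S))"
    using assms by (intro mult_mono) (auto simp: L2_set_def intro: sum_nonneg)
  finally show ?thesis by simp
qed

context flat_markov_chain
begin

text \<open>The transition operator acting on functions.\<close>

definition transition_avg :: "(nat \<Rightarrow> real) \<Rightarrow> nat \<Rightarrow> real" where
  "transition_avg f x = (\<Sum>y=1..n. P x y * f y)"

text \<open>Doeblin contraction: the part \<delta> / n of each row is common to all rows, and only
  the rest, of mass 1 - \<delta>, can contribute to the oscillation.\<close>

lemma transition_avg_contracts:
  assumes osc: "\<And>y y'. y \<in> {1..n} \<Longrightarrow> y' \<in> {1..n} \<Longrightarrow> f y - f y' \<le> w"
    and x: "x \<in> {1..n}" "x' \<in> {1..n}"
  shows "transition_avg f x - transition_avg f x' \<le> (1 - \<delta>) * w"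
proof -
  define y0 where "y0 = arg_min_on f {1..n}"
  have ne: "{1..n} \<noteq> {}" using n_pos by simp
  have y0: "y0 \<in> {1..n}" "\<And>y. y \<in> {1..n} \<Longrightarrow> f y0 \<le> f y"
    using arg_min_if_finite[OF finite_atLeastAtMost ne, of f] unfolding y0_def
    by (blast, meson not_le)
  have sh: "(\<Sum>y=1..n. (P z y - \<delta> / real n) * (f y - f y0)) = transition_avg f z - f y0 - (\<Sum>y=1..n. \<delta> / real n * (f y - f y0))"
    if "z \<in> {1..n}" for z
  proof -
    have "(\<Sum>y=1..n. P z y * f y0) = f y0" using P_sum[OF that] by (simp add: sum_distrib_right[symmetric])
    then show ?thesis unfolding transition_avg_def by (simp only: left_diff_distrib right_diff_distrib sum_subtractf)
  qed
  have "transition_avg f x - transition_avg f x'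
      = (\<Sum>y=1..n. (P x y - \<delta> / real n) * (f y - f y0)) - (\<Sum>y=1..n. (P x' y - \<delta> / real n) * (f y - f y0))"
    unfolding sh[OF x(1)] sh[OF x(2)] by simp
  also have "\<dots> \<le> (\<Sum>y=1..n. (P x y - \<delta> / real n) * w) - 0"
  proof (intro diff_mono sum_mono sum_nonneg mult_left_mono mult_nonneg_nonneg)
    fix y assume y: "y \<in> {1..n}"
    show "f y - f y0 \<le> w" by (rule osc[OF y y0(1)])
    show "0 \<le> P x y - \<delta> / real n" "0 \<le> P x' y - \<delta> / real n" using P_lower x y by auto
    show "0 \<le> f y - f y0" using y0 y by simp
  qed
  also have "\<dots> = (1 - \<delta>) * w"
    using P_sum[OF x(1)] n_pos by (simp add: sum_distrib_right[symmetric] sum_subtractf)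
  finally show ?thesis .
qed

lemma stationary_avg: "(\<Sum>x=1..n. \<pi> x * transition_avg f x) = (\<Sum>y=1..n. \<pi> y * f y)"
proof -
  have "(\<Sum>x=1..n. \<pi> x * transition_avg f x) = (\<Sum>y=1..n. (\<Sum>x=1..n. \<pi> x * P x y) * f y)"
    unfolding transition_avg_def sum_distrib_left sum_distrib_right by (subst sum.swap) (simp add: mult_ac)
  also have "\<dots> = (\<Sum>y=1..n. \<pi> y * f y)"
    by (intro sum.cong refl arg_cong2[where f = "(*)"] \<pi>_facts(3))
  finally show ?thesis .
qed

text \<open>The solution is the sum of the iterates of the transition operator at h, a series that
  converges geometrically because the oscillation contracts and the stationary mean stays 0.\<close>

lemma poisson_equation:
  assumes h: "\<And>x. x \<in> {1..n} \<Longrightarrow> \<bar>h x\<bar> \<le> b" and mean: "(\<Sum>x=1..n. \<pi> x * h x) = 0"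
  obtains f where "\<And>x. x \<in> {1..n} \<Longrightarrow> f x - transition_avg f x = h x"
    "\<And>x. x \<in> {1..n} \<Longrightarrow> \<bar>f x\<bar> \<le> 2 * b / \<delta>"
proof -
  define it where "it m = (transition_avg ^^ m) h" for m
  have it_Suc: "it (Suc m) x = transition_avg (it m) x" for m x by (simp add: it_def)
  have osc: "it m x - it m x' \<le> (1 - \<delta>) ^ m * (2 * b)" if "x \<in> {1..n}" "x' \<in> {1..n}" for m x x'
    using that
  proof (induction m arbitrary: x x')
    case 0
    then show ?case using h[of x] h[of x'] by (simp add: it_def)
  next
    case (Suc m)
    have "transition_avg (it m) x - transition_avg (it m) x' \<le> (1 - \<delta>) * ((1 - \<delta>) ^ m * (2 * b))"
      by (intro transition_avg_contracts Suc)
    then show ?case by (simp add: it_Suc mult_ac)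
  qed
  have mean_it: "(\<Sum>x=1..n. \<pi> x * it m x) = 0" for m
  proof (induction m)
    case 0
    then show ?case using mean by (simp add: it_def)
  next
    case (Suc m)
    then show ?case by (simp only: it_Suc stationary_avg)
  qed
  have bd: "\<bar>it m x\<bar> \<le> (1 - \<delta>) ^ m * (2 * b)" if x: "x \<in> {1..n}" for m x
  proof -
    have eq: "it m x = (\<Sum>y=1..n. \<pi> y * (it m x - it m y))"
      using \<pi>_facts(2) mean_it[of m] by (simp add: right_diff_distrib sum_subtractf sum_distrib_right[symmetric])
    have "\<bar>\<Sum>y=1..n. \<pi> y * (it m x - it m y)\<bar> \<le> (\<Sum>y=1..n. \<pi> y * ((1 - \<delta>) ^ m * (2 * b)))"
    proof (intro order_trans[OF sum_abs] sum_mono)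
      fix y assume y: "y \<in> {1..n}"
      have "\<bar>it m x - it m y\<bar> \<le> (1 - \<delta>) ^ m * (2 * b)" using osc[OF x y, of m] osc[OF y x, of m] by linarith
      then show "\<bar>\<pi> y * (it m x - it m y)\<bar> \<le> \<pi> y * ((1 - \<delta>) ^ m * (2 * b))"
        using \<pi>_facts(1)[OF y] by (simp add: abs_mult mult_left_mono)
    qed
    also have "\<dots> = (1 - \<delta>) ^ m * (2 * b)" using \<pi>_facts(2) by (simp add: sum_distrib_right[symmetric])
    finally show ?thesis using eq by simp
  qed
  have geo: "norm (1 - \<delta>) < 1" using \<delta>_pos \<delta>_le_1 by simp
  have summ_geo: "summable (\<lambda>m. (1 - \<delta>) ^ m * (2 * b))" using geo by (intro summable_mult2 summable_geometric)
  have summ: "summable (\<lambda>m. it m x)" if "x \<in> {1..n}" for x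
    using bd[OF that] by (intro summable_comparison_test'[OF summ_geo, of 0]) simp
  define f where "f x = (\<Sum>m. it m x)" for x
  have "f x - transition_avg f x = h x" if x: "x \<in> {1..n}" for x
  proof -
    have "transition_avg f x = (\<Sum>y=1..n. (\<Sum>m. P x y * it m y))"
      unfolding transition_avg_def f_def by (intro sum.cong refl suminf_mult[symmetric] summ)
    also have "\<dots> = (\<Sum>m. \<Sum>y=1..n. P x y * it m y)"
      by (intro suminf_sum[symmetric] summable_mult summ)
    also have "\<dots> = (\<Sum>m. it (Suc m) x)" by (simp add: it_Suc transition_avg_def)
    also have "\<dots> = f x - it 0 x" unfolding f_def by (rule suminf_split_head[OF summ[OF x]])
    finally show ?thesis by (simp add: it_def)
  qed
  moreover have "\<bar>f x\<bar> \<le> 2 * b / \<delta>" if x: "x \<in> {1..n}" for x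
  proof -
    have "norm (f x) \<le> (\<Sum>m. (1 - \<delta>) ^ m * (2 * b))"
      unfolding f_def using bd[OF x] by (intro norm_suminf_le summ_geo) simp
    also have "\<dots> = (\<Sum>m. (1 - \<delta>) ^ m) * (2 * b)" using geo by (intro suminf_mult2[symmetric] summable_geometric)
    also have "\<dots> = 2 * b / \<delta>" using geo by (simp add: suminf_geometric)
    finally show ?thesis by simp
  qed
  ultimately show ?thesis by (rule that)
qed

text \<open>The transition counts without the transition at time 0. All the transitions that are left
  have a predecessor, on which one can condition; the discarded one changes the norm by at most 1.\<close>

definition late_count :: "nat \<Rightarrow> 'a \<Rightarrow> nat \<Rightarrow> nat \<Rightarrow> real" where
  "late_count T \<omega> x y = (\<Sum>t<T - 1. of_bool (X (Suc t) \<omega> = x \<and> X (Suc (Suc t)) \<omega> = y))"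

lemma transition_count_late:
  assumes "T > 0"
  shows "transition_count X T \<omega> x y = of_bool (X 0 \<omega> = x \<and> X 1 \<omega> = y) + late_count T \<omega> x y"
  using assms by (cases T) (simp_all add: transition_count_def late_count_def sum.lessThan_Suc_shift del: sum.lessThan_Suc sum_of_bool_eq)

lemma late_count_sum:
  assumes "\<omega> \<in> space M"
  shows "(\<Sum>x=1..n. \<Sum>y=1..n. w x y * late_count T \<omega> x y) = (\<Sum>t<T - 1. w (X (Suc t) \<omega>) (X (Suc (Suc t)) \<omega>))"
proof -
  have "(\<Sum>x=1..n. \<Sum>y=1..n. w x y * late_count T \<omega> x y)
      = (\<Sum>t<T - 1. \<Sum>x=1..n. \<Sum>y=1..n. w x y * of_bool (X (Suc t) \<omega> = x \<and> X (Suc (Suc t)) \<omega> = y))"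
    unfolding late_count_def sum_distrib_left
    by (subst sum.swap[of _ "{1..n}" "{..<T-1}"], rule sum.cong[OF refl], rule sum.swap)
  also have "\<dots> = (\<Sum>t<T - 1. w (X (Suc t) \<omega>) (X (Suc (Suc t)) \<omega>))"
  proof (rule sum.cong[OF refl])
    fix t
    have "(\<Sum>x=1..n. \<Sum>y=1..n. w x y * of_bool (X (Suc t) \<omega> = x \<and> X (Suc (Suc t)) \<omega> = y))
        = (\<Sum>x=1..n. (\<Sum>y=1..n. w x y * of_bool (X (Suc (Suc t)) \<omega> = y)) * of_bool (X (Suc t) \<omega> = x))"
      unfolding sum_distrib_right by (intro sum.cong refl) auto
    also have "\<dots> = w (X (Suc t) \<omega>) (X (Suc (Suc t)) \<omega>)"
      using X_in[OF assms] by (subst sum_mult_of_bool; simp add: sum_mult_of_bool del: atLeastAtMost_iff)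
    finally show "(\<Sum>x=1..n. \<Sum>y=1..n. w x y * of_bool (X (Suc t) \<omega> = x \<and> X (Suc (Suc t)) \<omega> = y))
        = w (X (Suc t) \<omega>) (X (Suc (Suc t)) \<omega>)" .
  qed
  finally show ?thesis .
qed

end

section \<open>The light pairs\<close>

text \<open>The constants of the light pairs, up to powers of n and d: a bound for the solution of the
  Poisson equation, for the increments, for their conditional second moments, and for the deviation,
  which is exceeded with probability of order exp (- \<kappa> n).\<close>

definition poisson_const :: "real \<Rightarrow> real \<Rightarrow> real" where
  "poisson_const \<delta> c = 4 * c\<^sup>2 / \<delta>"

definition increment_const :: "real \<Rightarrow> real \<Rightarrow> real" where
  "increment_const \<delta> c = 1 + c\<^sup>2 + 2 * poisson_const \<delta> c"

definition variance_const :: "real \<Rightarrow> real \<Rightarrow> real" where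
  "variance_const \<delta> c = 4 * (c\<^sup>2 + c ^ 4 + 2 * (poisson_const \<delta> c)\<^sup>2)"

definition light_const :: "real \<Rightarrow> real \<Rightarrow> real \<Rightarrow> real" where
  "light_const \<delta> c \<kappa> = 2 * (increment_const \<delta> c * (variance_const \<delta> c / (increment_const \<delta> c)\<^sup>2 + \<kappa>))
     + 2 * poisson_const \<delta> c + c\<^sup>2"

text \<open>The coefficients of the bilinear form, restricted to the light pairs.\<close>

definition light_part :: "nat \<Rightarrow> real \<Rightarrow> (nat \<Rightarrow> real) \<Rightarrow> (nat \<Rightarrow> real) \<Rightarrow> nat \<Rightarrow> nat \<Rightarrow> real" where
  "light_part n d u v x y = of_bool (\<bar>u x * v y\<bar> \<le> sqrt d / real n) * (u x * v y)"

lemma light_part_le: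
  assumes "d \<ge> 0"
  shows "\<bar>light_part n d u v x y\<bar> \<le> sqrt d / real n" "\<bar>light_part n d u v x y\<bar> \<le> \<bar>u x\<bar> * \<bar>v y\<bar>"
  using assms by (auto simp: light_part_def abs_mult)

context flat_markov_chain
begin

lemma two_step_sum_bound:
  assumes x: "x \<in> {1..n}" and w: "\<And>y z. y \<in> {1..n} \<Longrightarrow> z \<in> {1..n} \<Longrightarrow> w y z \<ge> 0"
  shows "two_step_avg w x \<le> (c / real n)\<^sup>2 * (\<Sum>y=1..n. \<Sum>z=1..n. w y z)"
proof -
  have c0: "c / real n \<ge> 0" using c_ge_1 by simp
  have "two_step_avg w x \<le> (\<Sum>y=1..n. c / real n * (\<Sum>z=1..n. c / real n * w y z))"
    using c0 by (intro sum_mono mult_mono P_upper x mult_right_mono w sum_nonneg mult_nonneg_nonneg P_nonneg) auto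
  also have "\<dots> = (c / real n)\<^sup>2 * (\<Sum>y=1..n. \<Sum>z=1..n. w y z)"
    unfolding sum_distrib_left by (intro sum.cong refl) (simp add: power2_eq_square)
  finally show ?thesis .
qed

lemma two_step_linear:
  "two_step_avg (\<lambda>y z. a * w y z + b * w' y z) x
   = a * two_step_avg w x + b * two_step_avg w' x"
  unfolding sum_distrib_left sum.distrib[symmetric] by (intro sum.cong refl) (simp add: algebra_simps)

lemma two_step_const:
  assumes "x \<in> {1..n}" shows "two_step_avg (\<lambda>y z. f y) x = transition_avg f x"
  unfolding transition_avg_def
proof (intro sum.cong refl)
  fix y assume "y \<in> {1..n}"
  then show "P x y * (\<Sum>z=1..n. P y z * f y) = P x y * f y"
    using P_sum[of y] by (simp add: sum_distrib_right[symmetric])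
qed

lemma two_step_mono:
  assumes "x \<in> {1..n}" "\<And>y z. y \<in> {1..n} \<Longrightarrow> z \<in> {1..n} \<Longrightarrow> w y z \<le> w' y z"
  shows "two_step_avg w x \<le> two_step_avg w' x"
  using assms by (intro sum_mono mult_left_mono P_nonneg)

lemma transition_avg_const: "x \<in> {1..n} \<Longrightarrow> transition_avg (\<lambda>_. a) x = a"
  unfolding transition_avg_def using P_sum[of x] by (simp add: sum_distrib_right[symmetric])

lemma transition_avg_abs:
  assumes "x \<in> {1..n}" "\<And>y. y \<in> {1..n} \<Longrightarrow> \<bar>f y\<bar> \<le> b"
  shows "\<bar>transition_avg f x\<bar> \<le> b"
proof -
  have "\<bar>transition_avg f x\<bar> \<le> (\<Sum>y=1..n. P x y * b)"
    unfolding transition_avg_def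
    using assms by (intro order_trans[OF sum_abs] sum_mono) (simp add: abs_mult P_nonneg mult_left_mono)
  also have "\<dots> = b" using P_sum[OF assms(1)] by (simp add: sum_distrib_right[symmetric])
  finally show ?thesis .
qed

text \<open>A Chernoff bound for the sum over all times: the sum is split into the blocks that start at
  even and at odd times.\<close>

lemma triple_sum_tail:
  assumes b: "b \<ge> 0"
    and step: "\<And>x. x \<in> {1..n} \<Longrightarrow> two_step_avg (\<lambda>y z. exp (g x y z)) x \<le> exp b"
  shows "{\<omega> \<in> space M. (\<Sum>t<T - 1. g (X t \<omega>) (X (Suc t) \<omega>) (X (Suc (Suc t)) \<omega>)) > 2 * s} \<in> sets M" (is "?A \<in> _")
    and "measure M {\<omega> \<in> space M. (\<Sum>t<T - 1. g (X t \<omega>) (X (Suc t) \<omega>) (X (Suc (Suc t)) \<omega>)) > 2 * s}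
         \<le> 2 * exp (real T * b - s)"
proof -
  define E where "E r = {\<omega> \<in> space M. block_sum g r ((T - 1 + 1 - r) div 2) \<omega> \<ge> s}" for r
  have E_prob: "measure M (E r) \<le> exp (real T * b - s)" for r
    unfolding E_def by (cases "T = 0 \<and> r = 0") 
      (rule block_sum_tail[OF b _ step], simp_all)+
  have E_sets: "E r \<in> sets M" for r
    unfolding E_def by (rule adapted_event_sets[OF adapted_comp[OF adapted_block_sum]])
  have "adapted (Suc T) (\<lambda>\<omega>. (\<Sum>t<T - 1. g (X t \<omega>) (X (Suc t) \<omega>) (X (Suc (Suc t)) \<omega>)) > 2 * s)"
    unfolding adapted_def by (auto intro!: arg_cong2[where f = "(<)"] sum.cong)
  then show As: "?A \<in> sets M" by (rule adapted_event_sets)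
  have "?A \<subseteq> E 0 \<union> E 1"
    unfolding triple_sum_split by (auto simp: E_def)
  then have "measure M ?A \<le> measure M (E 0 \<union> E 1)" by (intro finite_measure_mono sets.Un E_sets)
  also have "\<dots> \<le> measure M (E 0) + measure M (E 1)" by (intro measure_Un_le E_sets)
  also have "\<dots> \<le> 2 * exp (real T * b - s)" using E_prob[of 0] E_prob[of 1] by simp
  finally show "measure M ?A \<le> 2 * exp (real T * b - s)" .
qed

text \<open>The light part of the bilinear form of the centred late counts.\<close>

abbreviation light_deviation :: "nat \<Rightarrow> real \<Rightarrow> (nat \<Rightarrow> real) \<Rightarrow> (nat \<Rightarrow> real) \<Rightarrow> 'a \<Rightarrow> real" where
  "light_deviation T d u v \<omega> \<equiv>
     (\<Sum>x=1..n. \<Sum>y=1..n. light_part n d u v x y * (late_count T \<omega> x y - mean_count M X T x y))"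

text \<open>Let gbar be the two-step mean of the light part g, mu its stationary mean and f the
  solution of the Poisson equation f - P f = gbar - mu. Then
  g (y, z) - mu = D (x, y, z) + f x - f y, where D (x, y, z) = g (y, z) + f y - gbar x - (P f) x has
  mean 0 given x. The differences of f telescope along the path. As |D| is of order sqrt d / n and its
  conditional second moment of order 1 / n^2, exponential moments at \<theta> of order n / sqrt d
  give a deviation of order sqrt d with probability exponentially close to 1 in n.\<close>

lemma light_tail_one_sided:
  assumes T: "T \<ge> n" and d: "d = real T / real n"
    and u: "sqnorm n u \<le> 1" and v: "sqnorm n v \<le> 1"
  shows "measure M {\<omega> \<in> space M. light_deviation T d u v \<omega>
      > light_const \<delta> c \<kappa> * sqrt d} \<le> 2 * exp (- \<kappa> * real n)"
proof -
  have d1: "d \<ge> 1" using T n_pos by (simp add: d)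
  have n0: "real n > 0" using n_pos by simp
  have Td: "real T = d * real n" using n_pos by (simp add: d)
  define F where "F = poisson_const \<delta> c"
  define \<beta> where "\<beta> = increment_const \<delta> c"
  define V where "V = variance_const \<delta> c"
  have F0: "F \<ge> 0" using \<delta>_pos by (simp add: F_def poisson_const_def)
  have \<beta>: "\<beta> = 1 + c\<^sup>2 + 2 * F" by (simp add: \<beta>_def increment_const_def F_def)
  have \<beta>1: "\<beta> \<ge> 1" using F0 by (simp add: \<beta>)
  have V: "V = 4 * (c\<^sup>2 + c ^ 4 + 2 * F\<^sup>2)" by (simp add: V_def variance_const_def F_def)
  have V0: "V \<ge> 0" by (simp add: V)
  define g where "g = light_part n d u v"
  have g1: "\<bar>g y z\<bar> \<le> sqrt d / real n" "\<bar>g y z\<bar> \<le> \<bar>u y\<bar> * \<bar>v z\<bar>" for y z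
    unfolding g_def using d1 by (auto intro!: light_part_le)
  define gbar where "gbar x = two_step_avg g x" for x
  define mu where "mu = (\<Sum>x=1..n. \<pi> x * gbar x)"
  have gbar_bd: "\<bar>gbar x\<bar> \<le> c\<^sup>2 / real n" if x: "x \<in> {1..n}" for x
  proof -
    have "\<bar>gbar x\<bar> \<le> two_step_avg (\<lambda>y z. \<bar>g y z\<bar>) x"
      unfolding gbar_def
    proof (intro order_trans[OF sum_abs] sum_mono)
      fix y assume y: "y \<in> {1..n}"
      have "\<bar>\<Sum>z=1..n. P y z * g y z\<bar> \<le> (\<Sum>z=1..n. P y z * \<bar>g y z\<bar>)"
        using y by (intro order_trans[OF sum_abs] sum_mono) (simp add: abs_mult P_nonneg)
      then show "\<bar>P x y * (\<Sum>z=1..n. P y z * g y z)\<bar> \<le> P x y * (\<Sum>z=1..n. P y z * \<bar>g y z\<bar>)"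
        using x y by (simp add: abs_mult P_nonneg mult_left_mono)
    qed
    also have "\<dots> \<le> (c / real n)\<^sup>2 * (\<Sum>y=1..n. \<Sum>z=1..n. \<bar>g y z\<bar>)"
      by (rule two_step_sum_bound[OF x]) simp
    also have "\<dots> \<le> (c / real n)\<^sup>2 * (\<Sum>y=1..n. \<Sum>z=1..n. \<bar>u y\<bar> * \<bar>v z\<bar>)"
      by (intro mult_left_mono sum_mono g1) simp
    also have "(\<Sum>y=1..n. \<Sum>z=1..n. \<bar>u y\<bar> * \<bar>v z\<bar>) = (\<Sum>y=1..n. \<bar>u y\<bar>) * (\<Sum>z=1..n. \<bar>v z\<bar>)"
      by (simp add: sum_product)
    also have "\<dots> \<le> sqrt (real n) * sqrt (real n)"
      using sum_abs_le_sqrt[OF u] sum_abs_le_sqrt[OF v] by (intro mult_mono) (auto intro: sum_nonneg)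
    finally have "\<bar>gbar x\<bar> \<le> (c / real n)\<^sup>2 * real n" by (simp add: mult_left_mono)
    then show ?thesis using n0 by (simp add: power2_eq_square)
  qed
  have mu_bd: "\<bar>mu\<bar> \<le> c\<^sup>2 / real n"
  proof -
    have "\<bar>mu\<bar> \<le> (\<Sum>x=1..n. \<pi> x * (c\<^sup>2 / real n))"
      unfolding mu_def
    proof (intro order_trans[OF sum_abs] sum_mono)
      fix x assume x: "x \<in> {1..n}"
      show "\<bar>\<pi> x * gbar x\<bar> \<le> \<pi> x * (c\<^sup>2 / real n)"
        unfolding abs_mult abs_of_nonneg[OF \<pi>_facts(1)[OF x]] by (intro mult_left_mono gbar_bd x \<pi>_facts)
    qed
    also have "\<dots> = c\<^sup>2 / real n" using \<pi>_facts(2) by (simp add: sum_distrib_right[symmetric] sum_divide_distrib[symmetric])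
    finally show ?thesis .
  qed
  have h1: "\<bar>gbar x - mu\<bar> \<le> 2 * (c\<^sup>2 / real n)" if "x \<in> {1..n}" for x
    using gbar_bd[OF that] mu_bd by linarith
  have h2: "(\<Sum>x=1..n. \<pi> x * (gbar x - mu)) = 0"
    using \<pi>_facts(2) by (simp add: right_diff_distrib sum_subtractf sum_distrib_right[symmetric] mu_def)
  have F_eq: "2 * (2 * (c\<^sup>2 / real n)) / \<delta> = F / real n"
    by (simp add: F_def poisson_const_def field_simps)
  obtain f where f: "\<And>x. x \<in> {1..n} \<Longrightarrow> f x - transition_avg f x = gbar x - mu"
    "\<And>x. x \<in> {1..n} \<Longrightarrow> \<bar>f x\<bar> \<le> F / real n"
    using poisson_equation[of "\<lambda>x. gbar x - mu", OF h1 h2] unfolding F_eq by blast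
  have af: "\<bar>transition_avg f x\<bar> \<le> F / real n" if "x \<in> {1..n}" for x
    by (rule transition_avg_abs[OF that f(2)])
  define D where "D x y z = g y z + f y - gbar x - transition_avg f x" for x y z
  have D_mean: "two_step_avg (D x) x = 0" if x: "x \<in> {1..n}" for x
  proof -
    have "two_step_avg (D x) x
        = two_step_avg (\<lambda>y z. 1 * g y z + 1 * (f y - gbar x - transition_avg f x)) x"
      by (simp add: D_def algebra_simps)
    also have "\<dots> = gbar x + transition_avg (\<lambda>y. f y - gbar x - transition_avg f x) x"
      unfolding two_step_linear two_step_const[OF x] by (simp add: gbar_def)
    also have "transition_avg (\<lambda>y. f y - gbar x - transition_avg f x) x
        = transition_avg f x - transition_avg (\<lambda>_. gbar x + transition_avg f x) x"
      unfolding transition_avg_def[of _ x] by (simp add: algebra_simps sum_subtractf sum.distrib)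
    finally show ?thesis using x by (simp add: transition_avg_const)
  qed
  have sd: "sqrt d \<ge> 1" using d1 by simp
  have D_bd: "\<bar>D x y z\<bar> \<le> \<beta> * sqrt d / real n" if "x \<in> {1..n}" "y \<in> {1..n}" for x y z
  proof -
    have "\<bar>D x y z\<bar> \<le> \<bar>g y z\<bar> + \<bar>f y\<bar> + \<bar>gbar x\<bar> + \<bar>transition_avg f x\<bar>" unfolding D_def by linarith
    also have "\<dots> \<le> sqrt d / real n + F / real n + c\<^sup>2 / real n + F / real n"
      by (intro add_mono g1 f gbar_bd af that)
    also have "\<dots> = (sqrt d + (c\<^sup>2 + 2 * F) * 1) / real n" by (simp add: add_divide_distrib)
    also have "\<dots> \<le> (sqrt d + (c\<^sup>2 + 2 * F) * sqrt d) / real n"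
      using sd F0 by (intro divide_right_mono add_left_mono mult_left_mono) auto
    finally show ?thesis by (simp add: \<beta> algebra_simps)
  qed
  have D2: "two_step_avg (\<lambda>y z. (D x y z)\<^sup>2) x \<le> V / (real n)\<^sup>2" if x: "x \<in> {1..n}" for x
  proof -
    have "two_step_avg (\<lambda>y z. (D x y z)\<^sup>2) x
        \<le> two_step_avg (\<lambda>y z. 4 * (g y z)\<^sup>2 + 4 * ((F\<^sup>2 + c ^ 4 + F\<^sup>2) / (real n)\<^sup>2)) x"
    proof (rule two_step_mono[OF x])
      fix y z assume y: "y \<in> {1..n}"
      have sq: "(a + b - e - h)\<^sup>2 \<le> 4 * (a\<^sup>2 + b\<^sup>2 + e\<^sup>2 + h\<^sup>2)" for a b e h :: real
      proof -
        have "4 * (a\<^sup>2 + b\<^sup>2 + e\<^sup>2 + h\<^sup>2) - (a + b - e - h)\<^sup>2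
            = (a - b)\<^sup>2 + (a + e)\<^sup>2 + (a + h)\<^sup>2 + (b + e)\<^sup>2 + (b + h)\<^sup>2 + (e - h)\<^sup>2"
          by (simp add: power2_eq_square algebra_simps)
        also have "\<dots> \<ge> 0" by simp
        finally show ?thesis by simp
      qed
      have "(D x y z)\<^sup>2 \<le> 4 * ((g y z)\<^sup>2 + (f y)\<^sup>2 + (gbar x)\<^sup>2 + (transition_avg f x)\<^sup>2)"
        unfolding D_def by (rule sq)
      also have "\<dots> \<le> 4 * ((g y z)\<^sup>2 + (F / real n)\<^sup>2 + (c\<^sup>2 / real n)\<^sup>2 + (F / real n)\<^sup>2)"
        using f(2)[OF y] gbar_bd[OF x] af[OF x] F0
        by (intro mult_left_mono add_mono order_refl abs_le_square_iff[THEN iffD1]) auto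
      also have "\<dots> = 4 * (g y z)\<^sup>2 + 4 * ((F\<^sup>2 + c ^ 4 + F\<^sup>2) / (real n)\<^sup>2)"
        by (simp add: power_divide add_divide_distrib power_mult[symmetric])
      finally show "(D x y z)\<^sup>2 \<le> 4 * (g y z)\<^sup>2 + 4 * ((F\<^sup>2 + c ^ 4 + F\<^sup>2) / (real n)\<^sup>2)" .
    qed
    also have "\<dots> = 4 * two_step_avg (\<lambda>y z. (g y z)\<^sup>2) x + 4 * ((F\<^sup>2 + c ^ 4 + F\<^sup>2) / (real n)\<^sup>2)"
      unfolding two_step_linear two_step_const[OF x] transition_avg_const[OF x] by simp
    also have "two_step_avg (\<lambda>y z. (g y z)\<^sup>2) x \<le> (c / real n)\<^sup>2 * (\<Sum>y=1..n. \<Sum>z=1..n. (g y z)\<^sup>2)"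
      by (rule two_step_sum_bound[OF x]) simp
    also have "(\<Sum>y=1..n. \<Sum>z=1..n. (g y z)\<^sup>2) \<le> (\<Sum>y=1..n. \<Sum>z=1..n. (u y)\<^sup>2 * (v z)\<^sup>2)"
    proof (intro sum_mono)
      fix y z
      have "\<bar>g y z\<bar>\<^sup>2 \<le> (\<bar>u y\<bar> * \<bar>v z\<bar>)\<^sup>2" using g1 by (intro power_mono) auto
      then show "(g y z)\<^sup>2 \<le> (u y)\<^sup>2 * (v z)\<^sup>2" by (simp add: power_mult_distrib)
    qed
    also have "(\<Sum>y=1..n. \<Sum>z=1..n. (u y)\<^sup>2 * (v z)\<^sup>2) = sqnorm n u * (\<Sum>z=1..n. (v z)\<^sup>2)"
      by (simp add: sum_product)
    also have "\<dots> \<le> 1 * 1" using u v by (intro mult_mono) (auto intro: sum_nonneg)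
    finally have "two_step_avg (\<lambda>y z. (D x y z)\<^sup>2) x
        \<le> 4 * ((c / real n)\<^sup>2 * (1 * 1)) + 4 * ((F\<^sup>2 + c ^ 4 + F\<^sup>2) / (real n)\<^sup>2)"
      by (simp add: mult_left_mono)
    also have "\<dots> = V / (real n)\<^sup>2" by (simp add: V power_divide add_divide_distrib)
    finally show ?thesis .
  qed
  \<comment> \<open>Chosen such that the exponent stays in [-1, 1].\<close>
  define \<theta> where "\<theta> = real n / (\<beta> * sqrt d)"
  have \<theta>0: "\<theta> > 0" using n0 \<beta>1 sd by (simp add: \<theta>_def)
  define b where "b = V / (\<beta>\<^sup>2 * d)"
  have \<theta>b: "\<theta>\<^sup>2 * (V / (real n)\<^sup>2) = b"
    using n0 d1 by (simp add: \<theta>_def b_def power_divide power_mult_distrib)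
  have b0: "b \<ge> 0" using V0 d1 by (simp add: b_def)
  have step: "two_step_avg (\<lambda>y z. exp (\<theta> * D x y z)) x \<le> exp b" if x: "x \<in> {1..n}" for x
  proof -
    have "two_step_avg (\<lambda>y z. exp (\<theta> * D x y z)) x
        \<le> two_step_avg (\<lambda>y z. 1 * (1 + \<theta> * D x y z) + \<theta>\<^sup>2 * (D x y z)\<^sup>2) x"
    proof (rule two_step_mono[OF x])
      fix y z assume y: "y \<in> {1..n}"
      have "\<bar>\<theta> * D x y z\<bar> \<le> \<theta> * (\<beta> * sqrt d / real n)"
        unfolding abs_mult using D_bd[OF x y, of z] \<theta>0 by (intro mult_mono) auto
      also have "\<dots> = 1" using n0 \<beta>1 sd by (simp add: \<theta>_def)
      finally show "exp (\<theta> * D x y z) \<le> 1 * (1 + \<theta> * D x y z) + \<theta>\<^sup>2 * (D x y z)\<^sup>2"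
        using exp_le_quadratic[of "\<theta> * D x y z"] by (simp add: power_mult_distrib)
    qed
    also have "\<dots> = 1 * two_step_avg (\<lambda>y z. 1 + \<theta> * D x y z) x
        + \<theta>\<^sup>2 * two_step_avg (\<lambda>y z. (D x y z)\<^sup>2) x"
      by (rule two_step_linear)
    also have "two_step_avg (\<lambda>y z. 1 + \<theta> * D x y z) x = 1"
    proof -
      have "two_step_avg (\<lambda>y z. 1 + \<theta> * D x y z) x
          = two_step_avg (\<lambda>y z. 1 * 1 + \<theta> * D x y z) x" by simp
      also have "\<dots> = 1 * two_step_avg (\<lambda>y z. 1) x + \<theta> * two_step_avg (D x) x"
        by (rule two_step_linear)
      also have "\<dots> = 1"
        unfolding D_mean[OF x] two_step_const[OF x] transition_avg_const[OF x] by simp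
      finally show ?thesis .
    qed
    also have "1 * 1 + \<theta>\<^sup>2 * two_step_avg (\<lambda>y z. (D x y z)\<^sup>2) x \<le> 1 + b"
      unfolding \<theta>b[symmetric] mult_1_left by (intro add_left_mono mult_left_mono D2 x) simp
    also have "1 + b \<le> exp b" by (rule exp_ge_add_one_self)
    finally show ?thesis .
  qed
  define s where "s = real n * (V / \<beta>\<^sup>2 + \<kappa>)"
  have Tb: "real T * b = real n * (V / \<beta>\<^sup>2)"
    using d1 by (simp add: Td b_def)
  define N where "N = T - 1"
  define E where "E = {\<omega> \<in> space M. (\<Sum>t<T - 1. \<theta> * D (X t \<omega>) (X (Suc t) \<omega>) (X (Suc (Suc t)) \<omega>)) > 2 * s}"
  note tail = triple_sum_tail[OF b0 step, of s T, folded E_def]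
  have sub: "{\<omega> \<in> space M. light_deviation T d u v \<omega>
      > light_const \<delta> c \<kappa> * sqrt d} \<subseteq> E"
  proof (rule subsetI, rule ccontr)
    fix \<omega> assume w: "\<omega> \<in> {\<omega> \<in> space M. light_deviation T d u v \<omega>
      > light_const \<delta> c \<kappa> * sqrt d}" and nE: "\<omega> \<notin> E"
    have \<omega>: "\<omega> \<in> space M" using w by simp
    have Xin: "X t \<omega> \<in> {1..n}" for t by (rule X_in[OF \<omega>])
    have mean: "(\<Sum>x=1..n. \<Sum>y=1..n. g x y * mean_count M X T x y) = real T * mu"
    proof -
      have "(\<Sum>x=1..n. \<Sum>y=1..n. g x y * mean_count M X T x y) = real T * (\<Sum>x=1..n. \<pi> x * (\<Sum>y=1..n. P x y * g x y))"
        unfolding sum_distrib_left by (intro sum.cong refl) (simp add: mean_count_eq mult_ac)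
      also have "(\<Sum>x=1..n. \<pi> x * (\<Sum>y=1..n. P x y * g x y)) = mu"
        unfolding mu_def gbar_def using stationary_avg[of "\<lambda>x. \<Sum>y=1..n. P x y * g x y"]
        by (simp add: transition_avg_def)
      finally show ?thesis .
    qed
    have "(\<Sum>x=1..n. \<Sum>y=1..n. g x y * (late_count T \<omega> x y - mean_count M X T x y))
       = (\<Sum>t<N. g (X (Suc t) \<omega>) (X (Suc (Suc t)) \<omega>)) - real T * mu"
      unfolding right_diff_distrib sum_subtractf mean late_count_sum[OF \<omega>] N_def ..
    also have "(\<Sum>t<N. g (X (Suc t) \<omega>) (X (Suc (Suc t)) \<omega>))
       = (\<Sum>t<N. D (X t \<omega>) (X (Suc t) \<omega>) (X (Suc (Suc t)) \<omega>) + (f (X t \<omega>) - f (X (Suc t) \<omega>)) + mu)"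
    proof (intro sum.cong refl)
      fix t
      show "g (X (Suc t) \<omega>) (X (Suc (Suc t)) \<omega>)
        = D (X t \<omega>) (X (Suc t) \<omega>) (X (Suc (Suc t)) \<omega>) + (f (X t \<omega>) - f (X (Suc t) \<omega>)) + mu"
        using f(1)[OF Xin[of t]] by (simp add: D_def)
    qed
    also have "\<dots> = (\<Sum>t<N. D (X t \<omega>) (X (Suc t) \<omega>) (X (Suc (Suc t)) \<omega>)) + (f (X 0 \<omega>) - f (X N \<omega>)) + real N * mu"
      using sum_lessThan_telescope'[of "\<lambda>t. f (X t \<omega>)" N] by (simp add: sum.distrib)
    also have "\<dots> - real T * mu = (\<Sum>t<N. D (X t \<omega>) (X (Suc t) \<omega>) (X (Suc (Suc t)) \<omega>)) + (f (X 0 \<omega>) - f (X N \<omega>)) - mu"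
    proof -
      have "real T = real N + 1" using T n_pos by (simp add: N_def)
      then show ?thesis by (simp add: algebra_simps)
    qed
    finally have eq: "(\<Sum>x=1..n. \<Sum>y=1..n. g x y * (late_count T \<omega> x y - mean_count M X T x y))
        = (\<Sum>t<N. D (X t \<omega>) (X (Suc t) \<omega>) (X (Suc (Suc t)) \<omega>)) + (f (X 0 \<omega>) - f (X N \<omega>)) - mu" .
    have "\<theta> * (\<Sum>t<N. D (X t \<omega>) (X (Suc t) \<omega>) (X (Suc (Suc t)) \<omega>)) \<le> 2 * s"
      using nE \<omega> by (simp add: E_def N_def sum_distrib_left)
    then have "(\<Sum>t<N. D (X t \<omega>) (X (Suc t) \<omega>) (X (Suc (Suc t)) \<omega>)) \<le> 2 * s / \<theta>"
      using \<theta>0 by (simp add: pos_le_divide_eq mult.commute)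
    also have "2 * s / \<theta> = 2 * (\<beta> * (V / \<beta>\<^sup>2 + \<kappa>)) * sqrt d"
      using n0 by (simp add: s_def \<theta>_def)
    finally have 1: "(\<Sum>t<N. D (X t \<omega>) (X (Suc t) \<omega>) (X (Suc (Suc t)) \<omega>)) \<le> 2 * (\<beta> * (V / \<beta>\<^sup>2 + \<kappa>)) * sqrt d" .
    have "1 \<le> real n * sqrt d" using mult_mono[of 1 "real n" 1 "sqrt d"] n_pos sd by simp
    then have inv: "a / real n \<le> a * sqrt d" if "a \<ge> 0" for a :: real
      using n0 that mult_left_mono[of 1 "real n * sqrt d" a] by (simp add: pos_divide_le_eq mult_ac)
    have 2: "f (X 0 \<omega>) - f (X N \<omega>) \<le> 2 * F * sqrt d"
      using f(2)[OF Xin[of 0]] f(2)[OF Xin[of N]] inv[OF F0] by linarith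
    have 3: "- mu \<le> c\<^sup>2 * sqrt d" using mu_bd inv[of "c\<^sup>2"] by simp
    have "(\<Sum>x=1..n. \<Sum>y=1..n. g x y * (late_count T \<omega> x y - mean_count M X T x y)) \<le> light_const \<delta> c \<kappa> * sqrt d"
      unfolding eq light_const_def \<beta>_def[symmetric] V_def[symmetric] F_def[symmetric]
      using 1 2 3 by (simp add: algebra_simps)
    then show False using w by (simp add: g_def)
  qed
  have "measure M {\<omega> \<in> space M. light_deviation T d u v \<omega>
      > light_const \<delta> c \<kappa> * sqrt d} \<le> measure M E"
    by (intro finite_measure_mono sub tail)
  also have "\<dots> \<le> 2 * exp (real T * b - s)" by (rule tail)
  also have "real T * b - s = - \<kappa> * real n" unfolding Tb s_def by (simp add: algebra_simps)
  finally show ?thesis .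
qed

lemma adapted_late_count: "adapted (Suc T) (\<lambda>\<omega>. late_count T \<omega>)"
  unfolding adapted_def late_count_def by (auto intro!: ext sum.cong)

lemma light_event_sets:
  "{\<omega> \<in> space M. (\<Sum>x=1..n. \<Sum>y=1..n. w x y * (late_count T \<omega> x y - mean_count M X T x y)) > s} \<in> sets M"
  using adapted_late_count[of T]
  by (intro adapted_event_sets[of "Suc T"] adapted_comp[where F = "\<lambda>\<omega>. late_count T \<omega>" and
      f = "\<lambda>L. (\<Sum>x=1..n. \<Sum>y=1..n. w x y * (L x y - mean_count M X T x y)) > s"])

lemma light_tail:
  assumes T: "T \<ge> n" and d: "d = real T / real n"
    and u: "sqnorm n u \<le> 1" and v: "sqnorm n v \<le> 1"
  shows "{\<omega> \<in> space M. \<bar>light_deviation T d u v \<omega>\<bar>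
      > light_const \<delta> c \<kappa> * sqrt d} \<in> sets M" (is "?A \<in> _")
   "measure M {\<omega> \<in> space M. \<bar>light_deviation T d u v \<omega>\<bar>
      > light_const \<delta> c \<kappa> * sqrt d} \<le> 4 * exp (- \<kappa> * real n)"
proof -
  define B where "B u = {\<omega> \<in> space M. light_deviation T d u v \<omega>
      > light_const \<delta> c \<kappa> * sqrt d}" for u
  have neg: "light_part n d (\<lambda>x. - u x) v x y = - light_part n d u v x y" for x y
    by (simp add: light_part_def)
  have A: "?A = B u \<union> B (\<lambda>x. - u x)"
    unfolding B_def neg by (auto simp: sum_negf)
  have Bs: "B u \<in> sets M" for u unfolding B_def by (rule light_event_sets)
  show "?A \<in> sets M" unfolding A by (intro sets.Un Bs)
  have "measure M ?A \<le> measure M (B u) + measure M (B (\<lambda>x. - u x))"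
    unfolding A by (intro measure_Un_le Bs)
  also have "\<dots> \<le> 2 * exp (- \<kappa> * real n) + 2 * exp (- \<kappa> * real n)"
    unfolding B_def by (intro add_mono light_tail_one_sided[OF T d _ v]) (use u in simp_all)
  finally show "measure M ?A \<le> 4 * exp (- \<kappa> * real n)" by simp
qed

end

section \<open>Discrepancy and busy states\<close>

lemma subset_entropy_ge:
  assumes "1 \<le> a" "a \<le> n"
  shows "subset_entropy n a \<ge> 1 + ln (real n)"
proof -
  have ge: "ln (real a) \<le> real a - 1" using assms by (intro ln_le_minus_one) simp
  have "(real a - 1) * (1 + ln (real a)) \<le> (real a - 1) * (1 + ln (real n))"
    using assms by (intro mult_left_mono) auto
  moreover have "(real a - 1) * (1 + ln (real a)) - real a * ln (real a) = real a - 1 - ln (real a)"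
    by (simp add: algebra_simps)
  ultimately have "real a * ln (real a) \<le> (real a - 1) * (1 + ln (real n))" using ge by linarith
  then show ?thesis using assms by (simp add: subset_entropy_def ln_div algebra_simps)
qed

lemma binomial_le_entropy:
  assumes "1 \<le> a" "a \<le> n"
  shows "real (n choose a) \<le> exp (subset_entropy n a)"
proof -
  define z where "z = real a / real n"
  have z: "z > 0" using assms by (simp add: z_def)
  have "real (n choose a) * z ^ a = real (n choose a) * z ^ a * 1 ^ (n - a)" by simp
  also have "\<dots> \<le> (\<Sum>k\<le>n. real (n choose k) * z ^ k * 1 ^ (n - k))"
    using assms z by (intro member_le_sum[of a "{..n}" "\<lambda>k. real (n choose k) * z ^ k * 1 ^ (n - k)"]) auto
  also have "\<dots> = (z + 1) ^ n" by (rule binomial_ring[symmetric])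
  also have "\<dots> \<le> exp z ^ n" using z exp_ge_add_one_self[of z] by (intro power_mono) (auto simp: add.commute)
  also have "\<dots> = exp (real a)" using assms by (simp add: exp_of_nat_mult[symmetric] z_def)
  finally have "real (n choose a) \<le> exp (real a) / z ^ a" using z by (simp add: pos_le_divide_eq)
  also have "\<dots> = exp (real a) * (real n / real a) ^ a" by (simp add: z_def power_divide)
  also have "(real n / real a) ^ a = exp (real a * ln (real n / real a))"
    using assms by (simp add: exp_of_nat_mult)
  also have "exp (real a) * exp (real a * ln (real n / real a)) = exp (subset_entropy n a)"
    by (simp add: subset_entropy_def exp_add[symmetric] algebra_simps)
  finally show ?thesis .
qed

text \<open>The factor 3 leaves exp (- 2 h) after the number of subsets of a given size is paid for,
  and the entropy h of a nonempty set is at least 1 + ln n.\<close>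

lemma sum_subsets_entropy:
  assumes n: "n > 0"
  shows "(\<Sum>A\<in>Pow {1..n} - {{}}. exp (- (3 * subset_entropy n (card A)))) \<le> 1 / real n"
proof -
  let ?S = "Pow {1..n} - {{}}"
  have fin: "finite ?S" by simp
  have card_in: "card ` ?S \<subseteq> {1..n}"
  proof
    fix k assume "k \<in> card ` ?S"
    then obtain A where A: "A \<subseteq> {1..n}" "A \<noteq> {}" "k = card A" by auto
    have "finite A" using A finite_subset by blast
    then show "k \<in> {1..n}" using A card_mono[of "{1..n}" A] by (auto simp: Suc_le_eq card_gt_0_iff)
  qed
  have "(\<Sum>A\<in>?S. exp (- (3 * subset_entropy n (card A))))
      = (\<Sum>a\<in>{1..n}. \<Sum>A\<in>{A \<in> ?S. card A = a}. exp (- (3 * subset_entropy n (card A))))"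
    by (rule sum.group[OF fin finite_atLeastAtMost card_in, symmetric])
  also have "\<dots> = (\<Sum>a\<in>{1..n}. real (n choose a) * exp (- (3 * subset_entropy n a)))"
  proof (rule sum.cong[OF refl])
    fix a assume a: "a \<in> {1..n}"
    have "{A \<in> ?S. card A = a} = {A. A \<subseteq> {1..n} \<and> card A = a}" using a by auto
    then have "card {A \<in> ?S. card A = a} = n choose a" using n_subsets[of "{1..n}" a] by simp
    then show "(\<Sum>A\<in>{A \<in> ?S. card A = a}. exp (- (3 * subset_entropy n (card A))))
        = real (n choose a) * exp (- (3 * subset_entropy n a))" by simp
  qed
  also have "\<dots> \<le> (\<Sum>a\<in>{1..n}. 1 / (real n)\<^sup>2)"
  proof (rule sum_mono)
    fix a assume a: "a \<in> {1..n}"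
    define h where "h = subset_entropy n a"
    have h: "h \<ge> ln (real n)" using subset_entropy_ge[of a n] a by (simp add: h_def)
    have "real (n choose a) * exp (- (3 * h)) \<le> exp h * exp (- (3 * h))"
      using binomial_le_entropy[of a n] a by (intro mult_right_mono) (auto simp: h_def)
    also have "\<dots> = exp (- (2 * h))" by (simp add: exp_add[symmetric])
    also have "\<dots> \<le> exp (- (2 * ln (real n)))" using h by simp
    also have "\<dots> = 1 / (real n)\<^sup>2"
      using n by (simp add: exp_minus exp_double inverse_eq_divide)
    finally show "real (n choose a) * exp (- (3 * subset_entropy n a)) \<le> 1 / (real n)\<^sup>2" by (simp add: h_def)
  qed
  also have "\<dots> = 1 / real n" using n by (simp add: power2_eq_square)
  finally show ?thesis .
qed

text \<open>The states visited more than L times.\<close>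

abbreviation busy_states :: "nat \<Rightarrow> (nat \<Rightarrow> 'a \<Rightarrow> nat) \<Rightarrow> nat \<Rightarrow> 'a \<Rightarrow> real \<Rightarrow> nat set" where
  "busy_states n X T \<omega> L \<equiv> {w \<in> {1..n}. visits n X T \<omega> w > L}"

context flat_markov_chain
begin

text \<open>The event that there are too many transitions from A to B.\<close>

abbreviation crowded_pair :: "nat \<Rightarrow> real \<Rightarrow> nat set \<Rightarrow> nat set \<Rightarrow> real \<Rightarrow> real \<Rightarrow> 'a set" where
  "crowded_pair T d A B \<theta> s \<equiv> {\<omega> \<in> space M. \<theta> * (\<Sum>x\<in>A. \<Sum>y\<in>B. late_count T \<omega> x y)
     > 2 * c\<^sup>2 * exp \<theta> * d * real (card A) * real (card B) / real n + 2 * s}"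

lemma pair_count_tail:
  assumes T: "T \<ge> n" and d: "d = real T / real n" and A: "A \<subseteq> {1..n}" and B: "B \<subseteq> {1..n}" and \<theta>: "\<theta> \<ge> 0"
  shows "crowded_pair T d A B \<theta> s \<in> sets M"
    and "measure M (crowded_pair T d A B \<theta> s) \<le> 2 * exp (- s)"
proof -
  define b where "b = (exp \<theta> - 1) * ((c / real n)\<^sup>2 * (real (card A) * real (card B)))"
  have b0: "b \<ge> 0" using \<theta> by (simp add: b_def)
  have step: "two_step_avg (\<lambda>y z. exp (\<theta> * of_bool (y \<in> A \<and> z \<in> B))) x \<le> exp b"
    if x: "x \<in> {1..n}" for x
  proof -
    have "two_step_avg (\<lambda>y z. exp (\<theta> * of_bool (y \<in> A \<and> z \<in> B))) x
        = two_step_avg (\<lambda>y z. 1 * 1 + (exp \<theta> - 1) * of_bool (y \<in> A \<and> z \<in> B)) x"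
      by (intro sum.cong refl arg_cong2[where f = "(*)"]) auto
    also have "\<dots> = 1 + (exp \<theta> - 1) * two_step_avg (\<lambda>y z. of_bool (y \<in> A \<and> z \<in> B)) x"
      unfolding two_step_linear two_step_const[OF x] transition_avg_const[OF x] by simp
    also have "\<dots> \<le> 1 + (exp \<theta> - 1) * ((c / real n)\<^sup>2 * (\<Sum>y=1..n. \<Sum>z=1..n. of_bool (y \<in> A \<and> z \<in> B)))"
      using \<theta> by (intro add_left_mono mult_left_mono two_step_sum_bound x) auto
    also have "(\<Sum>y=1..n. \<Sum>z=1..n. of_bool (y \<in> A \<and> z \<in> B)) = real (card A) * real (card B)"
      using sum_restrict_pairs[OF A B, of "\<lambda>_ _. 1"] by simp
    also have "1 + (exp \<theta> - 1) * ((c / real n)\<^sup>2 * (real (card A) * real (card B))) \<le> exp b"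
      unfolding b_def by (rule exp_ge_add_one_self)
    finally show ?thesis .
  qed
  define \<mu> where "\<mu> = c\<^sup>2 * exp \<theta> * d * real (card A) * real (card B) / real n"
  have Tb: "real T * b \<le> \<mu>"
  proof -
    have "b \<le> exp \<theta> * ((c / real n)\<^sup>2 * (real (card A) * real (card B)))"
      unfolding b_def by (intro mult_right_mono) auto
    then have "real T * b \<le> real T * (exp \<theta> * ((c / real n)\<^sup>2 * (real (card A) * real (card B))))"
      by (intro mult_left_mono) auto
    also have "\<dots> = \<mu>" by (simp add: \<mu>_def d power2_eq_square)
    finally show ?thesis .
  qed
  have eq: "crowded_pair T d A B \<theta> s
      = {\<omega> \<in> space M. (\<Sum>t<T - 1. \<theta> * of_bool (X (Suc t) \<omega> \<in> A \<and> X (Suc (Suc t)) \<omega> \<in> B)) > 2 * (\<mu> + s)}"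
  proof (rule Collect_cong, rule conj_cong[OF refl])
    fix \<omega> assume \<omega>: "\<omega> \<in> space M"
    have "\<theta> * (\<Sum>x\<in>A. \<Sum>y\<in>B. late_count T \<omega> x y) = (\<Sum>t<T - 1. \<theta> * of_bool (X (Suc t) \<omega> \<in> A \<and> X (Suc (Suc t)) \<omega> \<in> B))"
      unfolding sum_restrict_pairs[OF A B, symmetric]
        late_count_sum[OF \<omega>, where w = "\<lambda>x y. of_bool (x \<in> A \<and> y \<in> B)"] sum_distrib_left ..
    moreover have "2 * c\<^sup>2 * exp \<theta> * d * real (card A) * real (card B) / real n + 2 * s = 2 * (\<mu> + s)"
      by (simp add: \<mu>_def)
    ultimately show "(\<theta> * (\<Sum>x\<in>A. \<Sum>y\<in>B. late_count T \<omega> x y) > 2 * c\<^sup>2 * exp \<theta> * d * real (card A) * real (card B) / real n + 2 * s)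
      \<longleftrightarrow> (\<Sum>t<T - 1. \<theta> * of_bool (X (Suc t) \<omega> \<in> A \<and> X (Suc (Suc t)) \<omega> \<in> B)) > 2 * (\<mu> + s)" by (simp only:)
  qed
  note tail = triple_sum_tail[where g = "\<lambda>x y z. \<theta> * of_bool (y \<in> A \<and> z \<in> B)", OF b0 step, of "\<mu> + s" T]
  show "crowded_pair T d A B \<theta> s \<in> sets M"
    unfolding eq by (rule tail(1))
  have "2 * exp (real T * b - (\<mu> + s)) \<le> 2 * exp (- s)" using Tb by simp
  then show "measure M (crowded_pair T d A B \<theta> s) \<le> 2 * exp (- s)"
    unfolding eq using tail(2) by linarith
qed

text \<open>The event that the discrepancy bound fails for some pair of nonempty sets
  of states and some tilt; its complement is the hypothesis of the bound for the heavy pairs.\<close>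

definition discrepancy_failure :: "nat \<Rightarrow> real \<Rightarrow> 'a set" where
  "discrepancy_failure T d = (\<Union>(A, B, m) \<in> (Pow {1..n} - {{}}) \<times> (Pow {1..n} - {{}}) \<times> {..n}.
     crowded_pair T d A B (tilt d m) (3 * (subset_entropy n (card A) + subset_entropy n (card B))))"

lemma discrepancy_failure:
  assumes T: "T \<ge> n" and d: "d = real T / real n"
  shows "discrepancy_failure T d \<in> sets M" "measure M (discrepancy_failure T d) \<le> 4 / real n"
proof -
  let ?S = "Pow {1..n} - {{}} :: nat set set"
  let ?h = "\<lambda>A. subset_entropy n (card A)"
  let ?E = "\<lambda>(A, B, m). crowded_pair T d A B (tilt d m) (3 * (?h A + ?h B))"
  have fin: "finite (?S \<times> ?S \<times> {..n})" by simp
  have E: "?E q \<in> sets M \<and> measure M (?E q) \<le> (\<lambda>(A, B, m). 2 * exp (- (3 * (?h A + ?h B)))) q"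
    if q: "q \<in> ?S \<times> ?S \<times> {..n}" for q
  proof (cases q)
    case (fields A B m)
    then have AB: "A \<subseteq> {1..n}" "B \<subseteq> {1..n}" using q by auto
    show ?thesis
      unfolding fields prod.case
      by (intro conjI pair_count_tail[OF T d AB] tilt_nonneg)
  qed
  have D: "discrepancy_failure T d = (\<Union>q\<in>?S \<times> ?S \<times> {..n}. ?E q)"
    by (simp add: discrepancy_failure_def)
  show "discrepancy_failure T d \<in> sets M" unfolding D using fin E by (intro sets.finite_UN) auto
  have "measure M (discrepancy_failure T d) \<le> (\<Sum>q\<in>?S \<times> ?S \<times> {..n}. measure M (?E q))"
    unfolding D using fin E by (intro measure_UNION_le) auto
  also have "\<dots> \<le> (\<Sum>(A, B, m)\<in>?S \<times> ?S \<times> {..n}. 2 * exp (- (3 * (?h A + ?h B))))"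
    using E by (intro sum_mono) auto
  also have "\<dots> = (\<Sum>A\<in>?S. \<Sum>B\<in>?S. \<Sum>m\<in>{..n}. 2 * exp (- (3 * (?h A + ?h B))))"
    by (simp only: sum.cartesian_product)
  also have "\<dots> = (\<Sum>A\<in>?S. \<Sum>B\<in>?S. (2 * (real n + 1)) * (exp (- (3 * ?h A)) * exp (- (3 * ?h B))))"
  proof (intro sum.cong refl)
    fix A B :: "nat set"
    have "- (3 * (?h A + ?h B)) = - (3 * ?h A) + - (3 * ?h B)" by simp
    then have e: "exp (- (3 * (?h A + ?h B))) = exp (- (3 * ?h A)) * exp (- (3 * ?h B))"
      by (simp only: exp_add)
    show "(\<Sum>m\<in>{..n}. 2 * exp (- (3 * (?h A + ?h B)))) = (2 * (real n + 1)) * (exp (- (3 * ?h A)) * exp (- (3 * ?h B)))"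
      unfolding e by simp
  qed
  also have "\<dots> = (2 * (real n + 1)) * ((\<Sum>A\<in>?S. exp (- (3 * ?h A))) * (\<Sum>B\<in>?S. exp (- (3 * ?h B))))"
    by (subst sum_product) (simp only: sum_distrib_left)
  also have "\<dots> \<le> (2 * (real n + 1)) * (1 / real n * (1 / real n))"
    using sum_subsets_entropy[OF n_pos] by (intro mult_left_mono mult_mono) (auto intro: sum_nonneg)
  also have "\<dots> \<le> (4 * real n) * (1 / real n * (1 / real n))"
    using n_pos by (intro mult_right_mono) auto
  also have "\<dots> = 4 / real n" using n_pos by simp
  finally show "measure M (discrepancy_failure T d) \<le> 4 / real n" .
qed

lemma visits_eq:
  assumes "\<omega> \<in> space M"
  shows "visits n X T \<omega> y = (\<Sum>t<T. of_bool (X (Suc t) \<omega> = y))"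
proof -
  have "visits n X T \<omega> y = (\<Sum>t<T. \<Sum>x=1..n. of_bool (X (Suc t) \<omega> = y) * of_bool (X t \<omega> = x))"
    unfolding visits_def transition_count_def
    by (subst sum.swap) (intro sum.cong refl, auto)
  also have "\<dots> = (\<Sum>t<T. of_bool (X (Suc t) \<omega> = y))"
    using X_in[OF assms] by (intro sum.cong refl sum_mult_of_bool[where f = "\<lambda>_. of_bool _"]) auto
  finally show ?thesis .
qed

lemma adapted_visits: "adapted T (\<lambda>\<omega>. visits n X T \<omega>)"
  unfolding adapted_def visits_def transition_count_def by (auto intro!: ext sum.cong)

lemma visits_tail:
  assumes T: "T \<ge> n" and d: "d = real T / real n" and w: "w \<in> {1..n}"
  shows "measure M {\<omega> \<in> space M. visits n X T \<omega> w > (2 * \<kappa> + 1) * d} \<le> 2 * exp ((2 * c - \<kappa>) * d)"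
proof -
  have d1: "d \<ge> 1" using T n_pos by (simp add: d)
  define b where "b = 2 * c / real n"
  have b0: "b \<ge> 0" using c_ge_1 by (simp add: b_def)
  have Tb: "real T * b = 2 * c * d" by (simp add: b_def d)
  have step: "two_step_avg (\<lambda>y z. exp (of_bool (z = w))) x \<le> exp b"
    if x: "x \<in> {1..n}" for x
  proof -
    have inner: "(\<Sum>z=1..n. P y z * exp (of_bool (z = w))) \<le> exp b" if y: "y \<in> {1..n}" for y
    proof -
      have "(\<Sum>z=1..n. P y z * exp (of_bool (z = w))) = (\<Sum>z=1..n. P y z + (exp 1 - 1) * (P y z * of_bool (w = z)))"
        by (intro sum.cong refl) (auto simp: algebra_simps)
      also have "\<dots> = 1 + (exp 1 - 1) * P y w"
        unfolding sum.distrib sum_distrib_left[symmetric] using P_sum[OF y] w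
        by (subst sum_mult_of_bool) auto
      also have "\<dots> \<le> 1 + 2 * (c / real n)"
        using exp_le P_upper[OF y w] P_nonneg[OF y w] by (intro add_left_mono mult_mono) auto
      also have "\<dots> \<le> exp b" unfolding b_def using exp_ge_add_one_self[of "2 * c / real n"] by simp
      finally show ?thesis .
    qed
    have "two_step_avg (\<lambda>y z. exp (of_bool (z = w))) x \<le> (\<Sum>y=1..n. P x y * exp b)"
      using x by (intro sum_mono mult_left_mono inner P_nonneg)
    also have "\<dots> = exp b" using P_sum[OF x] by (simp add: sum_distrib_right[symmetric])
    finally show ?thesis .
  qed
  note tail = triple_sum_tail[where g = "\<lambda>x y z. of_bool (z = w)", OF b0 step, of "\<kappa> * d" T]
  have "{\<omega> \<in> space M. visits n X T \<omega> w > (2 * \<kappa> + 1) * d}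
      \<subseteq> {\<omega> \<in> space M. (\<Sum>t<T - 1. of_bool (X (Suc (Suc t)) \<omega> = w)) > 2 * (\<kappa> * d)}"
  proof safe
    fix \<omega> assume \<omega>: "\<omega> \<in> space M" and v: "visits n X T \<omega> w > (2 * \<kappa> + 1) * d"
    have "T > 0" using T n_pos by simp
    then have "visits n X T \<omega> w = of_bool (X 1 \<omega> = w) + (\<Sum>t<T - 1. of_bool (X (Suc (Suc t)) \<omega> = w))"
      unfolding visits_eq[OF \<omega>] by (cases T) (simp_all add: sum.lessThan_Suc_shift del: sum.lessThan_Suc sum_of_bool_eq)
    also have "\<dots> \<le> d + (\<Sum>t<T - 1. of_bool (X (Suc (Suc t)) \<omega> = w))" using d1 by (intro add_right_mono) auto
    finally show "(\<Sum>t<T - 1. of_bool (X (Suc (Suc t)) \<omega> = w)) > 2 * (\<kappa> * d)" using v by (simp add: algebra_simps)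
  qed
  then have "measure M {\<omega> \<in> space M. visits n X T \<omega> w > (2 * \<kappa> + 1) * d}
      \<le> measure M {\<omega> \<in> space M. (\<Sum>t<T - 1. of_bool (X (Suc (Suc t)) \<omega> = w)) > 2 * (\<kappa> * d)}"
    by (intro finite_measure_mono tail(1))
  also have "\<dots> \<le> 2 * exp (real T * b - \<kappa> * d)" by (rule tail(2))
  finally show ?thesis by (simp only: Tb left_diff_distrib)
qed

lemma many_busy_states:
  assumes T: "T \<ge> n" and d: "d = real T / real n" and r: "r > 0"
  shows "{\<omega> \<in> space M. real (card (busy_states n X T \<omega> ((2 * \<kappa> + 1) * d))) \<ge> r} \<in> sets M"
    and "measure M {\<omega> \<in> space M. real (card (busy_states n X T \<omega> ((2 * \<kappa> + 1) * d))) \<ge> r}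
         \<le> 2 * real n * exp ((2 * c - \<kappa>) * d) / r"
proof -
  define Z where "Z \<omega> = real (card (busy_states n X T \<omega> ((2 * \<kappa> + 1) * d)))" for \<omega>
  have Z0: "Z \<omega> \<ge> 0" for \<omega> by (simp add: Z_def)
  have adZ: "adapted T Z"
    unfolding Z_def using adapted_comp[OF adapted_visits, of T "\<lambda>V. real (card {w \<in> {1..n}. V w > (2 * \<kappa> + 1) * d})"] by simp
  have "{\<omega> \<in> space M. Z \<omega> \<ge> r} \<in> sets M" by (rule adapted_event_sets[OF adapted_comp[OF adZ]])
  then show "{\<omega> \<in> space M. real (card (busy_states n X T \<omega> ((2 * \<kappa> + 1) * d))) \<ge> r} \<in> sets M"
    by (simp only: Z_def)
  define F where "F w = {\<omega> \<in> space M. visits n X T \<omega> w > (2 * \<kappa> + 1) * d}" for w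
  have F_sets: "F w \<in> sets M" for w
    unfolding F_def by (rule adapted_event_sets[OF adapted_comp[OF adapted_visits]])
  have Z_sum: "Z \<omega> = (\<Sum>w=1..n. indicator (F w) \<omega>)" if "\<omega> \<in> space M" for \<omega>
  proof -
    have "(\<Sum>w=1..n. indicator (F w) \<omega>) = (\<Sum>w\<in>busy_states n X T \<omega> ((2 * \<kappa> + 1) * d). 1 :: real)"
      using that by (intro sum.mono_neutral_cong_right) (auto simp: F_def indicator_def)
    then show ?thesis by (simp add: Z_def)
  qed
  have "measure M {\<omega> \<in> space M. Z \<omega> \<ge> r} \<le> (\<integral>\<omega>. Z \<omega> \<partial>M) / r"
    by (rule integral_Markov_inequality_measure[where A = "{}"]) (use r adapted_integrable[OF adZ] Z0 in auto)
  also have "(\<integral>\<omega>. Z \<omega> \<partial>M) = (\<integral>\<omega>. (\<Sum>w=1..n. indicator (F w) \<omega>) \<partial>M)"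
    by (intro Bochner_Integration.integral_cong refl Z_sum)
  also have "\<dots> = (\<Sum>w=1..n. measure M (F w))"
    using F_sets by (subst Bochner_Integration.integral_sum) (auto simp: emeasure_eq_measure)
  also have "\<dots> \<le> (\<Sum>w=1..n. 2 * exp ((2 * c - \<kappa>) * d))"
    unfolding F_def by (intro sum_mono visits_tail[OF T d])
  finally have "measure M {\<omega> \<in> space M. Z \<omega> \<ge> r} \<le> (real n * (2 * exp ((2 * c - \<kappa>) * d))) / r"
    using r by (simp add: divide_right_mono)
  then show "measure M {\<omega> \<in> space M. real (card (busy_states n X T \<omega> ((2 * \<kappa> + 1) * d))) \<ge> r}
         \<le> 2 * real n * exp ((2 * c - \<kappa>) * d) / r"
    by (simp only: Z_def mult_ac)
qed

end

section \<open>The spectral norm for a fixed number of states\<close>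

text \<open>The constant in the norm bound when all kept states have at most L d visits. The summands
  come from the light pairs, the heavy pairs in the counts, the heavy pairs and the trimmed states in
  the mean, and the transition at time 0. The rate 37 beats the number of pairs of net vectors,
  which is at most exp (36 n).\<close>

definition spectral_const :: "real \<Rightarrow> real \<Rightarrow> real \<Rightarrow> real" where
  "spectral_const \<delta> c L = light_const \<delta> c 37 + (2 * L + 360 * exp 3 + 2 * exp 5 * c\<^sup>2) + 3 * c\<^sup>2 + 1"

lemma spectral_const_pos:
  assumes "\<delta> > 0" "L \<ge> 0"
  shows "spectral_const \<delta> c L > 0"
proof -
  have "poisson_const \<delta> c \<ge> 0" using assms by (simp add: poisson_const_def)
  then have "light_const \<delta> c 37 \<ge> 0"
    by (auto simp: light_const_def increment_const_def variance_const_def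
        intro!: add_nonneg_nonneg mult_nonneg_nonneg divide_nonneg_nonneg)
  then show ?thesis using assms unfolding spectral_const_def by (intro add_nonneg_pos add_nonneg_nonneg) auto
qed

context flat_markov_chain
begin

lemma mean_count_bounds:
  assumes "x \<in> {1..n}" "y \<in> {1..n}" and d: "d = real T / real n"
  shows "0 \<le> mean_count M X T x y" "mean_count M X T x y \<le> c\<^sup>2 * d / real n"
proof -
  show "0 \<le> mean_count M X T x y"
    unfolding mean_count_eq[OF assms(1,2)] using assms by (intro mult_nonneg_nonneg \<pi>_facts(1) P_nonneg) auto
  have "\<pi> x * P x y \<le> (c / real n) * (c / real n)"
    using assms c_ge_1 by (intro mult_mono \<pi>_upper P_upper P_nonneg) auto
  then have "real T * (\<pi> x * P x y) \<le> real T * ((c / real n) * (c / real n))" by (intro mult_left_mono) auto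
  also have "\<dots> = c\<^sup>2 * d / real n" by (simp add: d power2_eq_square)
  finally show "mean_count M X T x y \<le> c\<^sup>2 * d / real n" by (simp add: mean_count_eq[OF assms(1,2)])
qed

lemma late_count_nonneg: "late_count T \<omega> x y \<ge> 0"
  unfolding late_count_def by (intro sum_nonneg) auto

lemma late_count_row_le:
  assumes "\<omega> \<in> space M"
  shows "(\<Sum>y=1..n. late_count T \<omega> x y) \<le> visits n X T \<omega> x" "(\<Sum>y=1..n. late_count T \<omega> y x) \<le> visits n X T \<omega> x"
proof -
  have "(\<Sum>y=1..n. late_count T \<omega> x y) = (\<Sum>t<T - 1. \<Sum>y=1..n. of_bool (X (Suc t) \<omega> = x) * of_bool (X (Suc (Suc t)) \<omega> = y))"
    unfolding late_count_def by (subst sum.swap) (intro sum.cong refl, auto)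
  also have "\<dots> = (\<Sum>t<T - 1. of_bool (X (Suc t) \<omega> = x))"
    using X_in[OF assms] by (intro sum.cong refl sum_mult_of_bool[where f = "\<lambda>_. of_bool _"]) auto
  also have "\<dots> \<le> (\<Sum>t<T. of_bool (X (Suc t) \<omega> = x))" by (intro sum_mono2) auto
  finally show "(\<Sum>y=1..n. late_count T \<omega> x y) \<le> visits n X T \<omega> x" unfolding visits_eq[OF assms] .
  show "(\<Sum>y=1..n. late_count T \<omega> y x) \<le> visits n X T \<omega> x"
    unfolding visits_def
  proof (intro sum_mono)
    fix y
    show "late_count T \<omega> y x \<le> transition_count X T \<omega> y x"
      by (cases "T = 0") (simp_all add: transition_count_late, simp_all add: late_count_def transition_count_def)
  qed
qed

text \<open>On the good event. With u' and v' the restrictions of u and v to the kept states, the form of the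
  trimmed counts at (u, v) is the form of the full counts at (u', v'), whose vectors belong to the net
  as well. The mean is not trimmed; the correction is small because at most n exp (- d) states
  are removed and d exp (- d / 2) is at most sqrt d.\<close>

lemma net_bilinear_bound:
  assumes T: "T \<ge> n" and d: "d = real T / real n" and \<omega>: "\<omega> \<in> space M"
    and light: "\<And>z w. z \<in> lattice_net n \<Longrightarrow> w \<in> lattice_net n \<Longrightarrow>
      \<bar>light_deviation T d (net_vector n z) (net_vector n w) \<omega>\<bar>
        \<le> light_const \<delta> c 37 * sqrt d"
    and disc: "\<omega> \<notin> discrepancy_failure T d"
    and L: "L \<ge> 0" and busy: "\<And>y. y \<in> G \<Longrightarrow> visits n X T \<omega> y \<le> L * d"
    and G: "real (card ({1..n} - G)) \<le> real n * exp (- d)"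
    and zw: "z \<in> lattice_net n" "w \<in> lattice_net n"
  shows "\<bar>bilinear_sum n (\<lambda>x y. trimmed_count G X T \<omega> x y - mean_count M X T x y) (net_vector n z) (net_vector n w)\<bar>
         \<le> spectral_const \<delta> c L * sqrt d"
proof -
  have d1: "d \<ge> 1" using T n_pos by (simp add: d)
  have n0: "real n > 0" using n_pos by simp
  have sd: "sqrt d \<ge> 1" using d1 by simp
  define m where "m = mean_count M X T"
  have m: "0 \<le> m x y" "m x y \<le> c\<^sup>2 * d / real n" if "x \<in> {1..n}" "y \<in> {1..n}" for x y
    unfolding m_def by (rule mean_count_bounds[OF that d])+
  define u where "u = net_vector n z"
  define v where "v = net_vector n w"
  obtain z' where z': "z' \<in> lattice_net n" "\<And>x. x \<in> {1..n} \<Longrightarrow> net_vector n z' x = (if x \<in> G then u x else 0)"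
    using net_vector_restrict[OF zw(1), of G] unfolding u_def by blast
  obtain w' where w': "w' \<in> lattice_net n" "\<And>x. x \<in> {1..n} \<Longrightarrow> net_vector n w' x = (if x \<in> G then v x else 0)"
    using net_vector_restrict[OF zw(2), of G] unfolding v_def by blast
  define u' where "u' = net_vector n z'"
  define v' where "v' = net_vector n w'"
  have u'G: "u' x = (if x \<in> G then u x else 0)" and v'G: "v' x = (if x \<in> G then v x else 0)" if "x \<in> {1..n}" for x
    using z'(2) w'(2) that by (auto simp: u'_def v'_def)
  have nu: "sqnorm n u \<le> 1" "sqnorm n v \<le> 1" "sqnorm n u' \<le> 1" "sqnorm n v' \<le> 1"
    unfolding u_def v_def u'_def v'_def by (intro net_vector_norm zw z' w')+
  define first where "first x y = (of_bool (X 0 \<omega> = x \<and> X 1 \<omega> = y) :: real)" for x y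
  define heavy where "heavy x y = of_bool (\<bar>u' x * v' y\<bar> > sqrt d / real n) * (u' x * v' y)" for x y
  have split: "u' x * v' y = light_part n d u' v' x y + heavy x y" for x y
    by (simp add: light_part_def heavy_def)
  have T0: "T > 0" using T n_pos by simp
  have "bilinear_sum n (\<lambda>x y. trimmed_count G X T \<omega> x y - mean_count M X T x y) u v
      = (\<Sum>x=1..n. \<Sum>y=1..n. u' x * v' y * first x y + light_part n d u' v' x y * (late_count T \<omega> x y - m x y)
          + heavy x y * late_count T \<omega> x y - heavy x y * m x y - (u x * v y - u' x * v' y) * m x y)"
    unfolding bilinear_sum_def
  proof (intro sum.cong refl)
    fix x y assume xy: "x \<in> {1..n}" "y \<in> {1..n}"
    have "u x * v y * (trimmed_count G X T \<omega> x y - m x y)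
        = u' x * v' y * (first x y + late_count T \<omega> x y - m x y) - (u x * v y - u' x * v' y) * m x y"
      using xy by (simp add: trimmed_count_def u'G v'G transition_count_late[OF T0] first_def algebra_simps)
    also have "\<dots> = u' x * v' y * first x y + u' x * v' y * (late_count T \<omega> x y - m x y) - (u x * v y - u' x * v' y) * m x y"
      by (simp add: algebra_simps)
    also have "u' x * v' y * (late_count T \<omega> x y - m x y)
        = light_part n d u' v' x y * (late_count T \<omega> x y - m x y) + heavy x y * late_count T \<omega> x y - heavy x y * m x y"
      unfolding split by (simp add: algebra_simps)
    finally show "u x * v y * (trimmed_count G X T \<omega> x y - mean_count M X T x y)
        = u' x * v' y * first x y + light_part n d u' v' x y * (late_count T \<omega> x y - m x y)
          + heavy x y * late_count T \<omega> x y - heavy x y * m x y - (u x * v y - u' x * v' y) * m x y"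
      by (simp add: m_def)
  qed
  also have "\<dots> = (\<Sum>x=1..n. \<Sum>y=1..n. u' x * v' y * first x y)
      + (\<Sum>x=1..n. \<Sum>y=1..n. light_part n d u' v' x y * (late_count T \<omega> x y - m x y))
      + (\<Sum>x=1..n. \<Sum>y=1..n. heavy x y * late_count T \<omega> x y)
      - (\<Sum>x=1..n. \<Sum>y=1..n. heavy x y * m x y)
      - (\<Sum>x=1..n. \<Sum>y=1..n. (u x * v y - u' x * v' y) * m x y)"
    by (simp only: sum.distrib sum_subtractf)
  finally have decomp: "bilinear_sum n (\<lambda>x y. trimmed_count G X T \<omega> x y - mean_count M X T x y) u v = \<dots>" .
  have t1: "\<bar>\<Sum>x=1..n. \<Sum>y=1..n. u' x * v' y * first x y\<bar> \<le> sqrt d"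
  proof -
    have "(\<Sum>x=1..n. \<Sum>y=1..n. u' x * v' y * first x y)
        = (\<Sum>x=1..n. (\<Sum>y=1..n. u' x * v' y * of_bool (X 1 \<omega> = y)) * of_bool (X 0 \<omega> = x))"
      unfolding sum_distrib_right first_def by (intro sum.cong refl) auto
    also have "\<dots> = (\<Sum>y=1..n. u' (X 0 \<omega>) * v' y * of_bool (X 1 \<omega> = y))"
      by (rule sum_mult_of_bool[OF finite_atLeastAtMost X_in[OF \<omega>]])
    also have "\<dots> = u' (X 0 \<omega>) * v' (X 1 \<omega>)"
      by (rule sum_mult_of_bool[OF finite_atLeastAtMost X_in[OF \<omega>]])
    finally have eq: "(\<Sum>x=1..n. \<Sum>y=1..n. u' x * v' y * first x y) = u' (X 0 \<omega>) * v' (X 1 \<omega>)" .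
    have "\<bar>u' (X 0 \<omega>)\<bar> * \<bar>v' (X 1 \<omega>)\<bar> \<le> 1 * 1"
      by (intro mult_mono abs_coord_le_1[OF nu(3)] abs_coord_le_1[OF nu(4)] X_in \<omega>) auto
    then show ?thesis unfolding eq abs_mult using sd by linarith
  qed
  have t2: "\<bar>\<Sum>x=1..n. \<Sum>y=1..n. light_part n d u' v' x y * (late_count T \<omega> x y - m x y)\<bar> \<le> light_const \<delta> c 37 * sqrt d"
    unfolding u'_def v'_def m_def by (rule light[OF z'(1) w'(1)])
  have t3: "\<bar>\<Sum>x=1..n. \<Sum>y=1..n. heavy x y * late_count T \<omega> x y\<bar> \<le> (2 * L + 360 * exp 3 + 2 * exp 5 * c\<^sup>2) * sqrt d"
  proof -
    have "\<bar>\<Sum>x=1..n. \<Sum>y=1..n. heavy x y * late_count T \<omega> x y\<bar> \<le> (\<Sum>x=1..n. \<Sum>y=1..n. \<bar>heavy x y * late_count T \<omega> x y\<bar>)"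
      by (intro order_trans[OF sum_abs] sum_mono sum_abs)
    also have "\<dots> = (\<Sum>x=1..n. \<Sum>y=1..n. of_bool (\<bar>u' x * v' y\<bar> > sqrt d / real n) * (\<bar>u' x * v' y\<bar> * late_count T \<omega> x y))"
      by (simp add: heavy_def abs_mult late_count_nonneg mult.assoc)
    also have "\<dots> \<le> (2 * L + 60 * exp 3 * 6 + exp 5 * (2 * c\<^sup>2)) * sqrt d"
    proof (rule heavy_bound[OF n_pos d1 _ _ L late_count_nonneg nu(3,4)])
      fix x assume x: "x \<in> {1..n}"
      show "(\<Sum>y=1..n. late_count T \<omega> x y) \<le> L * d" if "u' x \<noteq> 0"
        using late_count_row_le(1)[OF \<omega>, of T x] busy[of x] that u'G[OF x] by (auto split: if_splits)
      show "(\<Sum>y=1..n. late_count T \<omega> y x) \<le> L * d" if "v' x \<noteq> 0"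
        using late_count_row_le(2)[OF \<omega>, of T x] busy[of x] that v'G[OF x] by (auto split: if_splits)
    next
      fix A B k assume "A \<subseteq> {1..n}" "B \<subseteq> {1..n}" "A \<noteq> {}" "B \<noteq> {}" "k \<le> n"
      then have "(A, B, k) \<in> (Pow {1..n} - {{}}) \<times> (Pow {1..n} - {{}}) \<times> {..n}" by auto
      then have "\<not> tilt d k * (\<Sum>x\<in>A. \<Sum>y\<in>B. late_count T \<omega> x y)
          > 2 * c\<^sup>2 * exp (tilt d k) * d * real (card A) * real (card B) / real n
          + 2 * (3 * (subset_entropy n (card A) + subset_entropy n (card B)))"
        using disc \<omega> unfolding discrepancy_failure_def by blast
      then show "tilt d k * (\<Sum>x\<in>A. \<Sum>y\<in>B. late_count T \<omega> x y) \<le> 6 * (subset_entropy n (card A) + subset_entropy n (card B))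
          + 2 * c\<^sup>2 * exp (tilt d k) * d * real (card A) * real (card B) / real n" by linarith
    qed auto
    finally show ?thesis by (simp add: mult_ac)
  qed
  have t4: "\<bar>\<Sum>x=1..n. \<Sum>y=1..n. heavy x y * m x y\<bar> \<le> c\<^sup>2 * sqrt d"
  proof -
    have "\<bar>\<Sum>x=1..n. \<Sum>y=1..n. heavy x y * m x y\<bar> \<le> (\<Sum>x=1..n. \<Sum>y=1..n. \<bar>heavy x y * m x y\<bar>)"
      by (intro order_trans[OF sum_abs] sum_mono sum_abs)
    also have "\<dots> \<le> (\<Sum>x=1..n. \<Sum>y=1..n. c\<^sup>2 * sqrt d * ((u' x)\<^sup>2 * (v' y)\<^sup>2))"
    proof (intro sum_mono)
      fix x y assume xy: "x \<in> {1..n}" "y \<in> {1..n}"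
      show "\<bar>heavy x y * m x y\<bar> \<le> c\<^sup>2 * sqrt d * ((u' x)\<^sup>2 * (v' y)\<^sup>2)"
      proof (cases "\<bar>u' x * v' y\<bar> > sqrt d / real n")
        case True
        define a where "a = \<bar>u' x * v' y\<bar>"
        have "\<bar>heavy x y * m x y\<bar> = a * m x y" using True m[OF xy] by (simp add: heavy_def abs_mult a_def)
        also have "\<dots> \<le> a * (c\<^sup>2 * d / real n)" using m[OF xy] by (intro mult_left_mono) (auto simp: a_def)
        also have "\<dots> = c\<^sup>2 * sqrt d * (a * (sqrt d / real n))"
          using d1 by simp
        also have "\<dots> \<le> c\<^sup>2 * sqrt d * (a * a)"
          using True d1 by (intro mult_left_mono) (auto simp: a_def)
        also have "a * a = (u' x)\<^sup>2 * (v' y)\<^sup>2"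
          by (simp add: a_def power_mult_distrib flip: power2_eq_square)
        finally show ?thesis .
      next
        case False
        then show ?thesis using d1 by (simp add: heavy_def)
      qed
    qed
    also have "\<dots> = c\<^sup>2 * sqrt d * (sqnorm n u' * sqnorm n v')"
      by (subst sum_product) (simp only: sum_distrib_left)
    also have "\<dots> \<le> c\<^sup>2 * sqrt d * (1 * 1)"
      using nu d1 by (intro mult_left_mono mult_mono) (auto intro: sum_nonneg)
    finally show ?thesis by simp
  qed
  have t5: "\<bar>\<Sum>x=1..n. \<Sum>y=1..n. (u x * v y - u' x * v' y) * m x y\<bar> \<le> 2 * c\<^sup>2 * sqrt d"
  proof -
    define out where "out f x = of_bool (x \<notin> G) * \<bar>f x\<bar>" for f :: "nat \<Rightarrow> real" and x
    have out_sum: "(\<Sum>x=1..n. out f x) \<le> sqrt (real n * exp (- d))" if f: "sqnorm n f \<le> 1" for f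
    proof -
      have "(\<Sum>x=1..n. out f x) = (\<Sum>x\<in>{1..n} - G. \<bar>f x\<bar>)"
        unfolding out_def by (intro sum.mono_neutral_cong_right) auto
      also have "\<dots> \<le> sqrt (real (card ({1..n} - G)))"
      proof (rule sum_abs_le_sqrt)
        have "(\<Sum>x\<in>{1..n} - G. (f x)\<^sup>2) \<le> sqnorm n f" by (intro sum_mono2) auto
        then show "(\<Sum>x\<in>{1..n} - G. (f x)\<^sup>2) \<le> 1" using f by simp
      qed
      also have "\<dots> \<le> sqrt (real n * exp (- d))" using G by simp
      finally show ?thesis .
    qed
    have abs_sum: "(\<Sum>x=1..n. \<bar>f x\<bar>) \<le> sqrt (real n)" if f: "sqnorm n f \<le> 1" for f :: "nat \<Rightarrow> real"
      using sum_abs_le_sqrt[OF f] by simp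
    have "\<bar>\<Sum>x=1..n. \<Sum>y=1..n. (u x * v y - u' x * v' y) * m x y\<bar> \<le> (\<Sum>x=1..n. \<Sum>y=1..n. \<bar>(u x * v y - u' x * v' y) * m x y\<bar>)"
      by (intro order_trans[OF sum_abs] sum_mono sum_abs)
    also have "\<dots> \<le> (\<Sum>x=1..n. \<Sum>y=1..n. (c\<^sup>2 * d / real n) * (out u x * \<bar>v y\<bar>) + (c\<^sup>2 * d / real n) * (\<bar>u x\<bar> * out v y))"
    proof (intro sum_mono)
      fix x y assume xy: "x \<in> {1..n}" "y \<in> {1..n}"
      have "\<bar>u x * v y - u' x * v' y\<bar> \<le> out u x * \<bar>v y\<bar> + \<bar>u x\<bar> * out v y"
        unfolding u'G[OF xy(1)] v'G[OF xy(2)] out_def by (auto simp: abs_mult)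
      then have "\<bar>u x * v y - u' x * v' y\<bar> * m x y \<le> (out u x * \<bar>v y\<bar> + \<bar>u x\<bar> * out v y) * (c\<^sup>2 * d / real n)"
        using m[OF xy] by (intro mult_mono) (auto simp: out_def)
      moreover have "\<bar>(u x * v y - u' x * v' y) * m x y\<bar> = \<bar>u x * v y - u' x * v' y\<bar> * m x y"
        using m[OF xy] by (simp add: abs_mult)
      moreover have "(a + b) * k = k * a + k * b" for a b k :: real by (simp add: algebra_simps)
      ultimately show "\<bar>(u x * v y - u' x * v' y) * m x y\<bar> \<le> (c\<^sup>2 * d / real n) * (out u x * \<bar>v y\<bar>) + (c\<^sup>2 * d / real n) * (\<bar>u x\<bar> * out v y)"
        by metis
    qed
    also have "\<dots> = (c\<^sup>2 * d / real n) * ((\<Sum>x=1..n. out u x) * (\<Sum>y=1..n. \<bar>v y\<bar>)) + (c\<^sup>2 * d / real n) * ((\<Sum>x=1..n. \<bar>u x\<bar>) * (\<Sum>y=1..n. out v y))"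
      unfolding sum_product by (simp only: sum.distrib sum_distrib_left)
    also have "\<dots> \<le> (c\<^sup>2 * d / real n) * (sqrt (real n * exp (- d)) * sqrt (real n)) + (c\<^sup>2 * d / real n) * (sqrt (real n) * sqrt (real n * exp (- d)))"
      using d1 by (intro add_mono mult_left_mono mult_mono out_sum abs_sum nu) (auto intro!: sum_nonneg simp: out_def)
    also have "\<dots> = 2 * c\<^sup>2 * (d * sqrt (exp (- d)))"
    proof -
      have "sqrt (real n * exp (- d)) * sqrt (real n) = (sqrt (real n) * sqrt (real n)) * sqrt (exp (- d))"
        by (simp only: real_sqrt_mult mult_ac)
      then have s: "sqrt (real n * exp (- d)) * sqrt (real n) = real n * sqrt (exp (- d))" by simp
      show ?thesis
        unfolding mult.commute[of "sqrt (real n)" "sqrt (real n * exp (- d))"] s using n0 by simp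
    qed
    also have "d * sqrt (exp (- d)) = sqrt d * sqrt (d * exp (- d))" using d1 by (simp add: real_sqrt_mult)
    also have "\<dots> \<le> sqrt d * 1"
    proof (intro mult_left_mono)
      have "d \<le> exp d" using exp_ge_add_one_self[of d] by linarith
      then have "d * exp (- d) \<le> exp d * exp (- d)" by (intro mult_right_mono) auto
      also have "\<dots> = 1" by (simp add: exp_add[symmetric])
      finally show "sqrt (d * exp (- d)) \<le> 1" by simp
    qed (use d1 in auto)
    finally show ?thesis by (simp add: mult_left_mono)
  qed
  have "\<bar>bilinear_sum n (\<lambda>x y. trimmed_count G X T \<omega> x y - mean_count M X T x y) u v\<bar>
      \<le> sqrt d + light_const \<delta> c 37 * sqrt d + (2 * L + 360 * exp 3 + 2 * exp 5 * c\<^sup>2) * sqrt d + c\<^sup>2 * sqrt d + 2 * c\<^sup>2 * sqrt d"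
    unfolding decomp using t1 t2 t3 t4 t5 by linarith
  also have "\<dots> = spectral_const \<delta> c L * sqrt d" by (simp add: spectral_const_def algebra_simps)
  finally show ?thesis by (simp add: u_def v_def)
qed

text \<open>The event that the light part of the form is large at some pair of vectors of the net.\<close>

definition light_failure :: "nat \<Rightarrow> real \<Rightarrow> 'a set" where
  "light_failure T d = (\<Union>(z, w) \<in> lattice_net n \<times> lattice_net n.
     {\<omega> \<in> space M. \<bar>light_deviation T d (net_vector n z) (net_vector n w) \<omega>\<bar> > light_const \<delta> c 37 * sqrt d})"

lemma light_failure:
  assumes T: "T \<ge> n" and d: "d = real T / real n"
  shows "light_failure T d \<in> sets M" "measure M (light_failure T d) \<le> 4 * exp (- real n)"
proof -
  let ?E = "\<lambda>(z, w). {\<omega> \<in> space M. \<bar>light_deviation T d (net_vector n z) (net_vector n w) \<omega>\<bar> > light_const \<delta> c 37 * sqrt d}"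
  let ?N = "lattice_net n"
  have fin: "finite (?N \<times> ?N)" using finite_card_lattice_net by simp
  have E: "?E q \<in> sets M \<and> measure M (?E q) \<le> 4 * exp (- 37 * real n)" if "q \<in> ?N \<times> ?N" for q
  proof (cases q)
    case (Pair z w)
    then have "z \<in> ?N" "w \<in> ?N" using that by auto
    then show ?thesis unfolding Pair prod.case
      by (intro conjI light_tail[OF T d] net_vector_norm)
  qed
  have D: "light_failure T d = (\<Union>q\<in>?N \<times> ?N. ?E q)" by (simp add: light_failure_def)
  show "light_failure T d \<in> sets M" unfolding D using fin E by (intro sets.finite_UN) auto
  have "measure M (light_failure T d) \<le> (\<Sum>q\<in>?N \<times> ?N. measure M (?E q))"
    unfolding D using fin E by (intro measure_UNION_le) auto
  also have "\<dots> \<le> (\<Sum>q\<in>?N \<times> ?N. 4 * exp (- 37 * real n))" using E by (intro sum_mono) auto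
  also have "\<dots> = real (card ?N) * real (card ?N) * (4 * exp (- 37 * real n))" by (simp add: card_cartesian_product)
  also have "\<dots> \<le> exp (18 * real n) * exp (18 * real n) * (4 * exp (- 37 * real n))"
    by (intro mult_right_mono mult_mono finite_card_lattice_net) auto
  also have "\<dots> = 4 * exp (- real n)" by (simp add: exp_add[symmetric])
  finally show "measure M (light_failure T d) \<le> 4 * exp (- real n)" .
qed

text \<open>The set of kept states may be random in any way: all that matters is that few states are removed,
  and that no busy state is kept unless there are at least r busy states.\<close>

lemma trimmed_norm_tail:
  assumes T: "T \<ge> n" and d: "d = real T / real n" and \<kappa>: "\<kappa> \<ge> 0" and r: "r > 0"
    and G: "\<And>\<omega>. \<omega> \<in> space M \<Longrightarrow> G \<omega> \<subseteq> {1..n}"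
    and G_card: "\<And>\<omega>. \<omega> \<in> space M \<Longrightarrow> real (card ({1..n} - G \<omega>)) \<le> real n * exp (- d)"
    and G_busy: "\<And>\<omega> y. \<omega> \<in> space M \<Longrightarrow> y \<in> G \<omega> \<Longrightarrow> visits n X T \<omega> y > (2 * \<kappa> + 1) * d \<Longrightarrow>
        real (card (busy_states n X T \<omega> ((2 * \<kappa> + 1) * d))) \<ge> r"
  shows "measure M {\<omega> \<in> space M. \<bar>sigma_max (matrix_of n (trimmed_count (G \<omega>) X T \<omega>) - matrix_of n (mean_count M X T)) / sqrt d\<bar>
      > 2 * spectral_const \<delta> c (2 * \<kappa> + 1)}
     \<le> 8 / real n + 2 * real n * exp ((2 * c - \<kappa>) * d) / r"
proof -
  define C where "C = spectral_const \<delta> c (2 * \<kappa> + 1)"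
  define Bad where "Bad = {\<omega> \<in> space M. \<bar>sigma_max (matrix_of n (trimmed_count (G \<omega>) X T \<omega>) - matrix_of n (mean_count M X T)) / sqrt d\<bar>
      > 2 * C}"
  define H where "H = {\<omega> \<in> space M. real (card (busy_states n X T \<omega> ((2 * \<kappa> + 1) * d))) \<ge> r}"
  have d1: "d \<ge> 1" using T n_pos by (simp add: d)
  have C0: "C \<ge> 0" unfolding C_def using spectral_const_pos[OF \<delta>_pos, of "2 * \<kappa> + 1" c] \<kappa> by simp
  have sub: "Bad \<subseteq> (light_failure T d \<union> discrepancy_failure T d) \<union> H"
  proof (rule subsetI, rule ccontr)
    fix \<omega> assume w: "\<omega> \<in> Bad"
      and nf: "\<omega> \<notin> (light_failure T d \<union> discrepancy_failure T d) \<union> H"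
    have \<omega>: "\<omega> \<in> space M" using w by (simp add: Bad_def)
    let ?A = "\<lambda>x y. trimmed_count (G \<omega>) X T \<omega> x y - mean_count M X T x y"
    have net: "\<bar>bilinear_sum n ?A (net_vector n z) (net_vector n w)\<bar> \<le> C * sqrt d"
      if zw: "z \<in> lattice_net n" "w \<in> lattice_net n" for z w
      unfolding C_def
    proof (rule net_bilinear_bound[OF T d \<omega>])
      fix z w assume "z \<in> lattice_net n" "w \<in> lattice_net n"
      then show "\<bar>light_deviation T d (net_vector n z) (net_vector n w) \<omega>\<bar>
        \<le> light_const \<delta> c 37 * sqrt d"
        using nf \<omega> unfolding light_failure_def by fastforce
    next
      fix y assume "y \<in> G \<omega>"
      then show "visits n X T \<omega> y \<le> (2 * \<kappa> + 1) * d"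
        using G_busy[OF \<omega>, of y] nf \<omega> unfolding H_def by fastforce
    qed (use nf \<kappa> G_card[OF \<omega>] zw in auto)
    have bil: "\<bar>bilinear_sum n ?A u v\<bar> \<le> (2 * (C * sqrt d)) * sqrt (sqnorm n u) * sqrt (sqnorm n v)" for u v
      by (rule bilinear_bound_from_net[OF n_pos net])
    have "0 \<le> sigma_max (matrix_of n ?A)" "sigma_max (matrix_of n ?A) \<le> 2 * (C * sqrt d)"
      using C0 d1 by (intro sigma_max_bound[OF n_pos _ bil]; simp)+
    then have "\<bar>sigma_max (matrix_of n ?A) / sqrt d\<bar> \<le> 2 * C"
      using d1 by (simp add: pos_divide_le_eq)
    then show False using w unfolding Bad_def matrix_of_diff by simp
  qed
  have Hs: "H \<in> sets M" and Hm: "measure M H \<le> 2 * real n * exp ((2 * c - \<kappa>) * d) / r"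
    unfolding H_def by (rule many_busy_states[OF T d r])+
  note lf = light_failure[OF T d] and df = discrepancy_failure[OF T d]
  have "measure M Bad
      \<le> measure M ((light_failure T d \<union> discrepancy_failure T d) \<union> H)"
    using lf df Hs by (intro finite_measure_mono sub) auto
  also have "\<dots> \<le> measure M (light_failure T d \<union> discrepancy_failure T d) + measure M H"
    using lf df Hs by (intro measure_Un_le) auto
  also have "\<dots> \<le> (measure M (light_failure T d) + measure M (discrepancy_failure T d)) + measure M H"
    using lf df by (intro add_right_mono measure_Un_le) auto
  also have "\<dots> \<le> (4 * exp (- real n) + 4 / real n) + 2 * real n * exp ((2 * c - \<kappa>) * d) / r"
    by (intro add_mono lf df Hm)
  also have "4 * exp (- real n) \<le> 4 / real n"
  proof -
    have "real n \<le> exp (real n)" using exp_ge_add_one_self[of "real n"] by linarith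
    then show ?thesis using n_pos by (simp add: exp_minus field_simps)
  qed
  finally show ?thesis unfolding Bad_def C_def by simp
qed

end

section \<open>Block Markov chains and limits in probability\<close>

lemma cluster_size_lower:
  assumes bp: "bmc_parameters K \<alpha> p" and k: "k \<in> {1..K}" and n: "real n \<ge> 2 / \<alpha> k"
  shows "real n * \<alpha> k / 2 \<le> real (cluster_size K \<alpha> n k)"
proof -
  have \<alpha>: "\<And>j. j \<in> {1..K} \<Longrightarrow> \<alpha> j > 0" and sum\<alpha>: "(\<Sum>j=1..K. \<alpha> j) = 1" and K: "K \<ge> 1"
    using bp by (auto simp: bmc_parameters_def)
  have n\<alpha>: "real n * \<alpha> k \<ge> 2" using n \<alpha>[OF k] by (simp add: pos_divide_le_eq)
  show ?thesis
  proof (cases "k = 1")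
    case False
    have "real n * \<alpha> k - 1 \<le> real (nat \<lfloor>real n * \<alpha> k\<rfloor>)" by linarith
    then have "real n * \<alpha> k / 2 \<le> real (nat \<lfloor>real n * \<alpha> k\<rfloor>)" using n\<alpha> by linarith
    then show ?thesis using False unfolding cluster_size_def by (simp only: if_False)
  next
    case True
    have "(\<Sum>j=2..K. real (nat \<lfloor>real n * \<alpha> j\<rfloor>)) \<le> (\<Sum>j=2..K. real n * \<alpha> j)"
    proof (rule sum_mono)
      fix j assume "j \<in> {2..K}"
      then have "real n * \<alpha> j \<ge> 0" using \<alpha>[of j] by simp
      then show "real (nat \<lfloor>real n * \<alpha> j\<rfloor>) \<le> real n * \<alpha> j" by linarith
    qed
    also have "\<dots> = real n * (1 - \<alpha> 1)"
    proof -
      have "(\<Sum>j=1..K. \<alpha> j) = \<alpha> 1 + (\<Sum>j=Suc 1..K. \<alpha> j)" using K by (rule sum.atLeast_Suc_atMost)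
      then have "(\<Sum>j=2..K. \<alpha> j) = 1 - \<alpha> 1" using sum\<alpha> by (simp add: numeral_2_eq_2)
      then show ?thesis by (simp add: sum_distrib_left[symmetric])
    qed
    finally have "real n * \<alpha> 1 \<le> real n - real (\<Sum>j=2..K. nat \<lfloor>real n * \<alpha> j\<rfloor>)" by (simp add: algebra_simps)
    also have "\<dots> \<le> real (n - (\<Sum>j=2..K. nat \<lfloor>real n * \<alpha> j\<rfloor>))" by linarith
    also have "\<dots> = real (cluster_size K \<alpha> n k)" using True by (simp only: cluster_size_def if_True simp_thms)
    finally show ?thesis using True n\<alpha> by simp
  qed
qed

text \<open>For large n every cluster has between n a / 2 and n states, where a is the smallest ratio.\<close>

lemma bmc_flat:
  assumes bp: "bmc_parameters K \<alpha> p"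
  obtains \<delta> c n1 where "\<delta> > 0" "c > 0"
    "\<And>n. n \<ge> n1 \<Longrightarrow> clusters_nonempty K \<alpha> n"
    "\<And>n \<sigma> (M :: 'a measure) X. n \<ge> n1 \<Longrightarrow> block_markov_chain K \<alpha> p n \<sigma> M X \<Longrightarrow>
      \<exists>\<pi>. flat_markov_chain n (bmc_transition p n \<sigma>) \<pi> M X \<delta> c"
proof -
  have K: "K \<ge> 1" and \<alpha>: "\<And>j. j \<in> {1..K} \<Longrightarrow> \<alpha> j > 0" 
    and psum: "\<And>k. k \<in> {1..K} \<Longrightarrow> (\<Sum>l=1..K. p k l) = 1"
    and ppos: "\<And>k l. k \<in> {1..K} \<Longrightarrow> l \<in> {1..K} \<Longrightarrow> p k l > 0"
    using bp by (auto simp: bmc_parameters_def)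
  define a where "a = Min (\<alpha> ` {1..K})"
  define \<delta> where "\<delta> = Min ((\<lambda>(k, l). p k l) ` ({1..K} \<times> {1..K}))"
  have a: "a > 0" "\<And>j. j \<in> {1..K} \<Longrightarrow> a \<le> \<alpha> j" using K \<alpha> by (auto simp: a_def)
  have \<delta>: "\<delta> > 0" using K ppos by (subst \<delta>_def, subst Min_gr_iff) auto
  have \<delta>_le: "\<delta> \<le> p k l" if "k \<in> {1..K}" "l \<in> {1..K}" for k l
    using that unfolding \<delta>_def by (intro Min_le) auto
  have p_le: "p k l \<le> 1" if "k \<in> {1..K}" "l \<in> {1..K}" for k l
  proof -
    have "p k l \<le> (\<Sum>l=1..K. p k l)" using that ppos by (intro member_le_sum) (auto simp: less_imp_le)
    then show ?thesis using psum that by simp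
  qed
  define n1 where "n1 = nat \<lceil>2 / a\<rceil> + 1"
  have n1: "real n \<ge> 2 / \<alpha> j" "n > 0" if n: "n \<ge> n1" and j: "j \<in> {1..K}" for n j
  proof -
    have "2 / \<alpha> j \<le> 2 / a" using a(1) a(2)[OF j] by (intro divide_left_mono) auto
    also have "\<dots> \<le> real n1" unfolding n1_def by linarith
    finally show "real n \<ge> 2 / \<alpha> j" using n by linarith
    show "n > 0" using n by (simp add: n1_def)
  qed
  have size: "real n * a / 2 \<le> real (cluster_size K \<alpha> n k)" if "n \<ge> n1" "k \<in> {1..K}" for n k
  proof -
    have "real n * a / 2 \<le> real n * \<alpha> k / 2" using a(2)[OF that(2)] by (intro divide_right_mono mult_left_mono) auto
    also have "\<dots> \<le> real (cluster_size K \<alpha> n k)" by (rule cluster_size_lower[OF bp that(2) n1(1)[OF that]])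
    finally show ?thesis .
  qed
  have size_pos: "real n * a / 2 > 0" if "n \<ge> n1" for n
    using n1(2)[OF that, of 1] K a by simp
  have "clusters_nonempty K \<alpha> n" if n: "n \<ge> n1" for n
    unfolding clusters_nonempty_def using size[OF n] size_pos[OF n] by force
  moreover have "\<exists>\<pi>. flat_markov_chain n (bmc_transition p n \<sigma>) \<pi> M X \<delta> (2 / a)"
    if n: "n \<ge> n1" and bmc: "block_markov_chain K \<alpha> p n \<sigma> M X" for n \<sigma> X and M :: "'a measure"
  proof -
    have ca: "cluster_assignment K \<alpha> n \<sigma>" using bmc by (simp add: block_markov_chain_def)
    obtain \<pi> where \<pi>: "stationary_distribution n (bmc_transition p n \<sigma>) \<pi>" "markov_chain n (bmc_transition p n \<sigma>) \<pi> M X"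
      using bmc by (auto simp: block_markov_chain_def)
    have \<sigma>: "\<sigma> x \<in> {1..K}" if "x \<in> {1..n}" for x using ca that by (auto simp: cluster_assignment_def)
    have n0: "n > 0" using n1(2)[OF n, of 1] K by simp
    have cs: "real n * a / 2 \<le> real (card (cluster n \<sigma> k))" if "k \<in> {1..K}" for k
      using size[OF n that] ca that by (simp add: cluster_assignment_def)
    have cle: "real (card (cluster n \<sigma> k)) \<le> real n" for k
    proof -
      have "card (cluster n \<sigma> k) \<le> card {1..n}" unfolding cluster_def by (intro card_mono) auto
      then show ?thesis by simp
    qed
    have cpos: "real (card (cluster n \<sigma> k)) > 0" if "k \<in> {1..K}" for k
      using cs[OF that] size_pos[OF n] by linarith
    have "flat_markov_chain n (bmc_transition p n \<sigma>) \<pi> M X \<delta> (2 / a)"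
    proof
      show "n > 0" "\<delta> > 0" by fact+
      fix x assume x: "x \<in> {1..n}"
      show "(\<Sum>y=1..n. bmc_transition p n \<sigma> x y) = 1"
      proof -
        have inner: "(\<Sum>y\<in>cluster n \<sigma> k. bmc_transition p n \<sigma> x y) = p (\<sigma> x) k" if k: "k \<in> {1..K}" for k
        proof -
          have "(\<Sum>y\<in>cluster n \<sigma> k. bmc_transition p n \<sigma> x y)
              = (\<Sum>y\<in>cluster n \<sigma> k. p (\<sigma> x) k / real (card (cluster n \<sigma> k)))"
            by (intro sum.cong refl) (auto simp: bmc_transition_def cluster_def)
          then show ?thesis using cpos[OF k] by simp
        qed
        have "(\<Sum>y=1..n. bmc_transition p n \<sigma> x y) = (\<Sum>k=1..K. \<Sum>y\<in>cluster n \<sigma> k. bmc_transition p n \<sigma> x y)"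
          unfolding cluster_def by (rule sum.group[symmetric]) (use \<sigma> in auto)
        also have "\<dots> = (\<Sum>k=1..K. p (\<sigma> x) k)" by (rule sum.cong[OF refl inner])
        also have "\<dots> = 1" by (rule psum[OF \<sigma>[OF x]])
        finally show ?thesis .
      qed
      fix y assume y: "y \<in> {1..n}"
      have cy: "real (card (cluster n \<sigma> (\<sigma> y))) > 0" by (rule cpos[OF \<sigma>[OF y]])
      show "\<delta> / real n \<le> bmc_transition p n \<sigma> x y"
        unfolding bmc_transition_def
        using \<delta> cle cy \<delta>_le[OF \<sigma>[OF x] \<sigma>[OF y]] by (intro frac_le) auto
      have "bmc_transition p n \<sigma> x y \<le> 1 / (real n * a / 2)"
        unfolding bmc_transition_def
        using p_le[OF \<sigma>[OF x] \<sigma>[OF y]] ppos[OF \<sigma>[OF x] \<sigma>[OF y]] cs[OF \<sigma>[OF y]] size_pos[OF n] by (intro frac_le) auto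
      then show "bmc_transition p n \<sigma> x y \<le> 2 / a / real n" by (simp add: mult.commute)
    qed (fact \<pi>)+
    then show ?thesis by blast
  qed
  moreover have "2 / a > 0" using a by simp
  ultimately show ?thesis using \<delta> that by blast
qed

lemma trimmed_norm_in_prob:
  fixes P :: "nat \<Rightarrow> nat \<Rightarrow> nat \<Rightarrow> real" and M :: "nat \<Rightarrow> 'a measure"
    and X :: "nat \<Rightarrow> nat \<Rightarrow> 'a \<Rightarrow> nat" and T :: "nat \<Rightarrow> nat" and G :: "nat \<Rightarrow> 'a \<Rightarrow> nat set"
  assumes \<delta>: "\<delta> > 0" and \<kappa>: "\<kappa> \<ge> 0"
    and chain: "eventually (\<lambda>n. \<exists>\<pi>. flat_markov_chain n (P n) \<pi> (M n) (X n) \<delta> c) sequentially"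
    and T: "eventually (\<lambda>n. T n \<ge> n) sequentially"
    and r: "eventually (\<lambda>n. r n > 0) sequentially"
    and G: "eventually (\<lambda>n. \<forall>\<omega>\<in>space (M n). G n \<omega> \<subseteq> {1..n}
        \<and> real (card ({1..n} - G n \<omega>)) \<le> real n * exp (- (real (T n) / real n))) sequentially"
    and busy: "eventually (\<lambda>n. \<forall>\<omega>\<in>space (M n). \<forall>y\<in>G n \<omega>.
        visits n (X n) (T n) \<omega> y > (2 * \<kappa> + 1) * (real (T n) / real n) \<longrightarrow>
        real (card (busy_states n (X n) (T n) \<omega> ((2 * \<kappa> + 1) * (real (T n) / real n)))) \<ge> r n) sequentially"
    and lim: "(\<lambda>n. 8 / real n + 2 * real n * exp ((2 * c - \<kappa>) * (real (T n) / real n)) / r n) \<longlonglongrightarrow> 0"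
  shows "bigO_in_prob M
             (\<lambda>n \<omega>. sigma_max (matrix_of n (trimmed_count (G n \<omega>) (X n) (T n) \<omega>)
                               - matrix_of n (mean_count (M n) (X n) (T n))))
             (\<lambda>n. sqrt (real (T n) / real n))"
proof -
  define C where "C = 2 * spectral_const \<delta> c (2 * \<kappa> + 1)"
  have C: "C > 0" unfolding C_def using spectral_const_pos[OF \<delta>, of "2 * \<kappa> + 1" c] \<kappa> by simp
  define Q where "Q n = \<P>(\<omega> in M n. \<bar>sigma_max (matrix_of n (trimmed_count (G n \<omega>) (X n) (T n) \<omega>)
      - matrix_of n (mean_count (M n) (X n) (T n))) / sqrt (real (T n) / real n)\<bar> > C)" for n
  have Q: "\<exists>n0>0. \<forall>n>n0. Q n \<le> \<epsilon>" if \<epsilon>: "\<epsilon> > 0" for \<epsilon> :: real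
  proof -
    have "eventually (\<lambda>n. 8 / real n + 2 * real n * exp ((2 * c - \<kappa>) * (real (T n) / real n)) / r n < \<epsilon>) sequentially"
      using order_tendstoD(2)[OF lim \<epsilon>] .
    with chain T r G busy
    have "eventually (\<lambda>n. Q n \<le> \<epsilon>) sequentially"
    proof eventually_elim
      case (elim n)
      obtain \<pi> where "flat_markov_chain n (P n) \<pi> (M n) (X n) \<delta> c" using elim by blast
      then interpret flat_markov_chain n "P n" \<pi> "M n" "X n" \<delta> c .
      have "Q n
          \<le> 8 / real n + 2 * real n * exp ((2 * c - \<kappa>) * (real (T n) / real n)) / r n"
        unfolding Q_def C_def by (rule trimmed_norm_tail[OF _ refl \<kappa>]) (use elim in blast)+
      then show ?case using elim by linarith
    qed
    then obtain n0 where "\<And>n. n \<ge> n0 \<Longrightarrow> Q n \<le> \<epsilon>"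
      unfolding eventually_sequentially by blast
    then show ?thesis by (intro exI[of _ "Suc n0"]) auto
  qed
  show ?thesis unfolding bigO_in_prob_def using C Q[unfolded Q_def] by blast
qed

theorem theorem3:
  fixes K :: nat and \<alpha> :: "nat \<Rightarrow> real" and p :: "nat \<Rightarrow> nat \<Rightarrow> real"
    and \<sigma> :: "nat \<Rightarrow> nat \<Rightarrow> nat" and M :: "nat \<Rightarrow> 'a measure"
    and X :: "nat \<Rightarrow> nat \<Rightarrow> 'a \<Rightarrow> nat" and T :: "nat \<Rightarrow> nat"
  assumes "bmc_parameters K \<alpha> p"
    and "\<And>n. clusters_nonempty K \<alpha> n \<Longrightarrow> block_markov_chain K \<alpha> p n (\<sigma> n) (M n) (X n)"
    and "\<And>n. T n > 0"
  shows "((\<lambda>n. real (T n)) \<in> \<Omega>(\<lambda>n. real n * ln (real n)) \<longrightarrow>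
           bigO_in_prob M
             (\<lambda>n \<omega>. sigma_max (matrix_of n (transition_count (X n) (T n) \<omega>)
                               - matrix_of n (mean_count (M n) (X n) (T n))))
             (\<lambda>n. sqrt (real (T n) / real n)))
       \<and> ((\<lambda>n. real (T n)) \<in> \<omega>(\<lambda>n. real n) \<longrightarrow>
           (\<forall>\<Gamma> :: nat \<Rightarrow> 'a \<Rightarrow> nat set.
             (\<forall>n. clusters_nonempty K \<alpha> n \<longrightarrow> trimming n (T n) (M n) (X n) (\<Gamma> n)) \<longrightarrow>
             bigO_in_prob M
               (\<lambda>n \<omega>. sigma_max (matrix_of n (trimmed_count (\<Gamma> n \<omega>) (X n) (T n) \<omega>)
                                 - matrix_of n (mean_count (M n) (X n) (T n))))
               (\<lambda>n. sqrt (real (T n) / real n))))"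
proof -
  note bmc = assms(2)
  let ?d = "\<lambda>n. real (T n) / real n"
  obtain \<delta> c n1 where \<delta>: "\<delta> > 0" and c: "c > 0" and ne: "\<And>n. n \<ge> n1 \<Longrightarrow> clusters_nonempty K \<alpha> n"
    and flat: "\<And>n \<sigma> (M :: 'a measure) X. n \<ge> n1 \<Longrightarrow> block_markov_chain K \<alpha> p n \<sigma> M X \<Longrightarrow>
      \<exists>\<pi>. flat_markov_chain n (bmc_transition p n \<sigma>) \<pi> M X \<delta> c"
    using bmc_flat[OF assms(1), where 'a = 'a] by blast
  have chain: "eventually (\<lambda>n. \<exists>\<pi>. flat_markov_chain n (bmc_transition p n (\<sigma> n)) \<pi> (M n) (X n) \<delta> c) sequentially"
    using eventually_ge_at_top[of n1] by eventually_elim (intro flat bmc ne)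
  show ?thesis
  proof (intro conjI impI allI)
    assume growth: "(\<lambda>n. real (T n)) \<in> \<Omega>(\<lambda>n. real n * ln (real n))"
    obtain b where b: "b > 0" "eventually (\<lambda>n. norm (real (T n)) \<ge> b * norm (real n * ln (real n))) sequentially"
      using landau_omega.bigE[OF growth] by blast
    \<comment> \<open>The number of busy states is then at most of order 1 / n in expectation.\<close>
    define \<kappa> where "\<kappa> = 2 * c + 2 / b"
    have \<kappa>: "\<kappa> \<ge> 0" using c b by (simp add: \<kappa>_def)
    have "filterlim (\<lambda>n. ln (real n)) at_top sequentially"
      by (rule filterlim_compose[OF ln_at_top filterlim_real_sequentially])
    then have "eventually (\<lambda>n. ln (real n) \<ge> 1 / b) sequentially" by (simp add: filterlim_at_top)
    then have d: "eventually (\<lambda>n. n > 0 \<and> ?d n \<ge> b * ln (real n) \<and> ?d n \<ge> 1) sequentially"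
      using b(2) eventually_gt_at_top[of 0]
    proof eventually_elim
      case (elim n)
      have "1 / b > 0" using b(1) by simp
      then have ln0: "ln (real n) > 0" using elim by linarith
      have "real (T n) \<ge> b * (real n * ln (real n))" using elim ln0 by simp
      then have "?d n \<ge> b * ln (real n)" using elim by (simp add: pos_le_divide_eq mult_ac)
      moreover have "b * ln (real n) \<ge> b * (1 / b)" using elim b(1) by (intro mult_left_mono) auto
      moreover have "b * (1 / b) = 1" using b(1) by simp
      ultimately have "?d n \<ge> b * ln (real n)" "?d n \<ge> 1" by linarith+
      then show ?case using elim by blast
    qed
    have eq: "matrix_of n (transition_count (X n) (T n) \<omega>) = matrix_of n (trimmed_count {1..n} (X n) (T n) \<omega>)" for n \<omega>
      by (rule matrix_of_cong) (simp add: trimmed_count_def)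
    show "bigO_in_prob M
             (\<lambda>n \<omega>. sigma_max (matrix_of n (transition_count (X n) (T n) \<omega>)
                               - matrix_of n (mean_count (M n) (X n) (T n))))
             (\<lambda>n. sqrt (?d n))"
      unfolding eq
    proof (rule trimmed_norm_in_prob[OF \<delta> \<kappa> chain, where r = "\<lambda>_. 1"])
      show "eventually (\<lambda>n. T n \<ge> n) sequentially"
        using d by eventually_elim (auto simp: pos_le_divide_eq)
      \<comment> \<open>A kept busy state is itself counted among the busy states.\<close>
      show "eventually (\<lambda>n. \<forall>\<omega>\<in>space (M n). \<forall>y\<in>{1..n}.
        visits n (X n) (T n) \<omega> y > (2 * \<kappa> + 1) * ?d n \<longrightarrow>
        real (card (busy_states n (X n) (T n) \<omega> ((2 * \<kappa> + 1) * ?d n))) \<ge> 1) sequentially"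
      proof (intro always_eventually allI ballI impI)
        fix n \<omega> y assume "y \<in> {1..n}" "visits n (X n) (T n) \<omega> y > (2 * \<kappa> + 1) * ?d n"
        then have "y \<in> busy_states n (X n) (T n) \<omega> ((2 * \<kappa> + 1) * ?d n)" by simp
        then have "card (busy_states n (X n) (T n) \<omega> ((2 * \<kappa> + 1) * ?d n)) > 0"
          by (subst card_gt_0_iff) auto
        then show "real (card (busy_states n (X n) (T n) \<omega> ((2 * \<kappa> + 1) * ?d n))) \<ge> 1"
          by linarith
      qed
      show "(\<lambda>n. 8 / real n + 2 * real n * exp ((2 * c - \<kappa>) * ?d n) / 1) \<longlonglongrightarrow> 0"
      proof (rule tendsto_sandwich[OF _ _ tendsto_const])
        show "(\<lambda>n. 10 / real n) \<longlonglongrightarrow> 0" by (rule lim_const_over_n)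
        show "eventually (\<lambda>n. 0 \<le> 8 / real n + 2 * real n * exp ((2 * c - \<kappa>) * ?d n) / 1) sequentially"
          by simp
        show "eventually (\<lambda>n. 8 / real n + 2 * real n * exp ((2 * c - \<kappa>) * ?d n) / 1 \<le> 10 / real n) sequentially"
          using d
        proof eventually_elim
          case (elim n)
          define e where "e = ?d n"
          have "(2 * c - \<kappa>) * e = - (2 / b * e)" by (simp add: \<kappa>_def)
          also have "\<dots> \<le> - (2 / b * (b * ln (real n)))"
            using elim b by (intro le_imp_neg_le mult_left_mono) (auto simp: e_def)
          also have "\<dots> = - (2 * ln (real n))" using b by simp
          finally have "exp ((2 * c - \<kappa>) * e) \<le> exp (- (2 * ln (real n)))" by simp
          also have "\<dots> = 1 / (real n)\<^sup>2" using elim by (simp add: exp_minus exp_double inverse_eq_divide)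
          finally have "2 * real n * exp ((2 * c - \<kappa>) * e) \<le> 2 * real n * (1 / (real n)\<^sup>2)" by (intro mult_left_mono) auto
          also have "\<dots> = 2 / real n" using elim by (simp add: power2_eq_square)
          finally show ?case unfolding e_def[symmetric] by simp
        qed
      qed
    qed auto
  next
    fix \<Gamma> :: "nat \<Rightarrow> 'a \<Rightarrow> nat set"
    assume growth: "(\<lambda>n. real (T n)) \<in> \<omega>(\<lambda>n. real n)"
      and trim: "\<forall>n. clusters_nonempty K \<alpha> n \<longrightarrow> trimming n (T n) (M n) (X n) (\<Gamma> n)"
    \<comment> \<open>The expected number of busy states is then smaller than n exp (- d) by a factor exp (- d).\<close>
    define \<kappa> where "\<kappa> = 2 * c + 2"
    have \<kappa>: "\<kappa> \<ge> 0" using c by (simp add: \<kappa>_def)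
    have d: "eventually (\<lambda>n. ?d n \<ge> C) sequentially" if "C > 0" for C :: real
    proof -
      have "eventually (\<lambda>n. norm (real (T n)) \<ge> C * norm (real n)) sequentially"
        using landau_omega.smallD[OF growth that] .
      then show ?thesis using eventually_gt_at_top[of 0] by eventually_elim (simp add: pos_le_divide_eq)
    qed
    have \<Gamma>: "\<Gamma> n \<omega> \<subseteq> {1..n}" "real (card ({1..n} - \<Gamma> n \<omega>)) \<le> real n * exp (- ?d n)"
      "real n * exp (- ?d n) < real (card ({1..n} - \<Gamma> n \<omega>)) + 1"
      "\<And>x y. x \<in> {1..n} - \<Gamma> n \<omega> \<Longrightarrow> y \<in> \<Gamma> n \<omega> \<Longrightarrow> visits n (X n) (T n) \<omega> y \<le> visits n (X n) (T n) \<omega> x"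
      if n: "n \<ge> n1" and \<omega>: "\<omega> \<in> space (M n)" for n \<omega>
    proof -
      have tr: "trimming n (T n) (M n) (X n) (\<Gamma> n)" using trim ne[OF n] by blast
      then have meas: "\<Gamma> n \<in> M n \<rightarrow>\<^sub>M count_space (Pow {1..n})"
        and card: "int (card ({1..n} - \<Gamma> n \<omega>)) = \<lfloor>real n * exp (- ?d n)\<rfloor>"
        and top: "{1..n} - \<Gamma> n \<omega> \<noteq> {} \<Longrightarrow>
          Min (visits n (X n) (T n) \<omega> ` ({1..n} - \<Gamma> n \<omega>)) \<ge> Max (visits n (X n) (T n) \<omega> ` \<Gamma> n \<omega>)"
        using \<omega> by (auto simp: trimming_def)
      show sub: "\<Gamma> n \<omega> \<subseteq> {1..n}" using measurable_space[OF meas \<omega>] by simp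
      show "real (card ({1..n} - \<Gamma> n \<omega>)) \<le> real n * exp (- ?d n)"
        "real n * exp (- ?d n) < real (card ({1..n} - \<Gamma> n \<omega>)) + 1"
        using card by linarith+
      fix x y assume x: "x \<in> {1..n} - \<Gamma> n \<omega>" and y: "y \<in> \<Gamma> n \<omega>"
      have fin: "finite (\<Gamma> n \<omega>)" using sub finite_subset by blast
      have "visits n (X n) (T n) \<omega> y \<le> Max (visits n (X n) (T n) \<omega> ` \<Gamma> n \<omega>)" using fin y by (intro Max_ge) auto
      also have "\<dots> \<le> Min (visits n (X n) (T n) \<omega> ` ({1..n} - \<Gamma> n \<omega>))" using top x by blast
      also have "\<dots> \<le> visits n (X n) (T n) \<omega> x" using x by (intro Min_le) auto
      finally show "visits n (X n) (T n) \<omega> y \<le> visits n (X n) (T n) \<omega> x" .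
    qed
    show "bigO_in_prob M
               (\<lambda>n \<omega>. sigma_max (matrix_of n (trimmed_count (\<Gamma> n \<omega>) (X n) (T n) \<omega>)
                                 - matrix_of n (mean_count (M n) (X n) (T n))))
               (\<lambda>n. sqrt (?d n))"
    proof (rule trimmed_norm_in_prob[OF \<delta> \<kappa> chain, where r = "\<lambda>n. real n * exp (- ?d n)"])
      show "eventually (\<lambda>n. T n \<ge> n) sequentially"
        using d[of 1, simplified] eventually_gt_at_top[of 0] by eventually_elim (simp add: pos_le_divide_eq)
      show "eventually (\<lambda>n. real n * exp (- ?d n) > 0) sequentially"
        using eventually_gt_at_top[of 0] by eventually_elim simp
      show "eventually (\<lambda>n. \<forall>\<omega>\<in>space (M n). \<Gamma> n \<omega> \<subseteq> {1..n}
        \<and> real (card ({1..n} - \<Gamma> n \<omega>)) \<le> real n * exp (- ?d n)) sequentially"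
        using eventually_ge_at_top[of n1] by eventually_elim (use \<Gamma> in blast)
      show "eventually (\<lambda>n. \<forall>\<omega>\<in>space (M n). \<forall>y\<in>\<Gamma> n \<omega>.
        visits n (X n) (T n) \<omega> y > (2 * \<kappa> + 1) * ?d n \<longrightarrow>
        real (card (busy_states n (X n) (T n) \<omega> ((2 * \<kappa> + 1) * ?d n)))
          \<ge> real n * exp (- ?d n)) sequentially"
        using eventually_ge_at_top[of n1]
      proof (eventually_elim, intro ballI impI)
        fix n \<omega> y assume n: "n1 \<le> n" and \<omega>: "\<omega> \<in> space (M n)" and y: "y \<in> \<Gamma> n \<omega>"
          and vy: "visits n (X n) (T n) \<omega> y > (2 * \<kappa> + 1) * ?d n"
        let ?B = "busy_states n (X n) (T n) \<omega> ((2 * \<kappa> + 1) * ?d n)"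
        \<comment> \<open>If a busy state is kept, all removed states are busy as well, and there are more than n exp (- d) - 1 of them.\<close>
        have "insert y ({1..n} - \<Gamma> n \<omega>) \<subseteq> ?B"
        proof
          fix x assume "x \<in> insert y ({1..n} - \<Gamma> n \<omega>)"
          then show "x \<in> ?B" using \<Gamma>(1)[OF n \<omega>] \<Gamma>(4)[OF n \<omega>, of x y] y vy by force
        qed
        then have "card (insert y ({1..n} - \<Gamma> n \<omega>)) \<le> card ?B" by (intro card_mono) auto
        moreover have "card (insert y ({1..n} - \<Gamma> n \<omega>)) = card ({1..n} - \<Gamma> n \<omega>) + 1" using y by simp
        ultimately show "real (card ?B) \<ge> real n * exp (- ?d n)"
          using \<Gamma>(3)[OF n \<omega>] by linarith
      qed
      have dlim: "filterlim (\<lambda>n. ?d n) at_top sequentially"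
        unfolding filterlim_at_top_gt[where c = 0] using d by blast
      have "((\<lambda>x::real. exp (- x)) \<longlongrightarrow> 0) at_top"
        by (rule filterlim_compose[OF exp_at_bot filterlim_uminus_at_bot_at_top])
      then have "(\<lambda>n. exp (- ?d n)) \<longlonglongrightarrow> 0"
        by (rule filterlim_compose[OF _ dlim])
      then have "(\<lambda>n. 8 / real n + 2 * exp (- ?d n)) \<longlonglongrightarrow> 0 + 2 * 0"
        by (intro tendsto_add tendsto_mult tendsto_const lim_const_over_n)
      moreover have "eventually (\<lambda>n. 8 / real n + 2 * exp (- ?d n)
          = 8 / real n + 2 * real n * exp ((2 * c - \<kappa>) * ?d n) / (real n * exp (- ?d n))) sequentially"
        using eventually_gt_at_top[of 0]
      proof eventually_elim
        case (elim n)
        define e where "e = ?d n"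
        have "exp ((2 * c - \<kappa>) * e) = exp (- e) * exp (- e)" by (simp add: \<kappa>_def exp_add[symmetric])
        then show ?case using elim unfolding e_def[symmetric] by simp
      qed
      ultimately show "(\<lambda>n. 8 / real n + 2 * real n * exp ((2 * c - \<kappa>) * ?d n) / (real n * exp (- ?d n))) \<longlonglongrightarrow> 0"
        by (simp add: tendsto_cong)
    qed
  qed
qed

end
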